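(* Let $\nu\in\mathbb{N}$, $\nu>2$, and let $\theta\in\Theta$ be sampled under $\mathcal{W}$ (the dim-$\nu$ order-$1$ Gaussian free field). For $\gamma\ge0$ let $PT_\theta^\gamma$ denote the set of all perfect $\gamma$-thick points of $\theta$, i.e. the set of all $x\in\overline{S(O,1)}$ such that $$\lim_{t\searrow0}\ \frac{\bar\theta_t(x)}{\sqrt{-G(t)\ln t}}=\sqrt{2\nu\gamma}.$$ If $\gamma>0$, then $PT_\theta^\gamma=\emptyset$ almost surely.
   Context: Gaussian free field. Let $H:=H^1(\mathbb{R}^\nu)$ be the closure of $C_c^\infty(\mathbb{R}^\nu)$ under the inner product $(\phi,\psi)_H:=((I-\Delta)\phi,\psi)_{L^2(\mathbb{R}^\nu)}$. Let $\Theta$ be a separable Banach space (of tempered distributions on $\mathbb{R}^\nu$) in which $H$ is continuously and densely embedded, and $\mathcal{W}$ a Borel probability measure on $\Theta$, such that $(H,\Theta,\mathcal{W})$ is an abstract Wiener space: for every $\lambda\in\Theta^*$, $\mathbb{E}^{\mathcal W}[\exp(i\langle\cdot,\lambda\rangle)]=\exp(-\|h_\lambda\|_H^2/2)$, where $h_\lambda\in H$ is the unique element with $\langle h,\lambda\rangle=(h,h_\lambda)_H$ for all $h\in H$. This triple is the dim-$\nu$ order-$1$ Gaussian free field; "a.s." refers to $\mathcal{W}$. The Paley-Wiener map $\mathcal{I}:H\to L^2(\mathcal{W})$ is the unique linear isometry extending $h_\lambda\mapsto\langle\cdot,\lambda\rangle$, $\lambda\in\Theta^*$; its images form a centered Gaussian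 family with $\mathbb{E}^{\mathcal W}[\mathcal I(h)\mathcal I(g)]=(h,g)_H$. For $\lambda\in H^{-1}(\mathbb{R}^\nu)$ put $h_\lambda:=(I-\Delta)^{-1}\lambda\in H$. Renormalized spherical averages. For $x\in\mathbb{R}^\nu$, $t>0$, let $\sigma^{ave}_{x,t}\in H^{-1}(\mathbb{R}^\nu)$ be the uniform probability measure on the sphere $\partial B(x,t)$ and $$\bar\sigma_{x,t}:=\frac{(t/2)^{\frac{\nu-2}{2}}}{\Gamma(\nu/2)\,I_{\frac{\nu-2}{2}}(t)}\,\sigma^{ave}_{x,t},\qquad \bar\theta_t(x):=\mathcal{I}(h_{\bar\sigma_{x,t}})(\theta),$$ where $I_{\frac{\nu-2}{2}},K_{\frac{\nu-2}{2}}$ are modified Bessel functions. The family $\{\bar\theta_t(x):x\in\mathbb{R}^\nu,t\in(0,1]\}$ is taken to be a modification for which $(x,t)\mapsto\bar\theta_t(x)$ is continuous for every $\theta\in\Theta$. The variance $G(t):=\mathbb{E}^{\mathcal W}[(\bar\theta_t(x))^2]=\frac{\alpha_\nu}{(2\pi)^\nu}\frac{K_{(\nu-2)/2}(t)}{I_{(\nu-2)/2}(t)}$, with $\alpha_\nu=2\pi^{\nu/2}/\Gamma(\nu/2)$, does not depend on $x$. $\overline{S(O,1)}$ is the closed cube in $\mathbb{R}^\nu$ centered at the origin with side length $2$ (i.e. $[-1,1]^\nu$). *)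

theory Defs
  imports "HOL-Probability.Probability"
begin

section \<open>Test functions, Schwartz functions, tempered distributions\<close>

definition partial_deriv :: "'a::euclidean_space \<Rightarrow> ('a \<Rightarrow> real) \<Rightarrow> 'a \<Rightarrow> real" where
  "partial_deriv i f x = frechet_derivative f (at x) i"

fun iter_partial :: "'a::euclidean_space list \<Rightarrow> ('a \<Rightarrow> real) \<Rightarrow> 'a \<Rightarrow> real" where
  "iter_partial [] f = f"
| "iter_partial (i # is) f = partial_deriv i (iter_partial is f)"

definition smooth :: "('a::euclidean_space \<Rightarrow> real) \<Rightarrow> bool" where
  "smooth f \<longleftrightarrow> (\<forall>is\<in>lists Basis. \<forall>x. iter_partial is f differentiable (at x))"

definition laplacian :: "('a::euclidean_space \<Rightarrow> real) \<Rightarrow> 'a \<Rightarrow> real" where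
  "laplacian f x = (\<Sum>i\<in>Basis. partial_deriv i (partial_deriv i f) x)"

definition test_function :: "('a::euclidean_space \<Rightarrow> real) \<Rightarrow> bool" where
  "test_function \<phi> \<longleftrightarrow> smooth \<phi> \<and> compact (closure {x. \<phi> x \<noteq> 0})"

definition schwartz :: "('a::euclidean_space \<Rightarrow> real) \<Rightarrow> bool" where
  "schwartz \<phi> \<longleftrightarrow> smooth \<phi> \<and>
     (\<forall>k. \<forall>is\<in>lists Basis. \<exists>M. \<forall>x. (1 + norm x) ^ k * \<bar>iter_partial is \<phi> x\<bar> \<le> M)"

text \<open>Continuity is expressed by domination by one of the Schwartz seminorms
  \<open>max\<close> over at most \<open>N\<close> derivatives of \<open>sup\<^sub>x (1 + \<bar>x\<bar>)\<^sup>N \<bar>D \<phi> x\<bar>\<close>;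
  the variable \<open>M\<close> ranges over the upper bounds of that seminorm at \<open>\<phi>\<close>.\<close>

definition tempered_distribution :: "(('a::euclidean_space \<Rightarrow> real) \<Rightarrow> real) \<Rightarrow> bool" where
  "tempered_distribution T \<longleftrightarrow>
     (\<forall>\<phi> \<psi> a b. schwartz \<phi> \<longrightarrow> schwartz \<psi> \<longrightarrow>
        T (\<lambda>x. a * \<phi> x + b * \<psi> x) = a * T \<phi> + b * T \<psi>) \<and>
     (\<exists>C N. \<forall>\<phi> M. schwartz \<phi> \<longrightarrow>
        (\<forall>is\<in>lists Basis. length is \<le> N \<longrightarrow>
           (\<forall>x. (1 + norm x) ^ N * \<bar>iter_partial is \<phi> x\<bar> \<le> M)) \<longrightarrow>
        \<bar>T \<phi>\<bar> \<le> C * M)"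


section \<open>The Sobolev space $H^1$ and its dual\<close>

text \<open>A Hilbert space \<open>'h\<close> is presented as the closure of the test functions under
  $((I-\Delta)\phi,\psi)_{L^2}$, realised inside $L^2$: \<open>rep h\<close> is a representative of the
  $L^2$ class of \<open>h\<close>. These conditions determine \<open>'h\<close> and \<open>rep\<close> up to isometry and null sets.\<close>

locale sobolev_H1 =
  fixes rep :: "'h::{real_inner, complete_space} \<Rightarrow> 'a::euclidean_space \<Rightarrow> real"
  assumes rep_measurable: "rep h \<in> borel_measurable lborel"
    and rep_square_integrable: "integrable lborel (\<lambda>x. (rep h x)\<^sup>2)"
    and rep_linear: "AE x in lborel. rep (a *\<^sub>R h + b *\<^sub>R g) x = a * rep h x + b * rep g x"
    and rep_inject: "(AE x in lborel. rep h x = rep g x) \<Longrightarrow> h = g"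
    and rep_L2_bound: "(\<integral>x. (rep h x)\<^sup>2 \<partial>lborel) \<le> (norm h)\<^sup>2"
    and rep_test_function: "test_function \<phi> \<Longrightarrow> \<exists>h. AE x in lborel. rep h x = \<phi> x"
    and inner_test_functions:
      "\<lbrakk>test_function \<phi>; test_function \<psi>;
        AE x in lborel. rep h x = \<phi> x; AE x in lborel. rep g x = \<psi> x\<rbrakk>
       \<Longrightarrow> inner h g = (\<integral>x. (\<phi> x - laplacian \<phi> x) * \<psi> x \<partial>lborel)"
    and test_functions_dense:
      "closure {h. \<exists>\<phi>. test_function \<phi> \<and> (AE x in lborel. rep h x = \<phi> x)} = UNIV"

text \<open>$(I-\Delta)^{-1}L$: the element of $H^1$ that solves $(I-\Delta)h=L$ in the sense of
  distributions. An element of $H^{-1}$ is given through its values on test functions.\<close>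

definition resolvent ::
  "('h \<Rightarrow> 'a::euclidean_space \<Rightarrow> real) \<Rightarrow> (('a \<Rightarrow> real) \<Rightarrow> real) \<Rightarrow> 'h" where
  "resolvent rep L = (THE h. \<forall>\<phi>. test_function \<phi> \<longrightarrow>
     (\<integral>x. rep h x * (\<phi> x - laplacian \<phi> x) \<partial>lborel) = L \<phi>)"


section \<open>Abstract Wiener spaces and the Paley-Wiener map\<close>

definition riesz ::
  "('h::real_inner \<Rightarrow> 'b::real_normed_vector) \<Rightarrow> ('b \<Rightarrow>\<^sub>L real) \<Rightarrow> 'h" where
  "riesz emb l = (THE h. \<forall>g. blinfun_apply l (emb g) = inner g h)"

locale abstract_wiener_space = prob_space W
  for W :: "'b::{banach, second_countable_topology} measure" +
  fixes emb :: "'h::{real_inner, complete_space} \<Rightarrow> 'b"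
  assumes sets_W: "sets W = sets borel"
    and emb_bounded_linear: "bounded_linear emb"
    and emb_inj: "inj emb"
    and emb_dense: "closure (range emb) = UNIV"
    and char_functional:
      "(\<integral>\<theta>. exp (\<i> * complex_of_real (blinfun_apply l \<theta>)) \<partial>W)
         = complex_of_real (exp (- (norm (riesz emb l))\<^sup>2 / 2))"

text \<open>Elements of $L^2(W)$ are given by representatives.\<close>

definition paley_wiener_map ::
  "'b::{banach, second_countable_topology} measure \<Rightarrow> ('h::real_inner \<Rightarrow> 'b)
     \<Rightarrow> ('h \<Rightarrow> 'b \<Rightarrow> real) \<Rightarrow> bool" where
  "paley_wiener_map W emb PW \<longleftrightarrow>
     (\<forall>h. PW h \<in> borel_measurable W \<and> integrable W (\<lambda>\<theta>. (PW h \<theta>)\<^sup>2)) \<and>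
     (\<forall>a b h g. AE \<theta> in W. PW (a *\<^sub>R h + b *\<^sub>R g) \<theta> = a * PW h \<theta> + b * PW g \<theta>) \<and>
     (\<forall>h. (\<integral>\<theta>. (PW h \<theta>)\<^sup>2 \<partial>W) = (norm h)\<^sup>2) \<and>
     (\<forall>l. AE \<theta> in W. PW (riesz emb l) \<theta> = blinfun_apply l \<theta>)"


section \<open>The order-1 Gaussian free field\<close>

text \<open>\<open>pairing \<theta>\<close> is the tempered distribution that \<open>\<theta>\<close> is; the last assumption says that
  \<open>emb\<close> identifies an element of $H^1$ with the distribution it defines.\<close>

locale gaussian_free_field =
  sobolev_H1 rep + abstract_wiener_space W emb
  for rep :: "'h::{real_inner, complete_space} \<Rightarrow> 'a::euclidean_space \<Rightarrow> real"
    and W :: "'b::{banach, second_countable_topology} measure"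
    and emb :: "'h \<Rightarrow> 'b" +
  fixes pairing :: "'b \<Rightarrow> ('a \<Rightarrow> real) \<Rightarrow> real"
  assumes pairing_tempered: "tempered_distribution (pairing \<theta>)"
    and pairing_linear: "schwartz \<psi> \<Longrightarrow>
      pairing (a *\<^sub>R \<theta> + b *\<^sub>R \<eta>) \<psi> = a * pairing \<theta> \<psi> + b * pairing \<eta> \<psi>"
    and pairing_inject: "(\<And>\<psi>. schwartz \<psi> \<Longrightarrow> pairing \<theta> \<psi> = pairing \<eta> \<psi>) \<Longrightarrow> \<theta> = \<eta>"
    and pairing_emb: "schwartz \<psi> \<Longrightarrow> pairing (emb h) \<psi> = (\<integral>x. rep h x * \<psi> x \<partial>lborel)"


section \<open>Renormalized spherical averages\<close>

text \<open>The uniform measure on the sphere is obtained as the radial projection of the uniform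
  measure on the unit ball; \<open>sgn y\<close> is \<open>y / \<bar>y\<bar>\<close>.\<close>

definition sphere_measure :: "'a::euclidean_space \<Rightarrow> real \<Rightarrow> 'a measure" where
  "sphere_measure x t = distr (uniform_measure lborel (ball 0 1)) borel (\<lambda>y. x + t *\<^sub>R sgn y)"

definition bessel_I :: "real \<Rightarrow> real \<Rightarrow> real" where
  "bessel_I \<alpha> t =
     (\<Sum>m. (t / 2) powr (2 * real m + \<alpha>) / (fact m * Gamma (real m + \<alpha> + 1)))"

definition renorm_const :: "real \<Rightarrow> real \<Rightarrow> real" where
  "renorm_const \<nu> t =
     (t / 2) powr ((\<nu> - 2) / 2) / (Gamma (\<nu> / 2) * bessel_I ((\<nu> - 2) / 2) t)"

definition renorm_sphere :: "'a::euclidean_space \<Rightarrow> real \<Rightarrow> ('a \<Rightarrow> real) \<Rightarrow> real" where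
  "renorm_sphere x t \<phi> =
     renorm_const (real DIM('a)) t * (\<integral>y. \<phi> y \<partial>sphere_measure x t)"

definition spherical_averages ::
  "('h \<Rightarrow> 'a::euclidean_space \<Rightarrow> real) \<Rightarrow> 'b::topological_space measure
     \<Rightarrow> ('h \<Rightarrow> 'b \<Rightarrow> real) \<Rightarrow> ('a \<Rightarrow> real \<Rightarrow> 'b \<Rightarrow> real) \<Rightarrow> bool" where
  "spherical_averages rep W PW avg \<longleftrightarrow>
     (\<forall>x. \<forall>t\<in>{0<..1}. avg x t \<in> borel_measurable W \<and>
        (AE \<theta> in W. avg x t \<theta> = PW (resolvent rep (renorm_sphere x t)) \<theta>)) \<and>
     (\<forall>\<theta>. continuous_on (UNIV \<times> {0<..1}) (\<lambda>(x, t). avg x t \<theta>))"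

text \<open>The variance does not depend on the centre of the sphere, so it is read off at the origin.\<close>

definition avg_variance ::
  "'b measure \<Rightarrow> ('a::euclidean_space \<Rightarrow> real \<Rightarrow> 'b \<Rightarrow> real) \<Rightarrow> real \<Rightarrow> real" where
  "avg_variance W avg t = (\<integral>\<theta>. (avg 0 t \<theta>)\<^sup>2 \<partial>W)"

definition perfect_thick_points ::
  "'b measure \<Rightarrow> ('a::euclidean_space \<Rightarrow> real \<Rightarrow> 'b \<Rightarrow> real) \<Rightarrow> real \<Rightarrow> 'b \<Rightarrow> 'a set" where
  "perfect_thick_points W avg \<gamma> \<theta> =
     {x \<in> cbox (- One) One.
        ((\<lambda>t. avg x t \<theta> / sqrt (- avg_variance W avg t * ln t))
           \<longlongrightarrow> sqrt (2 * real DIM('a) * \<gamma>)) (at_right 0)}"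

end

(* Let n > 2 be the dimension and Y(x, t) the spherical average divided by its standard deviation.
   At a perfect gamma-thick point x, Y(x, t) is of size sqrt (ln (1/t)) at all small scales t at
   once, so for fixed m and all large N the sum of Y(x, 2^(-N-k)) over k = 1..m exceeds
   q * m * sqrt N for some q > 0.

   Averages over geometrically separated scales are almost independent: this sum has variance at
   most B * m, so at a given x it exceeds q * m * sqrt N / 2 with probability at most
   exp (- const * m * N). Since the variance of Y(x, t) - Y(y, t) is at most C * dist x y / t, the
   sum over k is controlled on the whole cube by its values on the dyadic grid of mesh 2^(-4N),
   which has about 2^(4 n N) points. For m large the union bound is summable in N, and the
   Borel-Cantelli lemma excludes thick points.

   Both variance bounds come by duality from estimates of the spherical averages of a test
   function by the L2 norm of its gradient (integrate the gradient along rays, then apply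
   Cauchy-Schwarz in polar coordinates). The standard deviations are bounded below by testing
   against rescaled bump functions. The Gaussian tails follow from the characteristic functional
   and the density in H of the Riesz representatives of the continuous functionals, for which
   these have to separate points (Hahn-Banach). *)

theory Submission
  imports Defs
begin


text \<open>One scale is not enough: a union bound over a number of points exponential in N would
  have to be beaten by exp (- const * q^2 * N), which fails for small gamma. With m nearly
  independent scales the threshold grows like m and the variance also only like m, so the exponent
  gains a factor m while the grid does not depend on m. All constants in tails and variances may
  therefore be crude; they only enlarge m. The mesh exponent 4 leaves room for the chaining: between
  neighbours in a grid of level j >= 4 * N the increment has variance of order 2^(N - j) <= 2^(- 3 *
  j / 4), which decays in j uniformly in N. The elements of H that carry the averages are given by a
  definite description, so their norms are never computed. Upper bounds come from pairing with all
  test functions, the lower bound from pairing with a single one, and the Bessel factor cancels in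
  the quotient by the standard deviation.\<close>

section \<open>Representation in Hilbert space and Hahn-Banach separation\<close>

lemma linear_coeff_eq_0:
  fixes A B :: real
  assumes "\<And>\<tau>. \<tau> * A + \<tau>\<^sup>2 * B \<ge> 0" "B \<ge> 0"
  shows "A = 0"
proof -
  \<comment> \<open>Any \<tau> = - s * A with s > 0 and s * B < 1 gives a negative value unless A =
    0; s = 1 / (B + 1) needs no case split on B = 0.\<close>
  have "0 \<le> (- A / (B+1)) * A + (- A / (B+1))\<^sup>2 * B" by (rule assms(1))
  also have "\<dots> = - (A / (B+1))\<^sup>2"
    using assms(2) by (simp add: power2_eq_square divide_simps) (simp add: algebra_simps)
  finally show ?thesis using assms(2) by simp
qed

text \<open>The functional is given by its graph, so that it need not be known beforehand to be a
  function of its argument; the representing vector minimises \<open>\<parallel>v\<parallel>\<^sup>2/2 - r\<close> over the graph.\<close>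

lemma riesz_graph:
  fixes P :: "('h::{real_inner,complete_space} \<times> real) set"
  assumes P: "subspace P" and C: "\<And>v r. (v, r) \<in> P \<Longrightarrow> \<bar>r\<bar> \<le> C * norm v"
  shows "\<exists>u\<in>closure (fst ` P). \<forall>(v, r)\<in>P. inner v u = r"
proof -
  define F where "F p = (norm (fst p))\<^sup>2 / 2 - snd p" for p :: "'h \<times> real"
  have lower: "- C\<^sup>2 / 2 \<le> F p" if "p \<in> P" for p
  proof -
    have "snd p \<le> C * norm (fst p)" using C[of "fst p" "snd p"] that by auto
    moreover have "0 \<le> (norm (fst p) - C)\<^sup>2" by simp
    ultimately show ?thesis unfolding F_def by (simp add: power2_eq_square algebra_simps)
  qed
  have bdd: "bdd_below (F ` P)" using lower by (auto intro!: bdd_belowI2)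
  have ne: "P \<noteq> {}" using P subspace_0 by blast
  define I where "I = Inf (F ` P)"
  have I_le: "I \<le> F p" if "p \<in> P" for p
    unfolding I_def by (rule cInf_lower) (use that bdd in auto)
  have "\<exists>p\<in>P. F p < I + 1 / real (Suc n)" for n
  proof -
    have "Inf (F ` P) < I + 1 / real (Suc n)" unfolding I_def by simp
    then show ?thesis using cInf_lessD[of "F ` P"] ne by blast
  qed
  then obtain p where p: "\<And>n. p n \<in> P" "\<And>n. F (p n) < I + 1 / real (Suc n)" by metis
  \<comment> \<open>Parallelogram law: the midpoint of two approximate minimisers cannot fall below
    \<open>I\<close>, which forces their first components together. The linear part of
    \<open>F\<close> cancels.\<close>
  have par: "(norm (fst q - fst q'))\<^sup>2 / 4 \<le> F q + F q' - 2 * I" if "q \<in> P" "q' \<in> P" for q q'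
  proof -
    have "(1/2) *\<^sub>R (q + q') \<in> P" using P that by (simp add: subspace_add subspace_scale)
    from I_le[OF this] show ?thesis
      unfolding F_def
      by (simp add: power2_norm_eq_inner inner_simps inner_commute power_mult_distrib field_simps)
  qed
  have "Cauchy (\<lambda>n. fst (p n))"
  proof (rule CauchyI)
    fix e :: real assume "e > 0"
    then obtain M where M: "1 / real (Suc M) < e\<^sup>2 / 8"
      using nat_approx_posE[of "e\<^sup>2/8"] by auto
    show "\<exists>M. \<forall>m\<ge>M. \<forall>n\<ge>M. norm (fst (p m) - fst (p n)) < e"
    proof (intro exI[of _ M] allI impI)
      fix m n assume mn: "m \<ge> M" "n \<ge> M"
      have "1 / real (Suc m) \<le> 1 / real (Suc M)" "1 / real (Suc n) \<le> 1 / real (Suc M)"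
        using mn by (auto simp: frac_le)
      with par[OF p(1)[of m] p(1)[of n]] p(2)[of m] p(2)[of n] M
      have "(norm (fst (p m) - fst (p n)))\<^sup>2 < e\<^sup>2" by linarith
      then show "norm (fst (p m) - fst (p n)) < e"
        using \<open>e > 0\<close> by (simp add: power_less_imp_less_base)
    qed
  qed
  then obtain u where u: "(\<lambda>n. fst (p n)) \<longlonglongrightarrow> u"
    using Cauchy_convergent convergent_def by blast
  have "u \<in> closure (fst ` P)"
    unfolding closure_sequential using u p(1) by (auto intro!: exI[of _ "\<lambda>n. fst (p n)"])
  moreover have "inner v u = r" if vr: "(v, r) \<in> P" for v r
  proof -
    \<comment> \<open>\<open>P\<close> need not be closed, so the minimum need not be attained in
      it. The perturbation in direction \<open>(v, r)\<close> is made at the approximate minimisers,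
      and the limit is taken afterwards.\<close>
    have "\<tau> * (inner u v - r) + \<tau>\<^sup>2 * ((norm v)\<^sup>2 / 2) \<ge> 0" for \<tau>
    proof -
      have "- (1 / real (Suc n)) \<le> \<tau> * (inner (fst (p n)) v - r) + \<tau>\<^sup>2 * ((norm v)\<^sup>2 / 2)" for n
      proof -
        have "p n + \<tau> *\<^sub>R (v, r) \<in> P" by (rule subspace_add[OF P p(1) subspace_scale[OF P vr]])
        from I_le[OF this] have "I \<le> (norm (fst (p n) + \<tau> *\<^sub>R v))\<^sup>2 / 2 - (snd (p n) + \<tau> * r)"
          by (simp add: F_def)
        also have "(norm (fst (p n) + \<tau> *\<^sub>R v))\<^sup>2
            = (norm (fst (p n)))\<^sup>2 + 2 * (\<tau> * inner (fst (p n)) v) + \<tau>\<^sup>2 * (norm v)\<^sup>2"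
          unfolding power2_norm_eq_inner
          by (simp add: inner_add_left inner_add_right inner_commute[of v "fst (p n)"]) (simp add: power2_eq_square algebra_simps)
        finally show ?thesis using p(2)[of n] unfolding F_def
          by (simp add: right_diff_distrib add_divide_distrib)
      qed
      moreover have "(\<lambda>n. \<tau> * (inner (fst (p n)) v - r) + \<tau>\<^sup>2 * ((norm v)\<^sup>2 / 2))
          \<longlonglongrightarrow> \<tau> * (inner u v - r) + \<tau>\<^sup>2 * ((norm v)\<^sup>2 / 2)"
        by (intro tendsto_intros u)
      moreover have "(\<lambda>n. - (1 / real (Suc n))) \<longlonglongrightarrow> - 0"
        by (intro tendsto_minus LIMSEQ_inverse_real_of_nat[unfolded inverse_eq_divide])
      ultimately show ?thesis
        using LIMSEQ_le[of "\<lambda>n. - (1 / real (Suc n))"] by fastforce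
    qed
    then have "inner u v - r = 0" by (rule linear_coeff_eq_0) simp
    then show ?thesis by (simp add: inner_commute)
  qed
  ultimately show ?thesis by blast
qed

text \<open>Letting \<open>d\<close> tend to \<open>v\<close> itself turns the hypothesis into an
  upper bound for \<open>inner v v\<close>, so a one-sided bound on a dense set is enough. Every
  upper bound for a spherical element is obtained this way.\<close>

lemma norm_le_if_inner_le_dense:
  fixes v :: "'h::real_inner"
  assumes D: "v \<in> closure D" and le: "\<And>d. d \<in> D \<Longrightarrow> inner d v \<le> C * norm d" and "C \<ge> 0"
  shows "norm v \<le> C"
proof -
  obtain d where d: "\<And>n. d n \<in> D" "d \<longlonglongrightarrow> v" using D unfolding closure_sequential by auto
  have "inner v v \<le> C * norm v"
    by (rule LIMSEQ_le[of "\<lambda>n. inner (d n) v" _ "\<lambda>n. C * norm (d n)"])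
       (auto intro!: tendsto_intros d le)
  then have "norm v * norm v \<le> C * norm v"
    by (simp add: power2_norm_eq_inner[symmetric] power2_eq_square)
  then show ?thesis using \<open>C \<ge> 0\<close>
    by (cases "norm v = 0") (auto simp: mult_le_cancel_right)
qed

definition sublinear :: "('b::real_vector \<Rightarrow> real) \<Rightarrow> bool" where
  "sublinear q \<longleftrightarrow> (\<forall>x y. q (x + y) \<le> q x + q y) \<and> (\<forall>c\<ge>0. \<forall>x. q (c *\<^sub>R x) = c * q x)"

lemma sublinear_0: "sublinear q \<Longrightarrow> q 0 = 0"
  unfolding sublinear_def by (metis mult_zero_left order_refl scaleR_zero_left)

lemma sublinear_ge: "sublinear q \<Longrightarrow> - q (- x) \<le> q x"
  using sublinear_0[of q] unfolding sublinear_def by (metis add.right_inverse minus_le_iff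
    add.commute le_add_same_cancel1 minus_add_cancel diff_0 diff_le_eq add_0)

text \<open>Shifting a sublinear functional in a direction gives a smaller sublinear functional, and
  a sublinear functional fixed by all shifts is linear. Hence the minimal ones are linear, which
  replaces the extension argument in the Hahn-Banach theorem.\<close>

definition sublinear_shift :: "('b::real_vector \<Rightarrow> real) \<Rightarrow> 'b \<Rightarrow> 'b \<Rightarrow> real" where
  "sublinear_shift p w x = (INF t\<in>{0..}. p (x + t *\<^sub>R w) - t * p w)"

lemma
  assumes p: "sublinear p"
  shows sublinear_shift_le: "t \<ge> 0 \<Longrightarrow> sublinear_shift p w x \<le> p (x + t *\<^sub>R w) - t * p w"
    and sublinear_sublinear_shift: "sublinear (sublinear_shift p w)"
proof -
  have hom: "p (c *\<^sub>R x) = c * p x" if "c \<ge> 0" for c x using p that by (simp add: sublinear_def)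
  have sub: "p (x + y) \<le> p x + p y" for x y using p by (simp add: sublinear_def)
  \<comment> \<open>A lower bound free of \<open>t\<close>: it makes the infimum in
    \<open>sublinear_shift\<close> a genuine one.\<close>
  have low: "- p (- x) \<le> p (x + t *\<^sub>R w) - t * p w" if "t \<ge> 0" for x t
    using sub[of "x + t *\<^sub>R w" "- x"] hom[OF that, of w] by simp
  have bdd: "bdd_below ((\<lambda>t. p (x + t *\<^sub>R w) - t * p w) ` {0..})" for x
    using low by (auto intro!: bdd_belowI2)
  show le: "sublinear_shift p w x \<le> p (x + t *\<^sub>R w) - t * p w" if "t \<ge> 0" for t x
    unfolding sublinear_shift_def by (rule cINF_lower[OF bdd]) (use that in simp)
  have ge: "m \<le> sublinear_shift p w x" if "\<And>t. t \<ge> 0 \<Longrightarrow> m \<le> p (x + t *\<^sub>R w) - t * p w" for m x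
    unfolding sublinear_shift_def by (rule cINF_greatest) (use that in auto)
  have add: "sublinear_shift p w (x + y) \<le> sublinear_shift p w x + sublinear_shift p w y" for x y
  proof -
    have "sublinear_shift p w (x + y) - (p (y + t *\<^sub>R w) - t * p w) \<le> sublinear_shift p w x"
      if t: "t \<ge> 0" for t
    proof (rule ge)
      fix s :: real assume s: "s \<ge> 0"
      \<comment> \<open>Shift lengths add, which is why the infimum runs over all
        \<open>t \<ge> 0\<close> and not over a single length.\<close>
      have "sublinear_shift p w (x + y) \<le> p ((x + y) + (s + t) *\<^sub>R w) - (s + t) * p w"
        using s t by (intro le) auto
      also have "p ((x + y) + (s + t) *\<^sub>R w) \<le> p (x + s *\<^sub>R w) + p (y + t *\<^sub>R w)"
        using sub[of "x + s *\<^sub>R w" "y + t *\<^sub>R w"] by (simp add: algebra_simps)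
      finally show "sublinear_shift p w (x + y) - (p (y + t *\<^sub>R w) - t * p w)
          \<le> p (x + s *\<^sub>R w) - s * p w"
        by (simp add: algebra_simps)
    qed
    then have "sublinear_shift p w (x + y) - sublinear_shift p w x \<le> sublinear_shift p w y"
      by (intro ge) (simp add: algebra_simps)
    then show ?thesis by simp
  qed
  have scale: "sublinear_shift p w (c *\<^sub>R x) \<le> c * sublinear_shift p w x" if "c > 0" for c x
  proof -
    have "sublinear_shift p w (c *\<^sub>R x) / c \<le> sublinear_shift p w x"
    proof (rule ge)
      fix t :: real assume t: "t \<ge> 0"
      have "sublinear_shift p w (c *\<^sub>R x) \<le> p (c *\<^sub>R x + (c * t) *\<^sub>R w) - (c * t) * p w"
        using t that by (intro le) auto
      also have "\<dots> = c * (p (x + t *\<^sub>R w) - t * p w)"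
        using hom[of c "x + t *\<^sub>R w"] that by (simp add: algebra_simps)
      finally show "sublinear_shift p w (c *\<^sub>R x) / c \<le> p (x + t *\<^sub>R w) - t * p w"
        using that by (simp add: field_simps)
    qed
    then show ?thesis using that by (simp add: field_simps)
  qed
  have zero: "sublinear_shift p w 0 = 0"
    using ge[of 0 0] le[of 0 0] hom sublinear_0[OF p] by force
  have "sublinear_shift p w (c *\<^sub>R x) = c * sublinear_shift p w x" if "c \<ge> 0" for c x
  proof (cases "c = 0")
    case False
    with that have c: "c > 0" by simp
    have "sublinear_shift p w x \<le> (1/c) * sublinear_shift p w (c *\<^sub>R x)"
      using scale[of "1/c" "c *\<^sub>R x"] c by simp
    then show ?thesis using scale[OF c, of x] c by (simp add: field_simps)
  qed (simp add: zero)
  with add show "sublinear (sublinear_shift p w)" unfolding sublinear_def by blast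
qed

text \<open>Zorn's lemma, with the pointwise order reversed by \<open>R\<close>. A nonempty chain is
  bounded by its pointwise infimum, which is finite because every sublinear \<open>q \<le> p\<close>
  lies above \<open>- p (- x)\<close>.\<close>

lemma minimal_sublinear_below:
  fixes p :: "'b::real_vector \<Rightarrow> real"
  assumes p: "sublinear p"
  obtains q where "sublinear q" "q \<le> p" "\<And>q'. sublinear q' \<Longrightarrow> q' \<le> q \<Longrightarrow> q' = q"
proof -
  define A where "A = {q. sublinear q \<and> q \<le> p}"
  define R where "R a b \<longleftrightarrow> b \<le> a" for a b :: "'b \<Rightarrow> real"
  have po: "partial_order_on A (relation_of R A)"
    unfolding R_def by (rule partial_order_on_relation_ofI) auto
  have "\<exists>m\<in>A. \<forall>a\<in>A. R m a \<longrightarrow> a = m"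
  proof (rule predicate_Zorn[OF po])
    fix C assume "C \<in> Chains (relation_of R A)"
    then have CA: "C \<subseteq> A" and ch: "\<And>a b. a \<in> C \<Longrightarrow> b \<in> C \<Longrightarrow> a \<le> b \<or> b \<le> a"
      unfolding Chains_def relation_of_def R_def by auto
    show "\<exists>u\<in>A. \<forall>a\<in>C. R a u"
    proof (cases "C = {}")
      case True then show ?thesis using p by (auto simp: A_def)
    next
      case False
      define u where "u x = (INF q\<in>C. q x)" for x
      have low: "- p (- x) \<le> q x" if "q \<in> C" for q x
        using sublinear_ge[of q x] that CA unfolding A_def le_fun_def
        by (smt (verit, best) mem_Collect_eq subsetD)
      have bdd: "bdd_below ((\<lambda>q. q x) ` C)" for x using low by (auto intro!: bdd_belowI2)
      have ule: "u x \<le> q x" if "q \<in> C" for q x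
        unfolding u_def by (rule cINF_lower[OF bdd that])
      have uge: "m \<le> u x" if "\<And>q. q \<in> C \<Longrightarrow> m \<le> q x" for m x
        unfolding u_def by (rule cINF_greatest[OF False that])
      have subC: "q (x + y) \<le> q x + q y" and homC: "c \<ge> 0 \<Longrightarrow> q (c *\<^sub>R x) = c * q x"
        if "q \<in> C" for q x y c using that CA unfolding A_def sublinear_def by auto
      have "u (x + y) \<le> u x + u y" for x y
      proof -
        \<comment> \<open>The smaller of \<open>q\<close> and \<open>q'\<close> can be used in both
          summands; here the comparability of members of a chain enters.\<close>
        have "u (x + y) \<le> q x + q' y" if "q \<in> C" "q' \<in> C" for q q'
          using ch[OF that] ule[OF that(1), of "x+y"] ule[OF that(2), of "x+y"]
            subC[OF that(1), of x y] subC[OF that(2), of x y] unfolding le_fun_def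
          by (smt (verit))
        then have "u (x + y) - q' y \<le> u x" if "q' \<in> C" for q'
          using that by (intro uge) (simp add: algebra_simps)
        then have "u (x + y) - u x \<le> u y" by (intro uge) (simp add: algebra_simps)
        then show ?thesis by simp
      qed
      moreover have "u (c *\<^sub>R x) = c * u x" if "c \<ge> 0" for c x
      proof (cases "c = 0")
        case True
        have "(\<lambda>q. q 0) ` C = {0}" using False homC[of _ 0 0] by force
        then have "u 0 = 0" unfolding u_def by simp
        then show ?thesis using True by simp
      next
        case F: False
        with that have c: "c > 0" by simp
        have "u (c *\<^sub>R x) / c \<le> u x"
          using ule[of _ "c *\<^sub>R x"] homC c by (intro uge) (simp add: field_simps)
        moreover have "c * u x \<le> u (c *\<^sub>R x)"
        proof (rule uge)
          fix q assume q: "q \<in> C"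
          show "c * u x \<le> q (c *\<^sub>R x)"
            using mult_left_mono[OF ule[OF q, of x], of c] homC[OF q] c by simp
        qed
        ultimately show ?thesis using c by (simp add: field_simps)
      qed
      moreover have "u \<le> p"
        using False CA ule unfolding A_def le_fun_def by (metis (mono_tags, lifting) ex_in_conv
            mem_Collect_eq order_trans subset_eq)
      ultimately have "u \<in> A" unfolding A_def sublinear_def by simp
      then show ?thesis using ule unfolding R_def le_fun_def by blast
    qed
  qed
  then obtain q where "q \<in> A" and m: "\<And>a. a \<in> A \<Longrightarrow> a \<le> q \<Longrightarrow> a = q" unfolding R_def by blast
  show thesis
  proof (rule that[of q])
    fix q' assume "sublinear q'" "q' \<le> q"
    then show "q' = q" using m[of q'] \<open>q \<in> A\<close> unfolding A_def by auto
  qed (use \<open>q \<in> A\<close> in \<open>auto simp: A_def\<close>)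
qed

lemma blinfun_nonzero_exists:
  fixes w :: "'b::real_normed_vector"
  assumes "w \<noteq> 0"
  shows "\<exists>l :: 'b \<Rightarrow>\<^sub>L real. blinfun_apply l w \<noteq> 0"
proof -
  have N: "sublinear (norm :: 'b \<Rightarrow> real)" by (auto simp: sublinear_def norm_triangle_ineq)
  \<comment> \<open>Starting from this shift instead of the norm itself forces every functional
    below it to satisfy \<open>q (- w) \<le> - norm w\<close>, so that it cannot vanish at
    \<open>w\<close>.\<close>
  define p0 where "p0 = sublinear_shift norm w"
  obtain q where q: "sublinear q" "q \<le> p0" and min: "\<And>q'. sublinear q' \<Longrightarrow> q' \<le> q \<Longrightarrow> q' = q"
    using minimal_sublinear_below[of p0] sublinear_sublinear_shift[OF N] unfolding p0_def by blast
  have sub: "q (x + y) \<le> q x + q y" for x y using q(1) by (simp add: sublinear_def)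
  have hom: "q (c *\<^sub>R x) = c * q x" if "c \<ge> 0" for c x using q(1) that by (simp add: sublinear_def)
  have sup: "q x + q y \<le> q (x + y)" for x y
  proof -
    have "sublinear_shift q y \<le> q"
      using sublinear_shift_le[OF q(1), of 0 y] by (simp add: le_fun_def)
    then have "sublinear_shift q y = q" by (intro min sublinear_sublinear_shift q)
    then have "q x \<le> q (x + 1 *\<^sub>R y) - 1 * q y"
      using sublinear_shift_le[OF q(1), of 1 y x] by simp
    then show ?thesis by simp
  qed
  have add: "q (x + y) = q x + q y" for x y using sub[of x y] sup[of x y] by simp
  have neg: "q (- x) = - q x" for x using add[of x "- x"] sublinear_0[OF q(1)] by simp
  have scale: "q (c *\<^sub>R x) = c * q x" for c x
  proof (cases "c \<ge> 0")
    case False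
    then show ?thesis using hom[of "- c" x] neg[of "c *\<^sub>R x"] by simp
  qed (rule hom)
  have le: "q x \<le> norm x" for x
    using q(2) sublinear_shift_le[OF N, of 0 w x] by (fastforce simp: p0_def le_fun_def intro: order_trans)
  have "\<bar>q x\<bar> \<le> norm x" for x using le[of x] le[of "- x"] neg[of x] by simp
  then have "bounded_linear q" by (intro bounded_linear_intro[of _ 1]) (auto simp: add scale)
  then have app: "blinfun_apply (Blinfun q) = q" by (rule bounded_linear_Blinfun_apply)
  have "q (- w) \<le> - norm w"
    using q(2) sublinear_shift_le[OF N, of 1 w "- w"]
    by (fastforce simp: p0_def le_fun_def intro: order_trans)
  then have "q w \<noteq> 0" using assms neg[of w] by auto
  with app show ?thesis by (intro exI[of _ "Blinfun q"]) simp
qed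


section \<open>Riesz representatives and Gaussian tails in the Wiener space\<close>

context abstract_wiener_space
begin

text \<open>The existence and uniqueness behind the definite description in \<open>riesz\<close>;
  without them \<open>char_functional\<close> would say nothing about variances.\<close>

lemma riesz_inner: "blinfun_apply l (emb g) = inner g (riesz emb l)"
proof -
  interpret e: bounded_linear emb by (rule emb_bounded_linear)
  interpret le: bounded_linear "\<lambda>g. blinfun_apply l (emb g)"
    by (rule bounded_linear_compose[OF blinfun.bounded_linear_right emb_bounded_linear])
  define P where "P = range (\<lambda>g. (g, blinfun_apply l (emb g)))"
  have "subspace P"
    unfolding P_def
    by (intro subspaceI; force simp: zero_prod_def e.add e.scaleR e.zero blinfun.bilinear_simps intro: rev_image_eqI)
  moreover obtain C where "\<And>g. norm (blinfun_apply l (emb g)) \<le> norm g * C"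
    using le.bounded by blast
  ultimately obtain u where "\<forall>(v, r)\<in>P. inner v u = r"
    using riesz_graph[of P C] by (auto simp: P_def mult.commute)
  then have u: "\<forall>g. blinfun_apply l (emb g) = inner g u" by (auto simp: P_def)
  moreover have "h = u" if "\<forall>g. blinfun_apply l (emb g) = inner g h" for h
    using that u by (metis vector_eq_ldot)
  ultimately have "riesz emb l = u" unfolding riesz_def by (rule the_equality)
  with u show ?thesis by simp
qed

lemma riesz_add: "riesz emb (l + l') = riesz emb l + riesz emb l'"
  by (rule iffD1[OF vector_eq_ldot]) (auto simp: riesz_inner[symmetric] inner_add_right blinfun.add_left)

lemma riesz_scaleR: "riesz emb (c *\<^sub>R l) = c *\<^sub>R riesz emb l"
  by (rule iffD1[OF vector_eq_ldot]) (auto simp: riesz_inner[symmetric] blinfun.scaleR_left)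

text \<open>The functional \<open>inner _ v\<close> on the representatives is itself represented by
  some \<open>u\<close> in their closure. Then every continuous functional vanishes at
  \<open>emb (u - v)\<close>, so \<open>u = v\<close> by separation of points and injectivity of
  \<open>emb\<close>. This takes the place of an orthogonal projection.\<close>

lemma riesz_dense: "v \<in> closure (range (riesz emb))"
proof -
  interpret e: bounded_linear emb by (rule emb_bounded_linear)
  define P where "P = range (\<lambda>l. (riesz emb l, inner (riesz emb l) v))"
  have z: "riesz emb 0 = 0" using riesz_scaleR[of 0 0] by simp
  have "subspace P"
  proof (rule subspaceI)
    show "0 \<in> P" unfolding P_def by (rule image_eqI[of _ _ 0]) (auto simp: z zero_prod_def)
    fix x y c assume "x \<in> P" "y \<in> P"
    then obtain l l' where "x = (riesz emb l, inner (riesz emb l) v)"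
      "y = (riesz emb l', inner (riesz emb l') v)" by (auto simp: P_def)
    then have "x + y = (riesz emb (l + l'), inner (riesz emb (l + l')) v)"
      "c *\<^sub>R x = (riesz emb (c *\<^sub>R l), inner (riesz emb (c *\<^sub>R l)) v)"
      by (auto simp: riesz_add riesz_scaleR inner_add_left)
    then show "x + y \<in> P" "c *\<^sub>R x \<in> P" unfolding P_def by blast+
  qed
  moreover have "\<bar>r\<bar> \<le> norm v * norm w" if "(w, r) \<in> P" for w r
    using that Cauchy_Schwarz_ineq2[of w v] by (auto simp: P_def mult.commute)
  ultimately obtain u where u: "u \<in> closure (fst ` P)" "\<forall>(w, r)\<in>P. inner w u = r"
    using riesz_graph[of P "norm v"] by blast
  have "blinfun_apply l (emb (u - v)) = 0" for l :: "'b \<Rightarrow>\<^sub>L real"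
  proof -
    have "inner (riesz emb l) u = inner (riesz emb l) v" using u(2) by (auto simp: P_def)
    then show ?thesis by (simp add: riesz_inner inner_diff_left inner_diff_right inner_commute[of _ "riesz emb l"])
  qed
  then have "emb (u - v) = 0" using blinfun_nonzero_exists by blast
  then have "u = v" using emb_inj e.zero by (metis eq_iff_diff_eq_0 injD)
  then show ?thesis using u(1) by (simp add: P_def image_image)
qed

end

text \<open>Exponential tilting: for x >= z > 0 one has x^2 >= z^2 + (x - z)^2, so beyond z the
  standard density is at most exp (- z^2 / 2) times the density of the normal law with mean
  z.\<close>

lemma std_normal_tail:
  assumes "z > 0"
  shows "measure std_normal_distribution {z..} \<le> exp (- z\<^sup>2 / 2)"
proof -
  interpret N: prob_space "density lborel (normal_density z 1)"
    by (rule prob_space_normal_density) simp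
  have "emeasure std_normal_distribution {z..}
      = (\<integral>\<^sup>+x. ennreal (std_normal_density x) * indicator {z..} x \<partial>lborel)"
    by (subst emeasure_density) auto
  also have "\<dots> \<le> (\<integral>\<^sup>+x. ennreal (exp (- z\<^sup>2 / 2)) * ennreal (normal_density z 1 x) \<partial>lborel)"
  proof (rule nn_integral_mono)
    fix x :: real
    have "std_normal_density x \<le> exp (- z\<^sup>2 / 2) * normal_density z 1 x" if "z \<le> x"
    proof -
      have "- x\<^sup>2 / 2 \<le> - z\<^sup>2 / 2 + - (x - z)\<^sup>2 / 2"
        using assms that mult_left_mono[of z x z] by (simp add: power2_eq_square algebra_simps)
      then have "exp (- x\<^sup>2 / 2) \<le> exp (- z\<^sup>2 / 2) * exp (- (x - z)\<^sup>2 / 2)"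
        by (simp add: exp_add[symmetric])
      then show ?thesis by (simp add: normal_density_def divide_simps)
    qed
    then show "ennreal (std_normal_density x) * indicator {z..} x
        \<le> ennreal (exp (- z\<^sup>2 / 2)) * ennreal (normal_density z 1 x)"
      by (auto simp: indicator_def ennreal_mult[symmetric] intro!: ennreal_leI)
  qed
  also have "\<dots> = ennreal (exp (- z\<^sup>2 / 2)) * emeasure (density lborel (normal_density z 1)) UNIV"
    by (subst nn_integral_cmult) (auto simp: emeasure_density)
  also have "\<dots> = ennreal (exp (- z\<^sup>2 / 2))" using N.emeasure_space_1 by simp
  finally show ?thesis
    by (simp add: measure_def enn2real_leI)
qed

context abstract_wiener_space
begin

lemma blinfun_measurable[measurable]: "blinfun_apply l \<in> borel_measurable W"
  using sets_W by (simp add: measurable_cong_sets[OF sets_W refl]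
      borel_measurable_continuous_onI linear_continuous_on blinfun.bounded_linear_right)

text \<open>Applying \<open>char_functional\<close> to all multiples \<open>t *\<^sub>R l\<close>
  gives the whole characteristic function. The law is written as an image of the standard normal law
  so that variance 0 is covered.\<close>

lemma distr_blinfun:
  "distr W borel (blinfun_apply l) = distr std_normal_distribution borel (\<lambda>x. norm (riesz emb l) * x)"
proof (rule Levy_uniqueness)
  interpret S: prob_space std_normal_distribution by (rule prob_space_normal_density) simp
  show "real_distribution (distr W borel (blinfun_apply l))"
    by (auto simp: real_distribution_def real_distribution_axioms_def intro!: prob_space_distr)
  show "real_distribution (distr std_normal_distribution borel (\<lambda>x. norm (riesz emb l) * x))"
    by (auto simp: real_distribution_def real_distribution_axioms_def intro!: S.prob_space_distr)
  show "char (distr W borel (blinfun_apply l)) =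
      char (distr std_normal_distribution borel (\<lambda>x. norm (riesz emb l) * x))" (is "?L = ?R")
  proof
    fix t
    have "?L t = (\<integral>\<theta>. exp (\<i> * complex_of_real (blinfun_apply (t *\<^sub>R l) \<theta>)) \<partial>W)"
      unfolding char_def by (subst integral_distr) (auto simp: blinfun.scaleR_left)
    also have "\<dots> = complex_of_real (exp (- (norm (riesz emb (t *\<^sub>R l)))\<^sup>2 / 2))"
      by (rule char_functional)
    also have "\<dots> = char std_normal_distribution (t * norm (riesz emb l))"
      by (simp add: char_std_normal_distribution riesz_scaleR power_mult_distrib)
    also have "\<dots> = ?R t"
      unfolding char_def by (subst integral_distr) (auto simp: mult.assoc)
    finally show "?L t = ?R t" .
  qed
qed

lemma blinfun_tail:
  assumes V: "(norm (riesz emb l))\<^sup>2 \<le> V" and "V > 0" and a: "a > 0"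
  shows "prob {\<theta> \<in> space W. a \<le> blinfun_apply l \<theta>} \<le> exp (- a\<^sup>2 / (2 * V))"
proof -
  define s where "s = norm (riesz emb l)"
  have "prob {\<theta> \<in> space W. a \<le> blinfun_apply l \<theta>} = measure (distr W borel (blinfun_apply l)) {a..}"
    by (subst measure_distr) (auto intro!: arg_cong[where f=prob])
  also have "\<dots> = measure std_normal_distribution ((\<lambda>x. s * x) -` {a..})"
    unfolding distr_blinfun s_def by (subst measure_distr) auto
  also have "\<dots> \<le> exp (- a\<^sup>2 / (2 * V))"
  proof (cases "s = 0")
    case True
    then have "(\<lambda>x. s * x) -` {a..} = {}" using a by auto
    then show ?thesis by simp
  next
    case False
    then have s: "s > 0" by (simp add: s_def)
    then have "(\<lambda>x. s * x) -` {a..} = {a / s..}" by (auto simp: field_simps)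
    then have "measure std_normal_distribution ((\<lambda>x. s * x) -` {a..}) \<le> exp (- (a/s)\<^sup>2 / 2)"
      using std_normal_tail[of "a/s"] a s by simp
    also have "\<dots> \<le> exp (- a\<^sup>2 / (2 * V))"
      using V s \<open>V > 0\<close> unfolding s_def[symmetric]
      by (auto simp: power_divide divide_simps intro!: mult_left_mono)
    finally show ?thesis .
  qed
  finally show ?thesis .
qed

end

lemma paley_wiener_diff:
  assumes "paley_wiener_map W emb PW"
  shows "AE \<theta> in W. PW (h - g) \<theta> = PW h \<theta> - PW g \<theta>"
proof -
  have "AE \<theta> in W. PW (1 *\<^sub>R h + (-1) *\<^sub>R g) \<theta> = 1 * PW h \<theta> + (-1) * PW g \<theta>"
    using assms unfolding paley_wiener_map_def by blast
  then show ?thesis by simp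
qed

text \<open>\<open>PW h\<close> is approximated in L2 by continuous functionals. Half of the
  threshold is left to the functional, whose variance is eventually below 2 * V, and (a/2)^2 / (2 *
  2 * V) explains the 16. The other half bounds the error by Chebyshev's inequality, which
  contributes 0 in the limit.\<close>

lemma (in abstract_wiener_space) paley_wiener_tail:
  assumes PW: "paley_wiener_map W emb PW"
    and V: "(norm h)\<^sup>2 \<le> V" and "V > 0" and a: "a > 0"
  shows "prob {\<theta> \<in> space W. a \<le> PW h \<theta>} \<le> exp (- a\<^sup>2 / (16 * V))"
proof -
  have meas[measurable]: "PW g \<in> borel_measurable W"
    and sq: "integrable W (\<lambda>\<theta>. (PW g \<theta>)\<^sup>2)"
    and iso: "(\<integral>\<theta>. (PW g \<theta>)\<^sup>2 \<partial>W) = (norm g)\<^sup>2" for g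
    using PW unfolding paley_wiener_map_def by blast+
  obtain g where g: "\<And>k. g k \<in> range (riesz emb)" "g \<longlonglongrightarrow> h"
    using riesz_dense[of h] unfolding closure_sequential by blast
  have "\<forall>k. \<exists>l. g k = riesz emb l" using g(1) by blast
  from choice[OF this] obtain l where l: "\<And>k. g k = riesz emb (l k)" by blast
  have ev: "\<forall>\<^sub>F k in sequentially. (norm (g k))\<^sup>2 < 2 * V"
  proof (rule order_tendstoD(2))
    show "(\<lambda>k. (norm (g k))\<^sup>2) \<longlonglongrightarrow> (norm h)\<^sup>2" by (intro tendsto_intros g)
  qed (use V \<open>V > 0\<close> in simp)
  have bound: "prob {\<theta> \<in> space W. a \<le> PW h \<theta>}
      \<le> exp (- a\<^sup>2 / (16 * V)) + (norm (h - g k))\<^sup>2 / (a/2)\<^sup>2" if k: "(norm (g k))\<^sup>2 < 2 * V" for k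
  proof -
    let ?A = "{\<theta> \<in> space W. a/2 \<le> blinfun_apply (l k) \<theta>}"
    let ?B = "{\<theta> \<in> space W. (a/2)\<^sup>2 \<le> (PW (h - g k) \<theta>)\<^sup>2}"
    have "AE \<theta> in W. PW (riesz emb (l k)) \<theta> = blinfun_apply (l k) \<theta>"
      using PW unfolding paley_wiener_map_def by blast
    with paley_wiener_diff[OF PW, of h "g k"]
    have "AE \<theta> in W. \<theta> \<in> {\<theta> \<in> space W. a \<le> PW h \<theta>} \<longrightarrow> \<theta> \<in> ?A \<union> ?B"
    proof eventually_elim
      case (elim \<theta>)
      { assume h: "a \<le> PW h \<theta>" and n: "\<not> a/2 \<le> blinfun_apply (l k) \<theta>"
        then have "a/2 \<le> PW (h - g k) \<theta>" using elim l by simp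
        then have "(a/2)\<^sup>2 \<le> (PW (h - g k) \<theta>)\<^sup>2" using a by (intro power_mono) auto }
      then show ?case by auto
    qed
    then have "prob {\<theta> \<in> space W. a \<le> PW h \<theta>} \<le> prob (?A \<union> ?B)"
      by (intro finite_measure_mono_AE) auto
    also have "\<dots> \<le> prob ?A + prob ?B" by (rule measure_Un_le) auto
    also have "prob ?A \<le> exp (- (a/2)\<^sup>2 / (2 * (2 * V)))"
      using k \<open>V > 0\<close> a l by (intro blinfun_tail) auto
    also have "- (a/2)\<^sup>2 / (2 * (2 * V)) = - a\<^sup>2 / (16 * V)" by (simp add: power_divide)
    also have "prob ?B \<le> (\<integral>\<theta>. (PW (h - g k) \<theta>)\<^sup>2 \<partial>W) / (a/2)\<^sup>2"
      using a by (intro integral_Markov_inequality_measure[where A="{}"] sq) auto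
    finally show ?thesis by (simp add: iso)
  qed
  have "(\<lambda>k. exp (- a\<^sup>2 / (16 * V)) + (norm (h - g k))\<^sup>2 / (a/2)\<^sup>2)
      \<longlonglongrightarrow> exp (- a\<^sup>2 / (16 * V)) + (norm (h - h))\<^sup>2 / (a/2)\<^sup>2"
    using a by (intro tendsto_intros g) auto
  from tendsto_lowerbound[OF this, of "prob {\<theta> \<in> space W. a \<le> PW h \<theta>}"] show ?thesis
    using eventually_mono[OF ev bound] by simp
qed


section \<open>Polar coordinates and a radial Cauchy-Schwarz inequality\<close>

lemma nn_integral_lborel_scaleR:
  fixes f :: "'a::euclidean_space \<Rightarrow> ennreal"
  assumes [measurable]: "f \<in> borel_measurable borel" and "c > 0"
  shows "(\<integral>\<^sup>+x. f x \<partial>lborel) = ennreal (c ^ DIM('a)) * (\<integral>\<^sup>+x. f (c *\<^sub>R x) \<partial>lborel)"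
proof -
  have "(\<integral>\<^sup>+x. f x \<partial>lborel)
      = (\<integral>\<^sup>+x. f x \<partial>density (distr lborel borel (\<lambda>x. 0 + c *\<^sub>R x)) (\<lambda>_. ennreal (\<bar>c\<bar> ^ DIM('a))))"
    by (rule arg_cong[where f="\<lambda>M. integral\<^sup>N M f", OF lborel_affine]) (use \<open>c > 0\<close> in simp)
  also have "\<dots> = ennreal (c ^ DIM('a)) * (\<integral>\<^sup>+x. f (c *\<^sub>R x) \<partial>lborel)"
    using \<open>c > 0\<close> by (simp add: nn_integral_density nn_integral_distr nn_integral_cmult)
  finally show ?thesis .
qed

lemma nn_integral_lborel_translate:
  fixes f :: "'a::euclidean_space \<Rightarrow> ennreal"
  assumes [measurable]: "f \<in> borel_measurable borel"
  shows "(\<integral>\<^sup>+x. f (a + x) \<partial>lborel) = (\<integral>\<^sup>+x. f x \<partial>lborel)"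
proof -
  have "(\<integral>\<^sup>+x. f x \<partial>lborel) = (\<integral>\<^sup>+x. f x \<partial>distr lborel borel ((+) a))"
    by (simp add: lborel_distr_plus)
  then show ?thesis by (simp add: nn_integral_distr)
qed

lemma nn_integral_inverse_power_Ioi:
  assumes a: "a > (0::real)" and k: "k > 0"
  shows "(\<integral>\<^sup>+s. ennreal (1 / s ^ Suc k) * indicator {a<..} s \<partial>lborel) = ennreal (1 / (real k * a ^ k))"
proof -
  have "(\<integral>\<^sup>+s. ennreal (1 / s ^ Suc k) * indicator {a<..} s \<partial>lborel)
      = (\<integral>\<^sup>+s. ennreal (indicator {a..} s / s ^ Suc k) * indicator {a..} s \<partial>lborel)"
    by (intro nn_integral_cong_AE) (use AE_lborel_singleton[of a] in eventually_elim, auto simp: indicator_def)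
  also have "\<dots> = ennreal (0 - - (1 / real k) * inverse (a ^ k))"
  proof (rule nn_integral_FTC_atLeast)
    fix x :: real assume x: "a \<le> x"
    with a have x0: "x > 0" by simp
    have "((\<lambda>s. s ^ k) has_real_derivative real k * x ^ (k - 1)) (at x)"
      by (rule DERIV_cong[OF DERIV_pow]) simp
    from DERIV_cmult[OF DERIV_inverse_fun[OF this], of "- (1 / real k)"]
    have "((\<lambda>s. - (1 / real k) * inverse (s ^ k)) has_real_derivative
        x ^ (k - 1) / (x ^ k * x ^ k)) (at x)"
      using x0 k by (simp add: field_simps)
    moreover have "x ^ (k - 1) / (x ^ k * x ^ k) = indicator {a..} x / x ^ Suc k"
    proof -
      have "x ^ k = x * x ^ (k - 1)" using k by (cases k) auto
      then show ?thesis using x x0 by (simp add: field_simps)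
    qed
    ultimately show "((\<lambda>s. - (1 / real k) * inverse (s ^ k)) has_real_derivative
        indicator {a..} x / x ^ Suc k) (at x)" by simp
    show "0 \<le> indicator {a..} x / x ^ Suc k" using x0 by auto
  next
    have "filterlim (\<lambda>s::real. s ^ k) at_top at_top"
      using k by (intro filterlim_pow_at_top filterlim_ident)
    then have "((\<lambda>s::real. inverse (s ^ k)) \<longlongrightarrow> 0) at_top"
      by (rule tendsto_inverse_0_at_top)
    then show "((\<lambda>s. - (1 / real k) * inverse (s ^ k)) \<longlongrightarrow> 0) at_top"
      by (rule tendsto_mult_right_zero)
  qed simp
  finally show ?thesis by (simp add: field_simps)
qed

lemma sgn_measurable[measurable]: "(sgn :: 'a::euclidean_space \<Rightarrow> 'a) \<in> borel_measurable borel"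
  unfolding sgn_div_norm by measurable

text \<open>Integration in polar coordinates, with directions sampled as \<open>sgn y\<close> for \<open>y\<close> uniform in the
  unit ball. After \<open>r = s * norm y\<close> the integrals over \<open>y\<close> and \<open>s\<close> are exchanged and \<open>z = s y\<close>.\<close>

lemma nn_integral_polar:
  fixes F :: "'a::euclidean_space \<Rightarrow> ennreal"
  assumes [measurable]: "F \<in> borel_measurable borel"
  shows "(\<integral>\<^sup>+y. (\<integral>\<^sup>+r. indicator (ball 0 1) y * indicator {0<..} r *
            (ennreal (r ^ (DIM('a) - 1)) * F (r *\<^sub>R sgn y)) \<partial>lborel) \<partial>lborel)
       = ennreal (1 / DIM('a)) * (\<integral>\<^sup>+z. F z \<partial>lborel)"
proof -
  let ?n = "DIM('a)"
  have n: "x ^ ?n = x * x ^ (?n - 1)" for x :: real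
    by (metis DIM_positive power_minus_mult mult.commute)
  have [measurable]: "ball (0::'a) 1 \<in> sets borel" "{0::real<..} \<in> sets borel" by auto
  have sub: "(\<integral>\<^sup>+r. indicator (ball 0 1) y * indicator {0<..} r * (ennreal (r ^ (?n - 1)) * F (r *\<^sub>R sgn y)) \<partial>lborel)
      = (\<integral>\<^sup>+s. indicator (ball 0 1) y * indicator {0<..} s *
            (ennreal (s ^ (?n - 1) * norm y ^ ?n) * F (s *\<^sub>R y)) \<partial>lborel)" if y: "y \<noteq> 0" for y :: 'a
  proof -
    have ny: "norm y > 0" using y by simp
    have "(\<integral>\<^sup>+r. indicator (ball 0 1) y * indicator {0<..} r * (ennreal (r ^ (?n - 1)) * F (r *\<^sub>R sgn y)) \<partial>lborel)
      = ennreal \<bar>norm y\<bar> * (\<integral>\<^sup>+s. indicator (ball 0 1) y * indicator {0<..} (0 + norm y * s) *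
          (ennreal ((0 + norm y * s) ^ (?n - 1)) * F ((0 + norm y * s) *\<^sub>R sgn y)) \<partial>lborel)"
      using ny by (intro nn_integral_real_affine) auto
    also have "\<dots> = (\<integral>\<^sup>+s. ennreal (norm y) * (indicator (ball 0 1) y * indicator {0<..} (0 + norm y * s) *
          (ennreal ((0 + norm y * s) ^ (?n - 1)) * F ((0 + norm y * s) *\<^sub>R sgn y))) \<partial>lborel)"
      by (subst nn_integral_cmult) auto
    also have "\<dots> = (\<integral>\<^sup>+s. indicator (ball 0 1) y * indicator {0<..} s *
            (ennreal (s ^ (?n - 1) * norm y ^ ?n) * F (s *\<^sub>R y)) \<partial>lborel)"
    proof (rule nn_integral_cong)
      fix s :: real
      have "norm y * s ^ (?n-1) * norm y ^ (?n-1) = s ^ (?n - 1) * norm y ^ ?n"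
        by (simp add: n)
      then have e: "ennreal (norm y) * ennreal ((norm y * s) ^ (?n - 1)) = ennreal (s ^ (?n - 1) * norm y ^ ?n)"
        if "s > 0" using that by (simp add: ennreal_mult[symmetric] power_mult_distrib mult_ac)
      have "(norm y * s) *\<^sub>R sgn y = s *\<^sub>R y" using ny by (simp add: sgn_div_norm)
      then show "ennreal (norm y) * (indicator (ball 0 1) y * indicator {0<..} (0 + norm y * s) *
          (ennreal ((0 + norm y * s) ^ (?n - 1)) * F ((0 + norm y * s) *\<^sub>R sgn y)))
        = indicator (ball 0 1) y * indicator {0<..} s *
            (ennreal (s ^ (?n - 1) * norm y ^ ?n) * F (s *\<^sub>R y))"
        using e ny by (cases "s > 0") (auto simp: indicator_def mult.assoc[symmetric] zero_less_mult_iff)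
    qed
    finally show ?thesis .
  qed
  \<comment> \<open>With z = s y the condition that y lies in the unit ball becomes
    \<open>norm z < s\<close>. The remaining integral of 1 / s^(n+1) over these s is 1 / (n * norm z
    ^ n), which cancels the factor \<open>norm z ^ n\<close> and leaves 1 / n.\<close>
  have scal: "(\<integral>\<^sup>+y. indicator (ball 0 1) y * indicator {0<..} s *
            (ennreal (s ^ (?n - 1) * norm y ^ ?n) * F (s *\<^sub>R y)) \<partial>lborel)
      = (\<integral>\<^sup>+z. ennreal (1 / s ^ Suc ?n) * indicator {norm z<..} s * (ennreal (norm z ^ ?n) * F z) \<partial>lborel)"
    for s :: real
  proof (cases "s > 0")
    case s: True
    have "(\<integral>\<^sup>+z. ennreal (1 / s ^ Suc ?n) * indicator {norm z<..} s * (ennreal (norm z ^ ?n) * F z) \<partial>lborel)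
      = ennreal (s ^ ?n) * (\<integral>\<^sup>+z. ennreal (1 / s ^ Suc ?n) * indicator {norm (s *\<^sub>R z)<..} s *
            (ennreal (norm (s *\<^sub>R z) ^ ?n) * F (s *\<^sub>R z)) \<partial>lborel)"
      by (rule nn_integral_lborel_scaleR) (use s in \<open>auto simp: indicator_def\<close>)
    also have "\<dots> = (\<integral>\<^sup>+z. ennreal (s ^ ?n) * (ennreal (1 / s ^ Suc ?n) * indicator {norm (s *\<^sub>R z)<..} s *
            (ennreal (norm (s *\<^sub>R z) ^ ?n) * F (s *\<^sub>R z))) \<partial>lborel)"
      by (subst nn_integral_cmult) (auto simp: indicator_def)
    also have "\<dots> = (\<integral>\<^sup>+y. indicator (ball 0 1) y * indicator {0<..} s *
            (ennreal (s ^ (?n - 1) * norm y ^ ?n) * F (s *\<^sub>R y)) \<partial>lborel)"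
    proof (rule nn_integral_cong)
      fix y :: 'a
      have "s ^ ?n * (1 / s ^ Suc ?n) * norm (s *\<^sub>R y) ^ ?n = s ^ (?n - 1) * norm y ^ ?n"
        using s n[of s] by (simp add: power_mult_distrib)
      then have e: "ennreal (s ^ ?n) * ennreal (1 / s ^ Suc ?n) * ennreal (norm (s *\<^sub>R y) ^ ?n)
          = ennreal (s ^ (?n - 1) * norm y ^ ?n)"
        using s by (simp only: ennreal_mult[symmetric] zero_le_power norm_ge_zero less_imp_le
            zero_le_divide_1_iff mult_nonneg_nonneg)
      have "indicator {norm (s *\<^sub>R y)<..} s = (indicator (ball 0 1) y :: ennreal)"
        using s by (auto simp: indicator_def)
      then show "ennreal (s ^ ?n) * (ennreal (1 / s ^ Suc ?n) * indicator {norm (s *\<^sub>R y)<..} s *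
            (ennreal (norm (s *\<^sub>R y) ^ ?n) * F (s *\<^sub>R y)))
        = indicator (ball 0 1) y * indicator {0<..} s * (ennreal (s ^ (?n - 1) * norm y ^ ?n) * F (s *\<^sub>R y))"
        using s unfolding e[symmetric] by (simp add: mult_ac)
    qed
    finally show ?thesis by simp
  next
    case False
    then have "\<not> norm z < s" for z :: 'a using norm_ge_zero[of z] by linarith
    then show ?thesis using False by (simp add: indicator_def)
  qed
  have "(\<integral>\<^sup>+y. (\<integral>\<^sup>+r. indicator (ball 0 1) y * indicator {0<..} r *
            (ennreal (r ^ (?n - 1)) * F (r *\<^sub>R sgn y)) \<partial>lborel) \<partial>lborel)
      = (\<integral>\<^sup>+y. (\<integral>\<^sup>+s. indicator (ball 0 1) y * indicator {0<..} s *
            (ennreal (s ^ (?n - 1) * norm y ^ ?n) * F (s *\<^sub>R y)) \<partial>lborel) \<partial>lborel)"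
    by (intro nn_integral_cong_AE) (use AE_lborel_singleton[of "0::'a"] in eventually_elim, rule sub)
  also have "\<dots> = (\<integral>\<^sup>+s. (\<integral>\<^sup>+y. indicator (ball 0 1) y * indicator {0<..} s *
            (ennreal (s ^ (?n - 1) * norm y ^ ?n) * F (s *\<^sub>R y)) \<partial>lborel) \<partial>lborel)"
    by (rule lborel_pair.Fubini') measurable
  also have "\<dots> = (\<integral>\<^sup>+s. (\<integral>\<^sup>+z. ennreal (1 / s ^ Suc ?n) * indicator {norm z<..} s *
      (ennreal (norm z ^ ?n) * F z) \<partial>lborel) \<partial>lborel)"
    by (intro nn_integral_cong scal)
  also have "\<dots> = (\<integral>\<^sup>+z. (\<integral>\<^sup>+s. ennreal (1 / s ^ Suc ?n) * indicator {norm z<..} s *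
      (ennreal (norm z ^ ?n) * F z) \<partial>lborel) \<partial>lborel)"
  proof (rule lborel_pair.Fubini')
    have [measurable]: "(\<lambda>(z::'a, s::real). indicator {norm z<..} s :: ennreal) \<in> borel_measurable (lborel \<Otimes>\<^sub>M lborel)"
      unfolding indicator_def greaterThan_iff by measurable
    show "(\<lambda>(z, s). ennreal (1 / s ^ Suc ?n) * indicator {norm z<..} s * (ennreal (norm z ^ ?n) * F z))
       \<in> borel_measurable (lborel \<Otimes>\<^sub>M lborel)" by measurable
  qed
  also have "\<dots> = (\<integral>\<^sup>+z. ennreal (1 / ?n) * F z \<partial>lborel)"
  proof (intro nn_integral_cong_AE, use AE_lborel_singleton[of "0::'a"] in eventually_elim)
    fix z :: 'a assume z: "z \<noteq> 0"
    have "(\<integral>\<^sup>+s. ennreal (1 / s ^ Suc ?n) * indicator {norm z<..} s * (ennreal (norm z ^ ?n) * F z) \<partial>lborel)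
        = ennreal (1 / (real ?n * norm z ^ ?n)) * (ennreal (norm z ^ ?n) * F z)"
      using z nn_integral_inverse_power_Ioi[of "norm z" ?n] by (subst nn_integral_multc) auto
    also have "\<dots> = ennreal (1 / ?n) * F z"
      using z by (simp add: mult.assoc[symmetric] ennreal_mult[symmetric])
    finally show "(\<integral>\<^sup>+s. ennreal (1 / s ^ Suc ?n) * indicator {norm z<..} s * (ennreal (norm z ^ ?n) * F z) \<partial>lborel)
        = ennreal (1 / ?n) * F z" .
  qed
  also have "\<dots> = ennreal (1 / ?n) * (\<integral>\<^sup>+z. F z \<partial>lborel)" by (rule nn_integral_cmult) auto
  finally show ?thesis .
qed

text \<open>The integrand is split as (w / sqrt (r^(n-1))) * (sqrt (r^(n-1)) * G). The square of the
  second factor is the polar form of an ordinary integral over the space, and the first leaves a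
  one-dimensional integral that depends on the weight alone.\<close>

lemma polar_Cauchy_Schwarz:
  fixes G :: "'a::euclidean_space \<Rightarrow> ennreal" and w :: "real \<Rightarrow> ennreal"
  assumes [measurable]: "G \<in> borel_measurable borel" "w \<in> borel_measurable borel"
  shows "(\<integral>\<^sup>+y. (\<integral>\<^sup>+r. indicator (ball 0 1) y * indicator {0<..} r * (w r * G (r *\<^sub>R sgn y)) \<partial>lborel) \<partial>lborel)\<^sup>2
     \<le> emeasure lborel (ball (0::'a) 1) *
         (\<integral>\<^sup>+r. indicator {0<..} r * ((w r)\<^sup>2 * ennreal (1 / r ^ (DIM('a) - 1))) \<partial>lborel) *
       (ennreal (1 / DIM('a)) * (\<integral>\<^sup>+z. (G z)\<^sup>2 \<partial>lborel))"
proof -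
  let ?n = "DIM('a)" and ?M = "lborel \<Otimes>\<^sub>M lborel :: ('a \<times> real) measure"
  have [measurable]: "ball (0::'a) 1 \<in> sets borel" "{0::real<..} \<in> sets borel" by auto
  define f where "f = (\<lambda>(y::'a, r). indicator (ball 0 1) y * (indicator {0<..} r *
     (w r * ennreal (sqrt (1 / r ^ (?n - 1))))))"
  define g where "g = (\<lambda>(y::'a, r). indicator (ball 0 1) y * (indicator {0<..} r *
     (ennreal (sqrt (r ^ (?n - 1))) * G (r *\<^sub>R sgn y))))"
  have [measurable]: "f \<in> borel_measurable ?M" "g \<in> borel_measurable ?M"
    unfolding f_def g_def by measurable
  have isq: "(indicator A x :: ennreal)\<^sup>2 = indicator A x" for A and x :: 'x
    by (simp add: indicator_def)
  have "(\<integral>\<^sup>+y. (\<integral>\<^sup>+r. indicator (ball 0 1) y * indicator {0<..} r * (w r * G (r *\<^sub>R sgn y)) \<partial>lborel) \<partial>lborel)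
      = (\<integral>\<^sup>+y. (\<integral>\<^sup>+r. f (y, r) * g (y, r) \<partial>lborel) \<partial>lborel)"
  proof (intro nn_integral_cong)
    fix y :: 'a and r :: real
    have "ennreal (sqrt (1 / r ^ (?n - 1))) * ennreal (sqrt (r ^ (?n - 1))) = 1" if "r > 0"
      using that by (simp add: ennreal_mult[symmetric] real_sqrt_mult[symmetric])
    then have "w r * ennreal (sqrt (1 / r ^ (?n - 1))) * (ennreal (sqrt (r ^ (?n - 1))) * G (r *\<^sub>R sgn y))
       = w r * G (r *\<^sub>R sgn y)" if "r > 0" using that by (metis mult.assoc mult.left_neutral)
    then show "indicator (ball 0 1) y * indicator {0<..} r * (w r * G (r *\<^sub>R sgn y)) = f (y, r) * g (y, r)"
      by (auto simp: f_def g_def indicator_def)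
  qed
  also have "\<dots> = (\<integral>\<^sup>+p. f p * g p \<partial>?M)"
    by (subst lborel.nn_integral_fst[symmetric]) auto
  also have "(\<integral>\<^sup>+p. f p * g p \<partial>?M)\<^sup>2 \<le> (\<integral>\<^sup>+p. (f p)\<^sup>2 \<partial>?M) * (\<integral>\<^sup>+p. (g p)\<^sup>2 \<partial>?M)"
    by (rule Cauchy_Schwarz_nn_integral) auto
  also have "(\<integral>\<^sup>+p. (g p)\<^sup>2 \<partial>?M) = (\<integral>\<^sup>+y. (\<integral>\<^sup>+r. (g (y, r))\<^sup>2 \<partial>lborel) \<partial>lborel)"
    by (subst lborel.nn_integral_fst[symmetric]) auto
  also have "\<dots> = (\<integral>\<^sup>+y. (\<integral>\<^sup>+r. indicator (ball 0 1) y * indicator {0<..} r *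
            (ennreal (r ^ (DIM('a) - 1)) * (G (r *\<^sub>R sgn y))\<^sup>2) \<partial>lborel) \<partial>lborel)"
    by (intro nn_integral_cong)
       (auto simp: g_def power_mult_distrib isq indicator_def ennreal_power)
  also have "\<dots> = ennreal (1 / ?n) * (\<integral>\<^sup>+z. (G z)\<^sup>2 \<partial>lborel)"
    by (rule nn_integral_polar) auto
  also have "(\<integral>\<^sup>+p. (f p)\<^sup>2 \<partial>?M) = (\<integral>\<^sup>+y. (\<integral>\<^sup>+r. (f (y, r))\<^sup>2 \<partial>lborel) \<partial>lborel)"
    by (subst lborel.nn_integral_fst[symmetric]) auto
  also have "\<dots> = (\<integral>\<^sup>+y. (\<integral>\<^sup>+r. indicator (ball (0::'a) 1) y *
      (indicator {0<..} r * ((w r)\<^sup>2 * ennreal (1 / r ^ (?n - 1)))) \<partial>lborel) \<partial>lborel)"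
    by (intro nn_integral_cong)
       (auto simp: f_def power_mult_distrib isq indicator_def ennreal_power real_sqrt_power[symmetric])
  also have "\<dots> = (\<integral>\<^sup>+y. indicator (ball (0::'a) 1) y *
      (\<integral>\<^sup>+r. indicator {0<..} r * ((w r)\<^sup>2 * ennreal (1 / r ^ (?n - 1))) \<partial>lborel) \<partial>lborel)"
    by (intro nn_integral_cong nn_integral_cmult) auto
  also have "\<dots> = emeasure lborel (ball (0::'a) 1) *
      (\<integral>\<^sup>+r. indicator {0<..} r * ((w r)\<^sup>2 * ennreal (1 / r ^ (?n - 1))) \<partial>lborel)"
    by (subst nn_integral_multc) auto
  finally show ?thesis .
qed


section \<open>Compactly supported functions: paths, integration by parts, linear
  combinations\<close>

text \<open>The gradient is a parameter, so that a product such as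
  \<open>partial_deriv i \<phi> x * \<phi> x\<close> becomes an instance with its gradient given by
  the product rule.\<close>

locale compact_C1 =
  fixes \<phi> :: "'a::euclidean_space \<Rightarrow> real" and g :: "'a \<Rightarrow> 'a"
  assumes deriv: "(\<phi> has_derivative (\<lambda>v. g x \<bullet> v)) (at x)"
    and grad_continuous: "continuous_on UNIV g"
    and support: "\<exists>R. \<forall>x. R \<le> norm x \<longrightarrow> \<phi> x = 0"
begin

lemma fun_continuous: "continuous_on UNIV \<phi>"
  using has_derivative_continuous[OF deriv] by (simp add: continuous_at_imp_continuous_on)

lemma measurable_fun[measurable]: "\<phi> \<in> borel_measurable borel"
  by (rule borel_measurable_continuous_onI[OF fun_continuous])

lemma measurable_grad[measurable]: "g \<in> borel_measurable borel"
  by (rule borel_measurable_continuous_onI[OF grad_continuous])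

lemma obtain_radius:
  obtains R where "R > 0" "\<And>x. R \<le> norm x \<Longrightarrow> \<phi> x = 0" "\<And>x. R \<le> norm x \<Longrightarrow> g x = 0"
proof -
  obtain R where R: "\<And>x. R \<le> norm x \<Longrightarrow> \<phi> x = 0" using support by auto
  have "g x = 0" if x: "R + 1 \<le> norm x" for x
  proof -
    have "(\<phi> has_derivative (\<lambda>v. 0)) (at x)"
    proof (rule has_derivative_transform_within_open)
      show "((\<lambda>x. 0 :: real) has_derivative (\<lambda>v. 0)) (at x)" by simp
      show "open {x :: 'a. R < norm x}" by (intro open_Collect_less continuous_intros)
    qed (use x R in auto)
    then have "(\<lambda>v. g x \<bullet> v) = (\<lambda>v. 0)" using deriv has_derivative_unique by blast
    then show ?thesis using inner_eq_zero_iff by metis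
  qed
  then show thesis using that[of "\<bar>R\<bar> + 1"] R by force
qed

lemma integrable_compact_support:
  fixes f :: "'a \<Rightarrow> real"
  assumes "continuous_on UNIV f" "\<And>x. \<phi> x = 0 \<Longrightarrow> g x = 0 \<Longrightarrow> f x = 0"
  shows "integrable lborel f"
proof -
  obtain R where R: "R > 0" "\<And>x. R \<le> norm x \<Longrightarrow> \<phi> x = 0" "\<And>x. R \<le> norm x \<Longrightarrow> g x = 0"
    using obtain_radius by metis
  have "integrable lborel (\<lambda>x. indicator (cball 0 R) x *\<^sub>R f x)"
    using assms(1) by (intro borel_integrable_compact) (auto intro: continuous_on_subset)
  also have "(\<lambda>x. indicator (cball 0 R) x *\<^sub>R f x) = f"
    using R assms(2) by (auto simp: indicator_def fun_eq_iff)
  finally show ?thesis .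
qed

lemma path_deriv: "((\<lambda>r. \<phi> (x + r *\<^sub>R w)) has_real_derivative g (x + r *\<^sub>R w) \<bullet> w) (at r)"
proof -
  have "((\<lambda>r. x + r *\<^sub>R w) has_derivative (\<lambda>h. h *\<^sub>R w)) (at r)"
    by (auto intro!: derivative_eq_intros)
  from has_derivative_compose[OF this deriv]
  show ?thesis unfolding has_field_derivative_def
    by (rule has_derivative_eq_rhs) (simp add: fun_eq_iff mult.commute)
qed

lemma path_grad_continuous: "isCont (\<lambda>r. g (x + r *\<^sub>R w) \<bullet> w) r"
proof -
  have "continuous_on UNIV (\<lambda>r. g (x + r *\<^sub>R w) \<bullet> w)"
    by (intro continuous_on_inner continuous_on_compose2[OF grad_continuous, of _ "\<lambda>r. x + r *\<^sub>R w"]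
        continuous_intros) auto
  then show ?thesis by (simp add: continuous_on_eq_continuous_at)
qed

lemma path_bound:
  assumes "s \<le> t" "norm w \<le> 1"
  shows "ennreal \<bar>\<phi> (x + t *\<^sub>R w) - \<phi> (x + s *\<^sub>R w)\<bar>
    \<le> (\<integral>\<^sup>+r. indicator {s<..t} r * ennreal (norm (g (x + r *\<^sub>R w))) \<partial>lborel)"
proof -
  let ?f = "\<lambda>r. (g (x + r *\<^sub>R w) \<bullet> w) * indicator {s..t} r"
  have F: "has_bochner_integral lborel ?f (\<phi> (x + t *\<^sub>R w) - \<phi> (x + s *\<^sub>R w))"
    by (rule has_bochner_integral_FTC_Icc_real) (use assms path_deriv path_grad_continuous in auto)
  then have "ennreal (norm (\<phi> (x + t *\<^sub>R w) - \<phi> (x + s *\<^sub>R w))) \<le> (\<integral>\<^sup>+r. norm (?f r) \<partial>lborel)"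
    using integral_norm_bound_ennreal[of lborel ?f] by (simp add: has_bochner_integral_iff)
  also have "\<dots> \<le> (\<integral>\<^sup>+r. indicator {s<..t} r * ennreal (norm (g (x + r *\<^sub>R w))) \<partial>lborel)"
  proof (rule nn_integral_mono_AE, use AE_lborel_singleton[of s] in eventually_elim)
    fix r assume "r \<noteq> s"
    have "\<bar>g (x + r *\<^sub>R w) \<bullet> w\<bar> \<le> norm (g (x + r *\<^sub>R w)) * norm w" by (rule Cauchy_Schwarz_ineq2)
    also have "\<dots> \<le> norm (g (x + r *\<^sub>R w)) * 1" using assms by (intro mult_left_mono) auto
    finally show "ennreal (norm (?f r)) \<le> indicator {s<..t} r * ennreal (norm (g (x + r *\<^sub>R w)))"
      using \<open>r \<noteq> s\<close> by (auto simp: indicator_def)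
  qed
  finally show ?thesis by simp
qed

text \<open>Translation invariance gives that the integral of \<phi> (x + v) - \<phi> x vanishes.
  Written by the fundamental theorem along the segment from x to x + v and exchanged by Fubini, it
  is an average over r of translates of the wanted integral.\<close>

lemma integral_grad_eq_0: "(\<integral>x. g x \<bullet> v \<partial>lborel) = 0"
proof -
  obtain R where R: "R > 0" "\<And>x. R \<le> norm x \<Longrightarrow> \<phi> x = 0" "\<And>x. R \<le> norm x \<Longrightarrow> g x = 0"
    using obtain_radius by metis
  define D where "D x = g x \<bullet> v" for x
  have Dc: "continuous_on UNIV D" unfolding D_def by (intro continuous_intros grad_continuous)
  have Dm[measurable]: "D \<in> borel_measurable borel"
    by (rule borel_measurable_continuous_onI[OF Dc])
  define h where "h r x = indicator {0..1::real} r * D (x + r *\<^sub>R v)" for r x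
  \<comment> \<open>A compact set outside of which \<open>h\<close> vanishes; continuity on it gives
    the joint integrability that Fubini requires.\<close>
  define S where "S = {0..1::real} \<times> cball (0::'a) (R + norm v)"
  have h_eq: "indicator S p *\<^sub>R D (snd p + fst p *\<^sub>R v) = h (fst p) (snd p)" for p
  proof -
    have "D (snd p + fst p *\<^sub>R v) = 0" if "fst p \<in> {0..1}" "norm (snd p) > R + norm v"
    proof -
      have "norm (fst p *\<^sub>R v) \<le> 1 * norm v" using that mult_right_mono[of "fst p" 1 "norm v"] by auto
      then have "R \<le> norm (snd p + fst p *\<^sub>R v)"
        using that norm_triangle_ineq2[of "snd p" "- (fst p *\<^sub>R v)"] by simp
      then show ?thesis using R by (simp add: D_def)
    qed
    then show ?thesis by (cases p) (auto simp: S_def h_def indicator_def)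
  qed
  have "integrable lborel (\<lambda>p. indicator S p *\<^sub>R D (snd p + fst p *\<^sub>R v))"
    unfolding S_def
    by (intro borel_integrable_compact compact_Times compact_Icc compact_cball
        continuous_on_compose2[OF Dc, of _ "\<lambda>p. snd p + fst p *\<^sub>R v"] continuous_intros) auto
  then have hi: "integrable (lborel \<Otimes>\<^sub>M lborel) (case_prod h)"
    unfolding lborel_prod h_eq by (simp add: split_def)
  have FTC: "(\<integral>r. h r x \<partial>lborel) = \<phi> (x + v) - \<phi> x" for x
    using integral_FTC_Icc_real[OF _ path_deriv path_grad_continuous, of 0 1 x v]
    by (simp add: h_def D_def mult.commute)
  have tr: "(\<integral>x. f (x + a) \<partial>lborel) = (\<integral>x. f x \<partial>lborel)"
    if "f \<in> borel_measurable borel" for f :: "'a \<Rightarrow> real" and a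
  proof -
    have "(\<integral>x. f x \<partial>lborel) = (\<integral>x. f x \<partial>distr lborel borel ((+) a))" by (simp add: lborel_distr_plus)
    then show ?thesis using that by (simp add: integral_distr add.commute)
  qed
  have int: "integrable lborel \<phi>" by (intro integrable_compact_support fun_continuous) auto
  have "integrable (distr lborel borel ((+) v)) \<phi>" using int by (simp add: lborel_distr_plus)
  then have int': "integrable lborel (\<lambda>x. \<phi> (x + v))"
    by (subst (asm) integrable_distr_eq) (auto simp: add.commute)
  have "(\<integral>x. D x \<partial>lborel) = (\<integral>r. indicator {0..1} r * (\<integral>x. D x \<partial>lborel) \<partial>(lborel :: real measure))"
    by simp
  also have "\<dots> = (\<integral>r. (\<integral>x. h r x \<partial>lborel) \<partial>lborel)"
    unfolding h_def by (simp add: tr)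
  also have "\<dots> = (\<integral>x. (\<integral>r. h r x \<partial>lborel) \<partial>lborel)"
    by (rule lborel_pair.Fubini_integral[OF hi, symmetric])
  also have "\<dots> = (\<integral>x. \<phi> (x + v) \<partial>lborel) - (\<integral>x. \<phi> x \<partial>lborel)"
    unfolding FTC by (rule Bochner_Integration.integral_diff[OF int' int])
  also have "\<dots> = 0" by (simp add: tr)
  finally show ?thesis by (simp add: D_def)
qed

end

lemma iter_partial_append: "iter_partial (is @ js) \<phi> = iter_partial is (iter_partial js \<phi>)"
  by (induction "is") auto

lemma smooth_differentiable: "smooth \<phi> \<Longrightarrow> \<phi> differentiable (at x)"
  unfolding smooth_def by (drule bspec[of _ _ "[]"]) auto

lemma smooth_partial_deriv:
  assumes "smooth \<phi>" "i \<in> Basis"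
  shows "smooth (partial_deriv i \<phi>)"
  unfolding smooth_def
proof (intro ballI allI)
  fix js :: "'a list" and x assume "js \<in> lists Basis"
  with assms(2) have "js @ [i] \<in> lists Basis" by auto
  with assms(1) have "iter_partial (js @ [i]) \<phi> differentiable (at x)" unfolding smooth_def by blast
  then show "iter_partial js (partial_deriv i \<phi>) differentiable (at x)" by (simp add: iter_partial_append)
qed

lemma smooth_continuous: "smooth \<phi> \<Longrightarrow> continuous_on UNIV \<phi>"
  by (auto intro!: continuous_at_imp_continuous_on differentiable_imp_continuous_within smooth_differentiable)

definition grad :: "('a::euclidean_space \<Rightarrow> real) \<Rightarrow> 'a \<Rightarrow> 'a" where
  "grad \<phi> x = (\<Sum>i\<in>Basis. partial_deriv i \<phi> x *\<^sub>R i)"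

lemma inner_grad: "i \<in> Basis \<Longrightarrow> grad \<phi> x \<bullet> i = partial_deriv i \<phi> x"
  by (simp add: grad_def)

lemma partial_deriv_eq_0: "grad \<phi> x = 0 \<Longrightarrow> i \<in> Basis \<Longrightarrow> partial_deriv i \<phi> x = 0"
  by (metis inner_grad inner_zero_left)

lemma has_derivative_grad:
  assumes "\<phi> differentiable (at x)"
  shows "(\<phi> has_derivative (\<lambda>v. grad \<phi> x \<bullet> v)) (at x)"
proof -
  have d: "(\<phi> has_derivative frechet_derivative \<phi> (at x)) (at x)"
    using assms by (simp add: frechet_derivative_works)
  then have "linear (frechet_derivative \<phi> (at x))" by (rule has_derivative_linear)
  interpret linear "frechet_derivative \<phi> (at x)" by fact
  have "frechet_derivative \<phi> (at x) v = grad \<phi> x \<bullet> v" for v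
  proof -
    have "frechet_derivative \<phi> (at x) v = frechet_derivative \<phi> (at x) (\<Sum>i\<in>Basis. (v \<bullet> i) *\<^sub>R i)"
      by (simp add: euclidean_representation)
    also have "\<dots> = grad \<phi> x \<bullet> v"
      by (simp add: sum scale grad_def partial_deriv_def inner_sum_left inner_commute[of v] mult.commute)
    finally show ?thesis .
  qed
  then have "frechet_derivative \<phi> (at x) = (\<lambda>v. grad \<phi> x \<bullet> v)" by (rule ext)
  with d show ?thesis by simp
qed

lemma partial_deriv_unique:
  assumes "(\<phi> has_derivative F) (at x)"
  shows "partial_deriv i \<phi> x = F i"
  by (simp add: partial_deriv_def frechet_derivative_at[OF assms, symmetric])

lemma test_function_smooth: "test_function \<phi> \<Longrightarrow> smooth \<phi>" by (simp add: test_function_def)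

lemma test_function_compact_C1:
  assumes "test_function \<phi>"
  shows "compact_C1 \<phi> (grad \<phi>)"
proof
  have s: "smooth \<phi>" using assms by (rule test_function_smooth)
  show "(\<phi> has_derivative (\<bullet>) (grad \<phi> x)) (at x)" for x
    by (intro has_derivative_grad smooth_differentiable s)
  show "continuous_on UNIV (grad \<phi>)"
    unfolding grad_def by (intro continuous_intros smooth_continuous smooth_partial_deriv s)
  have "bounded (closure {x. \<phi> x \<noteq> 0})"
    using assms by (auto simp: test_function_def compact_imp_bounded)
  then obtain b where b: "\<And>x. x \<in> closure {x. \<phi> x \<noteq> 0} \<Longrightarrow> norm x \<le> b" by (auto simp: bounded_iff)
  show "\<exists>R. \<forall>x. R \<le> norm x \<longrightarrow> \<phi> x = 0"
  proof (intro exI[of _ "b + 1"] allI impI)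
    fix x :: 'a assume "b + 1 \<le> norm x"
    then have "x \<notin> closure {x. \<phi> x \<noteq> 0}" using b[of x] by auto
    then show "\<phi> x = 0" using closure_subset[of "{x. \<phi> x \<noteq> 0}"] by auto
  qed
qed

lemma test_functionI:
  assumes "smooth \<phi>" "\<And>x. R \<le> norm x \<Longrightarrow> \<phi> x = 0"
  shows "test_function \<phi>"
proof -
  have "{x. \<phi> x \<noteq> 0} \<subseteq> cball 0 R" using assms(2) by (force simp: not_le[symmetric])
  then have "closure {x. \<phi> x \<noteq> 0} \<subseteq> cball 0 R" by (simp add: closure_minimal)
  then have "compact (closure {x. \<phi> x \<noteq> 0})"
    by (metis bounded_subset bounded_cball closed_closure compact_eq_bounded_closed)
  with assms(1) show ?thesis by (simp add: test_function_def)
qed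

text \<open>Integration by parts: for each coordinate i the integral of the i-th derivative of
  \<open>partial_deriv i \<phi> x * \<phi> x\<close> is 0. This identifies the norm of a test
  function in H and shows that it dominates the gradient energy.\<close>

lemma integral_laplacian:
  assumes \<phi>: "test_function \<phi>"
  shows "(\<integral>x. (\<phi> x - laplacian \<phi> x) * \<phi> x \<partial>lborel)
    = (\<integral>x. (\<phi> x)\<^sup>2 \<partial>lborel) + (\<integral>x. (norm (grad \<phi> x))\<^sup>2 \<partial>lborel)"
proof -
  interpret compact_C1 \<phi> "grad \<phi>" by (rule test_function_compact_C1[OF \<phi>])
  have s: "smooth \<phi>" using \<phi> by (rule test_function_smooth)
  note cont = smooth_continuous[OF s] smooth_continuous[OF smooth_partial_deriv[OF s]]
    smooth_continuous[OF smooth_partial_deriv[OF smooth_partial_deriv[OF s]]]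
  have parts: "(\<integral>x. partial_deriv i (partial_deriv i \<phi>) x * \<phi> x \<partial>lborel)
      = - (\<integral>x. (partial_deriv i \<phi> x)\<^sup>2 \<partial>lborel)" if i: "i \<in> Basis" for i
  proof -
    let ?p = "partial_deriv i \<phi>"
    interpret P: compact_C1 "\<lambda>x. ?p x * \<phi> x" "\<lambda>x. ?p x *\<^sub>R grad \<phi> x + \<phi> x *\<^sub>R grad ?p x"
    proof
      show "((\<lambda>x. ?p x * \<phi> x) has_derivative (\<bullet>) (?p x *\<^sub>R grad \<phi> x + \<phi> x *\<^sub>R grad ?p x)) (at x)" for x
        using has_derivative_mult[OF has_derivative_grad[OF smooth_differentiable[OF smooth_partial_deriv[OF s i]]] deriv]
        by (rule has_derivative_eq_rhs) (auto simp: inner_add_left)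
      have "continuous_on UNIV (grad ?p)"
        unfolding grad_def using i by (intro continuous_intros cont)
      then show "continuous_on UNIV (\<lambda>x. ?p x *\<^sub>R grad \<phi> x + \<phi> x *\<^sub>R grad ?p x)"
        using i by (intro continuous_intros cont grad_continuous)
      show "\<exists>R. \<forall>x. R \<le> norm x \<longrightarrow> ?p x * \<phi> x = 0" using support by auto
    qed
    have "0 = (\<integral>x. (?p x *\<^sub>R grad \<phi> x + \<phi> x *\<^sub>R grad ?p x) \<bullet> i \<partial>lborel)"
      by (rule P.integral_grad_eq_0[symmetric])
    also have "\<dots> = (\<integral>x. (?p x)\<^sup>2 + partial_deriv i ?p x * \<phi> x \<partial>lborel)"
      using i by (simp add: inner_add_left inner_grad power2_eq_square mult.commute)
    also have "\<dots> = (\<integral>x. (?p x)\<^sup>2 \<partial>lborel) + (\<integral>x. partial_deriv i ?p x * \<phi> x \<partial>lborel)"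
    proof (rule Bochner_Integration.integral_add)
      show "integrable lborel (\<lambda>x. (?p x)\<^sup>2)"
        using i by (intro integrable_compact_support continuous_intros cont) (auto simp: partial_deriv_eq_0)
      show "integrable lborel (\<lambda>x. partial_deriv i ?p x * \<phi> x)"
        using i by (intro integrable_compact_support continuous_intros cont) auto
    qed
    finally show ?thesis by simp
  qed
  have int2: "integrable lborel (\<lambda>x. (\<phi> x)\<^sup>2)"
    by (intro integrable_compact_support continuous_intros cont) auto
  have intp: "integrable lborel (\<lambda>x. partial_deriv i (partial_deriv i \<phi>) x * \<phi> x)" if "i \<in> Basis" for i
    using that by (intro integrable_compact_support continuous_intros cont) auto
  have intq: "integrable lborel (\<lambda>x. (partial_deriv i \<phi> x)\<^sup>2)" if i: "i \<in> Basis" for i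
    using i by (intro integrable_compact_support continuous_intros cont) (auto simp: partial_deriv_eq_0)
  have "(\<integral>x. (\<phi> x - laplacian \<phi> x) * \<phi> x \<partial>lborel)
      = (\<integral>x. (\<phi> x)\<^sup>2 - (\<Sum>i\<in>Basis. partial_deriv i (partial_deriv i \<phi>) x * \<phi> x) \<partial>lborel)"
    by (simp add: laplacian_def algebra_simps power2_eq_square sum_distrib_left)
  also have "\<dots> = (\<integral>x. (\<phi> x)\<^sup>2 \<partial>lborel)
      - (\<Sum>i\<in>Basis. (\<integral>x. partial_deriv i (partial_deriv i \<phi>) x * \<phi> x \<partial>lborel))"
    using int2 intp by (simp add: Bochner_Integration.integral_diff Bochner_Integration.integral_sum
        Bochner_Integration.integrable_sum)
  also have "\<dots> = (\<integral>x. (\<phi> x)\<^sup>2 \<partial>lborel) + (\<integral>x. (\<Sum>i\<in>Basis. (partial_deriv i \<phi> x)\<^sup>2) \<partial>lborel)"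
    using intq by (simp add: parts sum_negf Bochner_Integration.integral_sum)
  also have "(\<lambda>x. \<Sum>i\<in>Basis. (partial_deriv i \<phi> x)\<^sup>2) = (\<lambda>x. (norm (grad \<phi> x))\<^sup>2)"
    unfolding power2_norm_eq_inner
    by (rule ext, subst euclidean_inner) (simp add: inner_grad power2_eq_square)
  finally show ?thesis .
qed

lemma partial_deriv_lincomb:
  assumes "\<phi> differentiable (at x)" "\<psi> differentiable (at x)"
  shows "partial_deriv i (\<lambda>x. a * \<phi> x + b * \<psi> x) x = a * partial_deriv i \<phi> x + b * partial_deriv i \<psi> x"
  using assms unfolding partial_deriv_def
  by (intro fun_cong[OF frechet_derivative_at[symmetric], of _ _ _ i, THEN trans])
     (auto simp: frechet_derivative_works intro!: derivative_eq_intros)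

lemma smooth_lincomb:
  assumes "smooth \<phi>" "smooth \<psi>"
  shows "smooth (\<lambda>x. a * \<phi> x + b * \<psi> x)"
proof -
  have d: "iter_partial js \<phi> differentiable (at x)" "iter_partial js \<psi> differentiable (at x)"
    if "js \<in> lists Basis" for js x using assms that by (auto simp: smooth_def)
  have "iter_partial js (\<lambda>x. a * \<phi> x + b * \<psi> x) = (\<lambda>x. a * iter_partial js \<phi> x + b * iter_partial js \<psi> x)"
    if "js \<in> lists Basis" for js
    using that
  proof (induction js)
    case (Cons i js)
    then have "iter_partial js (\<lambda>x. a * \<phi> x + b * \<psi> x)
        = (\<lambda>x. a * iter_partial js \<phi> x + b * iter_partial js \<psi> x)" "js \<in> lists Basis" by auto
    then show ?case using d by (simp add: partial_deriv_lincomb)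
  qed simp
  then show ?thesis unfolding smooth_def by (auto intro!: derivative_intros d)
qed

lemma test_function_lincomb:
  assumes "test_function \<phi>" "test_function \<psi>"
  shows "test_function (\<lambda>x. a * \<phi> x + b * \<psi> x)"
proof -
  interpret A: compact_C1 \<phi> "grad \<phi>" by (rule test_function_compact_C1) fact
  interpret B: compact_C1 \<psi> "grad \<psi>" by (rule test_function_compact_C1) fact
  obtain R S where "\<And>x. R \<le> norm x \<Longrightarrow> \<phi> x = 0" "\<And>x. S \<le> norm x \<Longrightarrow> \<psi> x = 0"
    using A.support B.support by auto
  then have "a * \<phi> x + b * \<psi> x = 0" if "max R S \<le> norm x" for x using that by simp
  with smooth_lincomb[OF assms[THEN test_function_smooth]] show ?thesis by (rule test_functionI)
qed


section \<open>Spherical averages bounded by the gradient energy\<close>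

lemma ennreal_le_sqrt:
  assumes "x\<^sup>2 \<le> ennreal c" "c \<ge> 0"
  shows "x \<le> ennreal (sqrt c)"
proof (cases x)
  case (real r)
  then have "r\<^sup>2 \<le> c" using assms by (simp add: ennreal_power)
  then show ?thesis using real by (auto intro!: ennreal_leI real_le_rsqrt)
next
  case top
  then show ?thesis using assms by (simp add: power2_eq_square top_unique)
qed

definition unit_ball_volume :: "'a::euclidean_space itself \<Rightarrow> real" where
  "unit_ball_volume _ = measure lborel (ball (0::'a) 1)"

lemma emeasure_unit_ball: "emeasure lborel (ball (0::'a::euclidean_space) 1) = ennreal (unit_ball_volume TYPE('a))"
  unfolding unit_ball_volume_def by (intro emeasure_eq_ennreal_measure) (metis emeasure_lborel_ball_finite infinity_ennreal_def less_irrefl)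

lemma unit_ball_volume_pos: "unit_ball_volume TYPE('a::euclidean_space) > 0"
proof -
  show ?thesis unfolding unit_ball_volume_def by (rule content_ball_pos) simp
qed

lemma integral_sphere_measure:
  fixes f :: "'a::euclidean_space \<Rightarrow> real"
  assumes [measurable]: "f \<in> borel_measurable borel"
  shows "unit_ball_volume TYPE('a) * (\<integral>y. f y \<partial>sphere_measure x t)
    = (\<integral>y. indicator (ball 0 1) y * f (x + t *\<^sub>R sgn y) \<partial>lborel)"
proof -
  let ?V = "unit_ball_volume TYPE('a)"
  have [measurable]: "ball (0::'a) 1 \<in> sets borel" by auto
  have "uniform_measure lborel (ball (0::'a) 1) = density lborel (\<lambda>y. ennreal (indicator (ball 0 1) y / ?V))"
    unfolding uniform_measure_def emeasure_unit_ball
    using unit_ball_volume_pos[where 'a='a]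
    by (intro arg_cong[where f="density lborel"] ext) (auto simp: indicator_def divide_ennreal simp flip: ennreal_1)
  then have "(\<integral>y. f y \<partial>sphere_measure x t)
      = (\<integral>y. f (x + t *\<^sub>R sgn y) \<partial>density lborel (\<lambda>y. ennreal (indicator (ball 0 1) y / ?V)))"
    unfolding sphere_measure_def by (subst integral_distr) auto
  also have "\<dots> = (\<integral>y. (indicator (ball 0 1) y / ?V) *\<^sub>R f (x + t *\<^sub>R sgn y) \<partial>lborel)"
    using unit_ball_volume_pos[where 'a='a] by (subst integral_density) auto
  also have "\<dots> = (\<integral>y. indicator (ball 0 1) y * f (x + t *\<^sub>R sgn y) \<partial>lborel) / ?V"
    by simp
  finally show ?thesis using unit_ball_volume_pos[where 'a='a] by simp
qed

context compact_C1
begin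

definition energy :: real where "energy = (\<integral>x. (norm (g x))\<^sup>2 \<partial>lborel)"

lemma energy_nonneg: "energy \<ge> 0" unfolding energy_def by simp

lemma nn_integral_energy: "(\<integral>\<^sup>+x. (ennreal (norm (g (a + x))))\<^sup>2 \<partial>lborel) = ennreal energy"
proof -
  have "integrable lborel (\<lambda>x. (norm (g x))\<^sup>2)"
    by (intro integrable_compact_support continuous_intros grad_continuous) auto
  then have "(\<integral>\<^sup>+x. (ennreal (norm (g x)))\<^sup>2 \<partial>lborel) = ennreal energy"
    unfolding energy_def by (subst nn_integral_eq_integral[symmetric]) (auto simp: ennreal_power)
  then show ?thesis
    using nn_integral_lborel_translate[of "\<lambda>x. (ennreal (norm (g x)))\<^sup>2" a] by simp
qed

lemma integrable_sphere: "integrable lborel (\<lambda>y. indicator (ball 0 1) y * \<phi> (x + t *\<^sub>R sgn y))"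
proof -
  obtain R where R: "\<And>x. R \<le> norm x \<Longrightarrow> \<phi> x = 0" using support by auto
  have "bounded (\<phi> ` cball 0 R)"
    by (intro compact_imp_bounded compact_continuous_image continuous_on_subset[OF fun_continuous]) auto
  then obtain M where "\<forall>x\<in>cball 0 R. \<bar>\<phi> x\<bar> \<le> M" by (auto simp: bounded_iff)
  then have M: "norm x \<le> R \<Longrightarrow> \<bar>\<phi> x\<bar> \<le> M" for x by auto
  have le: "\<bar>\<phi> x\<bar> \<le> \<bar>M\<bar>" for x using M[of x] R[of x] by (cases "norm x \<le> R") auto
  have [measurable]: "ball (0::'a) 1 \<in> sets borel" by auto
  show ?thesis
  proof (rule Bochner_Integration.integrable_bound)
    show "integrable lborel (\<lambda>y. \<bar>M\<bar> * indicator (ball (0::'a) 1) y)"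
      by (intro integrable_mult_right integrable_real_indicator)
         (auto simp: emeasure_unit_ball)
    show "AE y in lborel. norm (indicator (ball 0 1) y * \<phi> (x + t *\<^sub>R sgn y)) \<le> norm (\<bar>M\<bar> * indicator (ball (0::'a) 1) y)"
      using le by (auto simp: indicator_def)
  qed measurable
qed

lemma sphere_ray_bound:
  assumes "t > 0" "y \<noteq> 0"
  shows "ennreal \<bar>\<phi> (x + t *\<^sub>R sgn y)\<bar>
    \<le> (\<integral>\<^sup>+r. indicator {0<..} r * (indicator {t<..} r * ennreal (norm (g (x + r *\<^sub>R sgn y)))) \<partial>lborel)"
proof -
  obtain R where R: "R > 0" "\<And>x. R \<le> norm x \<Longrightarrow> \<phi> x = 0" using obtain_radius by metis
  \<comment> \<open>Far enough out on the ray that \<phi> vanishes at distance s from x, so the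
    value at distance t is the increment up to s. Here \<open>sgn y\<close> has norm 1 because y is
    not 0.\<close>
  define s where "s = t + R + norm x"
  have "norm (s *\<^sub>R sgn y) = s" using assms R by (simp add: s_def norm_sgn)
  then have "R \<le> norm (x + s *\<^sub>R sgn y)"
    using norm_triangle_ineq2[of "s *\<^sub>R sgn y" "- x"] assms by (simp add: s_def add.commute)
  then have "ennreal \<bar>\<phi> (x + t *\<^sub>R sgn y)\<bar> = ennreal \<bar>\<phi> (x + s *\<^sub>R sgn y) - \<phi> (x + t *\<^sub>R sgn y)\<bar>"
    using R by simp
  also have "\<dots> \<le> (\<integral>\<^sup>+r. indicator {t<..s} r * ennreal (norm (g (x + r *\<^sub>R sgn y))) \<partial>lborel)"
    using R by (intro path_bound) (auto simp: s_def norm_sgn)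
  also have "\<dots> \<le> (\<integral>\<^sup>+r. indicator {0<..} r * (indicator {t<..} r * ennreal (norm (g (x + r *\<^sub>R sgn y)))) \<partial>lborel)"
    using assms by (intro nn_integral_mono) (auto simp: indicator_def)
  finally show ?thesis .
qed

lemma sphere_average_bound:
  assumes t: "t > 0"
  shows "ennreal (unit_ball_volume TYPE('a) * \<bar>\<integral>y. \<phi> y \<partial>sphere_measure x t\<bar>)
    \<le> (\<integral>\<^sup>+y. (\<integral>\<^sup>+r. indicator (ball 0 1) y * indicator {0<..} r *
          (indicator {t<..} r * ennreal (norm (g (x + r *\<^sub>R sgn y)))) \<partial>lborel) \<partial>lborel)"
proof -
  have [measurable]: "ball (0::'a) 1 \<in> sets borel" by auto
  have "ennreal (unit_ball_volume TYPE('a) * \<bar>\<integral>y. \<phi> y \<partial>sphere_measure x t\<bar>)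
      = ennreal (norm (\<integral>y. indicator (ball 0 1) y * \<phi> (x + t *\<^sub>R sgn y) \<partial>lborel))"
    using unit_ball_volume_pos[where 'a='a]
    by (simp add: abs_mult flip: integral_sphere_measure[OF measurable_fun])
  also have "\<dots> \<le> (\<integral>\<^sup>+y. norm (indicator (ball 0 1) y * \<phi> (x + t *\<^sub>R sgn y)) \<partial>lborel)"
    by (rule integral_norm_bound_ennreal[OF integrable_sphere])
  also have "\<dots> \<le> (\<integral>\<^sup>+y. indicator (ball 0 1) y * (\<integral>\<^sup>+r. indicator {0<..} r *
          (indicator {t<..} r * ennreal (norm (g (x + r *\<^sub>R sgn y)))) \<partial>lborel) \<partial>lborel)"
  proof (rule nn_integral_mono_AE, use AE_lborel_singleton[of "0::'a"] in eventually_elim)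
    fix y :: 'a assume "y \<noteq> 0"
    then show "ennreal (norm (indicator (ball 0 1) y * \<phi> (x + t *\<^sub>R sgn y)))
       \<le> indicator (ball 0 1) y * (\<integral>\<^sup>+r. indicator {0<..} r *
          (indicator {t<..} r * ennreal (norm (g (x + r *\<^sub>R sgn y)))) \<partial>lborel)"
      using sphere_ray_bound[OF t] by (auto simp: indicator_def)
  qed
  also have "\<dots> = (\<integral>\<^sup>+y. (\<integral>\<^sup>+r. indicator (ball 0 1) y * indicator {0<..} r *
          (indicator {t<..} r * ennreal (norm (g (x + r *\<^sub>R sgn y)))) \<partial>lborel) \<partial>lborel)"
    unfolding mult.assoc by (intro nn_integral_cong nn_integral_cmult[symmetric]) measurable
  finally show ?thesis .
qed

text \<open>The weights of the radial integral below are those of the Green function, so this is the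
  upper bound \<open>cov \<le> C * max s t powr (2 - DIM('a))\<close> for the covariances of spherical averages,
  summed against weights.\<close>

lemma weighted_sphere_averages:
  fixes w \<tau> :: "'k \<Rightarrow> real"
  assumes K: "finite K" and w: "\<And>k. k \<in> K \<Longrightarrow> w k \<ge> 0" and t: "\<And>k. k \<in> K \<Longrightarrow> \<tau> k > 0"
    and dim: "DIM('a) > 2"
  shows "(\<Sum>k\<in>K. w k * \<bar>\<integral>y. \<phi> y \<partial>sphere_measure x (\<tau> k)\<bar>)\<^sup>2
    \<le> 1 / (unit_ball_volume TYPE('a) * real DIM('a) * real (DIM('a) - 2))
       * (\<Sum>k\<in>K. \<Sum>l\<in>K. w k * w l / max (\<tau> k) (\<tau> l) ^ (DIM('a) - 2)) * energy"
proof -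
  let ?V = "unit_ball_volume TYPE('a)" and ?n = "DIM('a)"
  let ?G = "\<lambda>z. ennreal (norm (g (x + z)))"
  \<comment> \<open>The rays for all radii have the same directions and differ only in where they
    start. The weighted sum is therefore bounded by one polar integral with the step function
    \<open>W\<close>, and the square of \<open>W\<close> produces the double sum with
    \<open>max (\<tau> k) (\<tau> l)\<close>.\<close>
  define W where "W r = (\<Sum>k\<in>K. ennreal (w k) * indicator {\<tau> k<..} r)" for r
  define S where "S = (\<Sum>k\<in>K. w k * \<bar>\<integral>y. \<phi> y \<partial>sphere_measure x (\<tau> k)\<bar>)"
  define Q where "Q = (\<Sum>k\<in>K. \<Sum>l\<in>K. w k * w l / max (\<tau> k) (\<tau> l) ^ (?n - 2))"
  have V: "?V > 0" by (rule unit_ball_volume_pos)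
  have S0: "S \<ge> 0" unfolding S_def using w by (intro sum_nonneg) auto
  have Q0: "Q \<ge> 0" unfolding Q_def using w t by (intro sum_nonneg divide_nonneg_nonneg) (auto simp: le_max_iff_disj less_imp_le)
  have term0: "0 \<le> 1 / real (?n - 2) * (w k * w l / max (\<tau> k) (\<tau> l) ^ (?n - 2))"
    if "k \<in> K" "l \<in> K" for k l
    using w[OF that(1)] w[OF that(2)] t[OF that(1)] by (auto simp: le_max_iff_disj)
  have [measurable]: "ball (0::'a) 1 \<in> sets borel" "{s::real<..} \<in> sets borel" for s by auto
  have Wm[measurable]: "W \<in> borel_measurable borel" unfolding W_def by measurable
  have "ennreal (?V * S) = (\<Sum>k\<in>K. ennreal (w k) * ennreal (?V * \<bar>\<integral>y. \<phi> y \<partial>sphere_measure x (\<tau> k)\<bar>))"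
  proof -
    have "?V * S = (\<Sum>k\<in>K. w k * (?V * \<bar>\<integral>y. \<phi> y \<partial>sphere_measure x (\<tau> k)\<bar>))"
      unfolding S_def by (simp add: sum_distrib_left mult_ac)
    then show ?thesis using V w by (simp add: ennreal_mult[symmetric] sum_ennreal)
  qed
  also have "\<dots> \<le> (\<Sum>k\<in>K. ennreal (w k) * (\<integral>\<^sup>+y. (\<integral>\<^sup>+r. indicator (ball 0 1) y * indicator {0<..} r *
          (indicator {\<tau> k<..} r * ?G (r *\<^sub>R sgn y)) \<partial>lborel) \<partial>lborel))"
    by (intro sum_mono mult_left_mono sphere_average_bound t) auto
  also have "\<dots> = (\<integral>\<^sup>+y. (\<integral>\<^sup>+r. indicator (ball 0 1) y * indicator {0<..} r *
          (W r * ?G (r *\<^sub>R sgn y)) \<partial>lborel) \<partial>lborel)"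
    unfolding W_def
    by (subst nn_integral_cmult[symmetric], measurable, subst nn_integral_sum[symmetric], measurable,
        intro nn_integral_cong, subst nn_integral_cmult[symmetric], measurable,
        subst nn_integral_sum[symmetric], measurable, intro nn_integral_cong)
       (simp add: sum_distrib_left sum_distrib_right mult_ac)
  finally have "(ennreal (?V * S))\<^sup>2 \<le> (\<integral>\<^sup>+y. (\<integral>\<^sup>+r. indicator (ball 0 1) y * indicator {0<..} r *
          (W r * ?G (r *\<^sub>R sgn y)) \<partial>lborel) \<partial>lborel)\<^sup>2"
    by (rule power_mono) simp
  also have "\<dots> \<le> emeasure lborel (ball (0::'a) 1) *
         (\<integral>\<^sup>+r. indicator {0<..} r * ((W r)\<^sup>2 * ennreal (1 / r ^ (?n - 1))) \<partial>lborel) *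
       (ennreal (1 / ?n) * (\<integral>\<^sup>+z. (?G z)\<^sup>2 \<partial>lborel))"
    by (rule polar_Cauchy_Schwarz) measurable
  also have "(\<integral>\<^sup>+r. indicator {0<..} r * ((W r)\<^sup>2 * ennreal (1 / r ^ (?n - 1))) \<partial>lborel)
      = (\<integral>\<^sup>+r. (\<Sum>k\<in>K. \<Sum>l\<in>K. ennreal (w k * w l) *
           (ennreal (1 / r ^ Suc (?n - 2)) * indicator {max (\<tau> k) (\<tau> l)<..} r)) \<partial>lborel)"
  proof (rule nn_integral_cong)
    fix r :: real
    have n: "Suc (?n - 2) = ?n - 1" using dim by simp
    have "indicator {0<..} r * ((W r)\<^sup>2 * ennreal (1 / r ^ (?n - 1)))
      = (\<Sum>k\<in>K. \<Sum>l\<in>K. indicator {0<..} r * (ennreal (w k) * ennreal (w l)) *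
           (ennreal (1 / r ^ (?n - 1)) * (indicator {\<tau> k<..} r * indicator {\<tau> l<..} r)))"
      unfolding W_def power2_eq_square sum_product
      by (simp add: sum_distrib_left sum_distrib_right mult_ac)
    also have "\<dots> = (\<Sum>k\<in>K. \<Sum>l\<in>K. ennreal (w k * w l) *
           (ennreal (1 / r ^ Suc (?n - 2)) * indicator {max (\<tau> k) (\<tau> l)<..} r))"
    proof (intro sum.cong refl)
      fix k l assume "k \<in> K" "l \<in> K"
      then show "indicator {0<..} r * (ennreal (w k) * ennreal (w l)) *
           (ennreal (1 / r ^ (?n - 1)) * (indicator {\<tau> k<..} r * indicator {\<tau> l<..} r))
        = ennreal (w k * w l) * (ennreal (1 / r ^ Suc (?n - 2)) * indicator {max (\<tau> k) (\<tau> l)<..} r)"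
        using w t[of k] unfolding n by (auto simp: indicator_def ennreal_mult)
    qed
    finally show "indicator {0<..} r * ((W r)\<^sup>2 * ennreal (1 / r ^ (?n - 1)))
      = (\<Sum>k\<in>K. \<Sum>l\<in>K. ennreal (w k * w l) *
           (ennreal (1 / r ^ Suc (?n - 2)) * indicator {max (\<tau> k) (\<tau> l)<..} r))" .
  qed
  also have "\<dots> = (\<Sum>k\<in>K. \<Sum>l\<in>K. ennreal (w k * w l) *
      ennreal (1 / (real (?n - 2) * max (\<tau> k) (\<tau> l) ^ (?n - 2))))"
  proof (subst nn_integral_sum, measurable, intro sum.cong refl, subst nn_integral_sum, measurable,
      intro sum.cong refl, subst nn_integral_cmult, measurable)
    fix k l assume "k \<in> K" "l \<in> K"
    then have "max (\<tau> k) (\<tau> l) > 0" using t[of k] by simp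
    from nn_integral_inverse_power_Ioi[OF this, of "?n - 2"] dim
    show "ennreal (w k * w l) * (\<integral>\<^sup>+r. ennreal (1 / r ^ Suc (?n - 2)) * indicator {max (\<tau> k) (\<tau> l)<..} r \<partial>lborel)
      = ennreal (w k * w l) * ennreal (1 / (real (?n - 2) * max (\<tau> k) (\<tau> l) ^ (?n - 2)))" by simp
  qed
  also have "\<dots> = (\<Sum>k\<in>K. \<Sum>l\<in>K. ennreal (1 / real (?n - 2) * (w k * w l / max (\<tau> k) (\<tau> l) ^ (?n - 2))))"
    using w t by (intro sum.cong refl) (auto simp: ennreal_mult[symmetric] less_imp_le le_max_iff_disj field_simps)
  also have "\<dots> = (\<Sum>k\<in>K. ennreal (\<Sum>l\<in>K. 1 / real (?n - 2) * (w k * w l / max (\<tau> k) (\<tau> l) ^ (?n - 2))))"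
    using term0 by (intro sum.cong refl sum_ennreal) auto
  also have "\<dots> = ennreal (1 / real (?n - 2) * Q)"
    unfolding Q_def sum_distrib_left using term0 by (intro sum_ennreal sum_nonneg) auto
  finally have "(ennreal (?V * S))\<^sup>2 \<le> ennreal ?V * ennreal (1 / real (?n - 2) * Q) * (ennreal (1 / ?n) * ennreal energy)"
    unfolding nn_integral_energy emeasure_unit_ball .
  moreover have "ennreal a * ennreal b * (ennreal c * ennreal d) = ennreal (a * b * (c * d))"
    if "a \<ge> 0" "b \<ge> 0" "c \<ge> 0" "d \<ge> 0" for a b c d
    using that by (simp add: ennreal_mult[symmetric])
  moreover have "(ennreal (?V * S))\<^sup>2 = ennreal ((?V * S)\<^sup>2)"
    using V S0 by (intro ennreal_power) simp
  ultimately have "ennreal ((?V * S)\<^sup>2) \<le> ennreal (?V * (1 / real (?n - 2) * Q) * ((1 / ?n) * energy))"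
    using V Q0 energy_nonneg by simp
  then have "(?V * S)\<^sup>2 \<le> ?V * (1 / real (?n - 2) * Q) * ((1 / ?n) * energy)"
    using V Q0 energy_nonneg by (subst (asm) ennreal_le_iff) (intro mult_nonneg_nonneg, auto)
  moreover have "(?V * S)\<^sup>2 = ?V * (?V * S\<^sup>2)" by (simp add: power2_eq_square)
  ultimately have "?V * S\<^sup>2 \<le> (1 / real (?n - 2) * Q) * ((1 / ?n) * energy)"
    using V by (simp only: mult.assoc mult_le_cancel_left_pos)
  then have "S\<^sup>2 \<le> (1 / real (?n - 2) * Q) * ((1 / ?n) * energy) / ?V"
    by (subst pos_le_divide_eq[OF V], subst mult.commute)
  then show ?thesis unfolding S_def[symmetric] Q_def[symmetric] by (simp add: mult_ac)
qed

text \<open>The difference is integrated along the segment from y to x. One factor of the distance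
  comes from Cauchy-Schwarz on the segment, the other from its length after exchanging the
  integrals, since the energy does not change under translation.\<close>

lemma translation_bound:
  "(\<integral>\<^sup>+z. (ennreal \<bar>\<phi> (x + z) - \<phi> (y + z)\<bar>)\<^sup>2 \<partial>lborel) \<le> ennreal ((dist x y)\<^sup>2 * energy)"
proof (cases "x = y")
  case False
  define \<delta> where "\<delta> = dist x y"
  define v where "v = (x - y) /\<^sub>R \<delta>"
  have \<delta>: "\<delta> > 0" using False by (simp add: \<delta>_def)
  have v: "norm v \<le> 1" "y + \<delta> *\<^sub>R v = x" using \<delta> by (auto simp: v_def \<delta>_def dist_norm)
  have [measurable]: "{0<..\<delta>} \<in> sets borel" by auto
  have "(ennreal \<bar>\<phi> (x + z) - \<phi> (y + z)\<bar>)\<^sup>2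
      \<le> ennreal \<delta> * (\<integral>\<^sup>+r. indicator {0<..\<delta>} r * (ennreal (norm (g ((y + r *\<^sub>R v) + z))))\<^sup>2 \<partial>lborel)" for z
  proof -
    have "ennreal \<bar>\<phi> (x + z) - \<phi> (y + z)\<bar>
        \<le> (\<integral>\<^sup>+r. indicator {0<..\<delta>} r * ennreal (norm (g ((y + z) + r *\<^sub>R v))) \<partial>lborel)"
      using path_bound[of 0 \<delta> v "y + z"] v \<delta> by (simp add: add_ac flip: v(2))
    also have "\<dots> = (\<integral>\<^sup>+r. indicator {0<..\<delta>} r * (indicator {0<..\<delta>} r * ennreal (norm (g ((y + r *\<^sub>R v) + z)))) \<partial>lborel)"
      by (intro nn_integral_cong) (auto simp: indicator_def add_ac)
    finally have "(ennreal \<bar>\<phi> (x + z) - \<phi> (y + z)\<bar>)\<^sup>2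
      \<le> (\<integral>\<^sup>+r. indicator {0<..\<delta>} r * (indicator {0<..\<delta>} r * ennreal (norm (g ((y + r *\<^sub>R v) + z)))) \<partial>lborel)\<^sup>2"
      by (rule power_mono) simp
    also have "\<dots> \<le> (\<integral>\<^sup>+r. (indicator {0<..\<delta>} r)\<^sup>2 \<partial>lborel) *
        (\<integral>\<^sup>+r. (indicator {0<..\<delta>} r * ennreal (norm (g ((y + r *\<^sub>R v) + z))))\<^sup>2 \<partial>lborel)"
      by (rule Cauchy_Schwarz_nn_integral) measurable
    also have "(\<integral>\<^sup>+r. (indicator {0<..\<delta>} r)\<^sup>2 \<partial>lborel) = (\<integral>\<^sup>+r. indicator {0<..\<delta>} r \<partial>lborel)"
      by (intro nn_integral_cong) (auto simp: indicator_def)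
    also have "\<dots> = ennreal \<delta>" using \<delta> by simp
    also have "(\<integral>\<^sup>+r. (indicator {0<..\<delta>} r * ennreal (norm (g ((y + r *\<^sub>R v) + z))))\<^sup>2 \<partial>lborel)
      = (\<integral>\<^sup>+r. indicator {0<..\<delta>} r * (ennreal (norm (g ((y + r *\<^sub>R v) + z))))\<^sup>2 \<partial>lborel)"
      by (intro nn_integral_cong) (auto simp: indicator_def)
    finally show ?thesis .
  qed
  then have "(\<integral>\<^sup>+z. (ennreal \<bar>\<phi> (x + z) - \<phi> (y + z)\<bar>)\<^sup>2 \<partial>lborel)
    \<le> (\<integral>\<^sup>+z. ennreal \<delta> * (\<integral>\<^sup>+r. indicator {0<..\<delta>} r * (ennreal (norm (g ((y + r *\<^sub>R v) + z))))\<^sup>2 \<partial>lborel) \<partial>lborel)"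
    by (rule nn_integral_mono)
  also have "\<dots> = ennreal \<delta> * (\<integral>\<^sup>+z. (\<integral>\<^sup>+r. indicator {0<..\<delta>} r * (ennreal (norm (g ((y + r *\<^sub>R v) + z))))\<^sup>2 \<partial>lborel) \<partial>lborel)"
    by (rule nn_integral_cmult) measurable
  also have "(\<integral>\<^sup>+z. (\<integral>\<^sup>+r. indicator {0<..\<delta>} r * (ennreal (norm (g ((y + r *\<^sub>R v) + z))))\<^sup>2 \<partial>lborel) \<partial>lborel)
    = (\<integral>\<^sup>+r. (\<integral>\<^sup>+z. indicator {0<..\<delta>} r * (ennreal (norm (g ((y + r *\<^sub>R v) + z))))\<^sup>2 \<partial>lborel) \<partial>lborel)"
    by (rule lborel_pair.Fubini') measurable
  also have "\<dots> = (\<integral>\<^sup>+r. indicator {0<..\<delta>} r * ennreal energy \<partial>lborel)"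
    by (intro nn_integral_cong, subst nn_integral_cmult) (measurable, simp add: nn_integral_energy)
  also have "\<dots> = ennreal \<delta> * ennreal energy"
    using \<delta> by (subst nn_integral_multc) auto
  finally show ?thesis using \<delta> energy_nonneg
    by (simp add: ennreal_mult[symmetric] power2_eq_square mult.assoc \<delta>_def[symmetric])
qed simp

end

text \<open>The radial weight is the indicator of the shell, and on the shell 1 / r^(n-1) is at most
  1 / t^(n-1). The bound has order sqrt \<delta>, which is where the linear dependence of the
  squared modulus on the distance originates.\<close>

lemma shell_bound:
  fixes G :: "'a::euclidean_space \<Rightarrow> ennreal"
  assumes [measurable]: "G \<in> borel_measurable borel" and t: "t > 0" and \<delta>: "\<delta> > 0"
    and G: "(\<integral>\<^sup>+z. (G z)\<^sup>2 \<partial>lborel) \<le> ennreal e" and e: "e \<ge> 0"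
  shows "(\<integral>\<^sup>+y. indicator (ball 0 1) y * (\<integral>\<^sup>+r. indicator {t<..t+\<delta>} r * G (r *\<^sub>R sgn y) \<partial>lborel) \<partial>lborel)
    \<le> ennreal (sqrt (unit_ball_volume TYPE('a) * (\<delta> / t ^ (DIM('a) - 1)) * (1 / DIM('a) * e)))"
proof (rule ennreal_le_sqrt)
  let ?V = "unit_ball_volume TYPE('a)" and ?n = "DIM('a)"
  have V: "?V > 0" by (rule unit_ball_volume_pos)
  then show "0 \<le> ?V * (\<delta> / t ^ (?n - 1)) * (1 / ?n * e)" using t \<delta> e by simp
  have [measurable]: "ball (0::'a) 1 \<in> sets borel" "{t<..t+\<delta>} \<in> sets borel" by auto
  have "(\<integral>\<^sup>+y. indicator (ball 0 1) y * (\<integral>\<^sup>+r. indicator {t<..t+\<delta>} r * G (r *\<^sub>R sgn y) \<partial>lborel) \<partial>lborel)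
     = (\<integral>\<^sup>+y. (\<integral>\<^sup>+r. indicator (ball 0 1) y * (indicator {t<..t+\<delta>} r * G (r *\<^sub>R sgn y)) \<partial>lborel) \<partial>lborel)"
    by (intro nn_integral_cong nn_integral_cmult[symmetric]) measurable
  also have "\<dots> = (\<integral>\<^sup>+y. (\<integral>\<^sup>+r. indicator (ball 0 1) y * indicator {0<..} r *
      (indicator {t<..t+\<delta>} r * G (r *\<^sub>R sgn y)) \<partial>lborel) \<partial>lborel)"
    using t by (intro nn_integral_cong) (auto simp: indicator_def)
  finally have "(\<integral>\<^sup>+y. indicator (ball 0 1) y * (\<integral>\<^sup>+r. indicator {t<..t+\<delta>} r * G (r *\<^sub>R sgn y) \<partial>lborel) \<partial>lborel)\<^sup>2
     = (\<integral>\<^sup>+y. (\<integral>\<^sup>+r. indicator (ball 0 1) y * indicator {0<..} r *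
      (indicator {t<..t+\<delta>} r * G (r *\<^sub>R sgn y)) \<partial>lborel) \<partial>lborel)\<^sup>2" by simp
  also have "\<dots> \<le> emeasure lborel (ball (0::'a) 1) *
         (\<integral>\<^sup>+r. indicator {0<..} r * ((indicator {t<..t+\<delta>} r)\<^sup>2 * ennreal (1 / r ^ (?n - 1))) \<partial>lborel) *
       (ennreal (1 / ?n) * (\<integral>\<^sup>+z. (G z)\<^sup>2 \<partial>lborel))"
    by (rule polar_Cauchy_Schwarz) measurable
  also have "\<dots> \<le> ennreal ?V * ennreal (\<delta> / t ^ (?n - 1)) * (ennreal (1 / ?n) * ennreal e)"
    unfolding emeasure_unit_ball
  proof (intro mult_mono G order_refl)
    have "(\<integral>\<^sup>+r. indicator {0<..} r * ((indicator {t<..t+\<delta>} r)\<^sup>2 * ennreal (1 / r ^ (?n - 1))) \<partial>lborel)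
       \<le> (\<integral>\<^sup>+r. ennreal (1 / t ^ (?n - 1)) * indicator {t<..t+\<delta>} r \<partial>lborel)"
      using t by (intro nn_integral_mono) (auto simp: indicator_def intro!: ennreal_leI divide_left_mono power_mono)
    also have "\<dots> = ennreal (1 / t ^ (?n - 1)) * ennreal \<delta>"
      using \<delta> by (subst nn_integral_cmult) auto
    finally show "(\<integral>\<^sup>+r. indicator {0<..} r * ((indicator {t<..t+\<delta>} r)\<^sup>2 * ennreal (1 / r ^ (?n - 1))) \<partial>lborel)
       \<le> ennreal (\<delta> / t ^ (?n - 1))" using t \<delta> by (simp add: ennreal_mult[symmetric])
  qed auto
  also have "\<dots> = ennreal (?V * (\<delta> / t ^ (?n - 1)) * (1 / ?n * e))"
    using V t \<delta> e by (simp add: ennreal_mult[symmetric])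
  finally show "(\<integral>\<^sup>+y. indicator (ball 0 1) y * (\<integral>\<^sup>+r. indicator {t<..t+\<delta>} r * G (r *\<^sub>R sgn y) \<partial>lborel) \<partial>lborel)\<^sup>2
    \<le> ennreal (?V * (\<delta> / t ^ (?n - 1)) * (1 / ?n * e))" .
qed

text \<open>Both spherical averages are compared with averages over the shell of width \<open>dist x y\<close>.\<close>

lemma (in compact_C1) sphere_average_modulus:
  assumes t: "t > 0"
  shows "((\<integral>z. \<phi> z \<partial>sphere_measure x t) - (\<integral>z. \<phi> z \<partial>sphere_measure y t))\<^sup>2
    \<le> 9 / (unit_ball_volume TYPE('a) * DIM('a)) * (dist x y / t ^ (DIM('a) - 1)) * energy"
proof (cases "x = y")
  case False
  let ?V = "unit_ball_volume TYPE('a)" and ?n = "DIM('a)"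
  define \<delta> where "\<delta> = dist x y"
  have \<delta>: "\<delta> > 0" using False by (simp add: \<delta>_def)
  have V: "?V > 0" by (rule unit_ball_volume_pos)
  have [measurable]: "ball (0::'a) 1 \<in> sets borel" "{t<..t+\<delta>} \<in> sets borel" by auto
  define c where "c = sqrt (?V * (\<delta> / t ^ (?n - 1)) * (1 / ?n * energy))"
  have c0: "c \<ge> 0" unfolding c_def using V t \<delta> energy_nonneg by simp
  define \<psi> where "\<psi> z = \<phi> (x + z) - \<phi> (y + z)" for z
  have [measurable]: "\<psi> \<in> borel_measurable borel" unfolding \<psi>_def by measurable
  define J where "J = (\<integral>\<^sup>+w. indicator (ball 0 1) w * ennreal \<bar>\<psi> (t *\<^sub>R sgn w)\<bar> \<partial>lborel)"
  define A where "A z w = (\<integral>\<^sup>+r. indicator {t<..t+\<delta>} r * ennreal (norm (g (z + r *\<^sub>R sgn w))) \<partial>lborel)" for z w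
  define B where "B w = (\<integral>\<^sup>+r. indicator {t<..t+\<delta>} r * ennreal \<bar>\<psi> (r *\<^sub>R sgn w)\<bar> \<partial>lborel)" for w
  have [measurable]: "A z \<in> borel_measurable borel" "B \<in> borel_measurable borel" for z
    unfolding A_def B_def by measurable
  have Ale: "(\<integral>\<^sup>+w. indicator (ball 0 1) w * A z w \<partial>lborel) \<le> ennreal c" for z
    unfolding A_def c_def using energy_nonneg t \<delta>
    by (intro shell_bound) (auto simp: nn_integral_energy)
  have Ble: "(\<integral>\<^sup>+w. indicator (ball 0 1) w * B w \<partial>lborel) \<le> ennreal (\<delta> * c)"
  proof -
    have "(\<integral>\<^sup>+w. indicator (ball 0 1) w * B w \<partial>lborel)
      \<le> ennreal (sqrt (?V * (\<delta> / t ^ (?n - 1)) * (1 / ?n * (\<delta>\<^sup>2 * energy))))"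
      unfolding B_def using energy_nonneg t \<delta> translation_bound[of x y]
      by (intro shell_bound) (auto simp: \<psi>_def \<delta>_def)
    also have "?V * (\<delta> / t ^ (?n - 1)) * (1 / ?n * (\<delta>\<^sup>2 * energy))
        = \<delta>\<^sup>2 * (?V * (\<delta> / t ^ (?n - 1)) * (1 / ?n * energy))" by simp
    finally show ?thesis using \<delta> by (simp only: real_sqrt_mult c_def real_sqrt_abs) simp
  qed
  \<comment> \<open>A translation bound in L2 says nothing about a single sphere. So the value on
    the sphere is compared with all radii r in the shell and integrated over r: two radial
    increments, \<open>A x\<close> and \<open>A y\<close>, and one translated difference,
    \<open>B\<close>. With shell width equal to the translation distance each of the three costs
    \<delta> * c after integration over directions, hence 3 * c below and the 9 in the
    statement.\<close>
  have pt: "ennreal \<delta> * ennreal \<bar>\<psi> (t *\<^sub>R sgn w)\<bar> \<le> ennreal \<delta> * (A x w + A y w) + B w" for w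
  proof -
    have shift: "ennreal \<bar>\<phi> (z + r *\<^sub>R sgn w) - \<phi> (z + t *\<^sub>R sgn w)\<bar> \<le> A z w"
      if "r \<in> {t<..t+\<delta>}" for r z
    proof -
      have "ennreal \<bar>\<phi> (z + r *\<^sub>R sgn w) - \<phi> (z + t *\<^sub>R sgn w)\<bar>
        \<le> (\<integral>\<^sup>+s. indicator {t<..r} s * ennreal (norm (g (z + s *\<^sub>R sgn w))) \<partial>lborel)"
        using that by (intro path_bound) (auto simp: norm_sgn)
      also have "\<dots> \<le> A z w"
        unfolding A_def using that by (intro nn_integral_mono) (auto simp: indicator_def)
      finally show ?thesis .
    qed
    have "ennreal \<bar>\<psi> (t *\<^sub>R sgn w)\<bar> \<le> A x w + A y w + ennreal \<bar>\<psi> (r *\<^sub>R sgn w)\<bar>"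
      if r: "r \<in> {t<..t+\<delta>}" for r
    proof -
      have "ennreal \<bar>\<psi> (t *\<^sub>R sgn w)\<bar> \<le> ennreal (\<bar>\<phi> (x + r *\<^sub>R sgn w) - \<phi> (x + t *\<^sub>R sgn w)\<bar>
         + \<bar>\<phi> (y + r *\<^sub>R sgn w) - \<phi> (y + t *\<^sub>R sgn w)\<bar> + \<bar>\<psi> (r *\<^sub>R sgn w)\<bar>)"
        unfolding \<psi>_def by (intro ennreal_leI) linarith
      also have "\<dots> = ennreal \<bar>\<phi> (x + r *\<^sub>R sgn w) - \<phi> (x + t *\<^sub>R sgn w)\<bar>
         + ennreal \<bar>\<phi> (y + r *\<^sub>R sgn w) - \<phi> (y + t *\<^sub>R sgn w)\<bar> + ennreal \<bar>\<psi> (r *\<^sub>R sgn w)\<bar>"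
        by (simp add: ennreal_plus)
      also have "\<dots> \<le> A x w + A y w + ennreal \<bar>\<psi> (r *\<^sub>R sgn w)\<bar>"
        by (intro add_mono shift r order_refl)
      finally show ?thesis .
    qed
    then have "(\<integral>\<^sup>+r. indicator {t<..t+\<delta>} r * ennreal \<bar>\<psi> (t *\<^sub>R sgn w)\<bar> \<partial>lborel)
      \<le> (\<integral>\<^sup>+r. indicator {t<..t+\<delta>} r * (A x w + A y w) + indicator {t<..t+\<delta>} r * ennreal \<bar>\<psi> (r *\<^sub>R sgn w)\<bar> \<partial>lborel)"
      by (intro nn_integral_mono) (auto simp: indicator_def)
    also have "\<dots> = (\<integral>\<^sup>+r. indicator {t<..t+\<delta>} r * (A x w + A y w) \<partial>lborel) + B w"
      unfolding B_def by (rule nn_integral_add) auto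
    finally show ?thesis using \<delta> by (simp add: nn_integral_multc)
  qed
  have "ennreal \<delta> * J = (\<integral>\<^sup>+w. indicator (ball 0 1) w * (ennreal \<delta> * ennreal \<bar>\<psi> (t *\<^sub>R sgn w)\<bar>) \<partial>lborel)"
    unfolding J_def by (subst nn_integral_cmult[symmetric]) (auto simp: mult_ac)
  also have "\<dots> \<le> (\<integral>\<^sup>+w. indicator (ball 0 1) w * (ennreal \<delta> * (A x w + A y w) + B w) \<partial>lborel)"
    by (intro nn_integral_mono mult_left_mono pt) auto
  also have "\<dots> = (\<integral>\<^sup>+w. ennreal \<delta> * (indicator (ball 0 1) w * A x w) + ennreal \<delta> * (indicator (ball 0 1) w * A y w)
      + indicator (ball 0 1) w * B w \<partial>lborel)"
    by (intro nn_integral_cong) (simp add: distrib_left mult_ac)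
  also have "\<dots> = ennreal \<delta> * (\<integral>\<^sup>+w. indicator (ball 0 1) w * A x w \<partial>lborel)
      + ennreal \<delta> * (\<integral>\<^sup>+w. indicator (ball 0 1) w * A y w \<partial>lborel) + (\<integral>\<^sup>+w. indicator (ball 0 1) w * B w \<partial>lborel)"
    by (simp add: nn_integral_add nn_integral_cmult)
  also have "\<dots> \<le> ennreal \<delta> * ennreal c + ennreal \<delta> * ennreal c + ennreal (\<delta> * c)"
    by (intro add_mono mult_left_mono Ale Ble) auto
  also have "\<dots> = ennreal \<delta> * ennreal (3 * c)"
    using \<delta> c0 by (simp add: ennreal_mult[symmetric] ennreal_plus[symmetric] del: ennreal_plus)
  finally have J: "J \<le> ennreal (3 * c)"
    using \<delta> by (simp add: ennreal_mult_le_mult_iff)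
  define D where "D = (\<integral>z. \<phi> z \<partial>sphere_measure x t) - (\<integral>z. \<phi> z \<partial>sphere_measure y t)"
  have "?V * D = (\<integral>w. indicator (ball 0 1) w * \<phi> (x + t *\<^sub>R sgn w) - indicator (ball 0 1) w * \<phi> (y + t *\<^sub>R sgn w) \<partial>lborel)"
    unfolding D_def right_diff_distrib integral_sphere_measure[OF measurable_fun]
    by (rule Bochner_Integration.integral_diff[symmetric]) (rule integrable_sphere)+
  also have "ennreal (norm \<dots>) \<le> (\<integral>\<^sup>+w. norm (indicator (ball 0 1) w * \<phi> (x + t *\<^sub>R sgn w)
      - indicator (ball 0 1) w * \<phi> (y + t *\<^sub>R sgn w)) \<partial>lborel)"
    by (intro integral_norm_bound_ennreal Bochner_Integration.integrable_diff integrable_sphere)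
  also have "\<dots> = J"
    unfolding J_def \<psi>_def by (intro nn_integral_cong) (auto simp: indicator_def)
  also note J
  finally have "?V * \<bar>D\<bar> \<le> 3 * c" using c0 V by (simp add: abs_mult)
  then have "(?V * \<bar>D\<bar>)\<^sup>2 \<le> (3 * c)\<^sup>2" using V by (intro power_mono) auto
  also have "(3 * c)\<^sup>2 = 9 * (?V * (\<delta> / t ^ (?n - 1)) * (1 / ?n * energy))"
    unfolding c_def using V t \<delta> energy_nonneg by (simp add: power_mult_distrib)
  also have "\<dots> = ?V * (9 * ((\<delta> / t ^ (?n - 1)) * (1 / ?n * energy)))" by simp
  also have "(?V * \<bar>D\<bar>)\<^sup>2 = ?V * (?V * D\<^sup>2)" by (simp add: power_mult_distrib) (simp add: power2_eq_square)
  finally have "?V * D\<^sup>2 \<le> 9 * ((\<delta> / t ^ (?n - 1)) * (1 / ?n * energy))"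
    using V by (simp only: mult_le_cancel_left_pos)
  then have "D\<^sup>2 \<le> 9 * ((\<delta> / t ^ (?n - 1)) * (1 / ?n * energy)) / ?V"
    by (subst pos_le_divide_eq[OF V], subst mult.commute)
  then show ?thesis unfolding D_def[symmetric] \<delta>_def[symmetric] by (simp add: mult_ac)
qed (use energy_nonneg in simp)


section \<open>Rescaled bump functions\<close>

text \<open>The functions exp (- 1 / s) / s^k, cut off at 0: the derivative of each is a combination
  of two others, so smoothness of the bump functions needs only first derivatives of this
  family.\<close>

definition flat_exp :: "nat \<Rightarrow> real \<Rightarrow> real" where
  "flat_exp k s = (if s \<le> 0 then 0 else exp (- 1 / s) / s ^ k)"

lemma flat_exp_nonneg: "flat_exp k s \<ge> 0"
  by (simp add: flat_exp_def)

text \<open>From exp u >= (u / p)^p at u = 1 / s with p = k + 2. Two powers of s survive the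
  division by s^k, which makes the derivative at 0 exist and vanish.\<close>

lemma flat_exp_quadratic_bound: "flat_exp k s \<le> (real k + 2) ^ (k + 2) * s\<^sup>2"
proof (cases "s > 0")
  case s: True
  let ?n = "k + 2"
  have "(1 / (s * real ?n)) ^ ?n \<le> (1 + (1/s) / real ?n) ^ ?n"
    using s by (intro power_mono) auto
  also have "\<dots> \<le> exp (1 / s)"
    using s by (intro exp_ge_one_plus_x_over_n_power_n) (auto intro: order_trans[of _ 0])
  finally have "inverse (exp (1 / s)) \<le> inverse ((1 / (s * real ?n)) ^ ?n)"
    using s by (intro le_imp_inverse_le zero_less_power) auto
  then have "exp (- (1 / s)) \<le> (s * real ?n) ^ ?n"
    by (simp only: exp_minus power_one_over inverse_eq_divide) simp
  then have "exp (- (1 / s)) / s ^ k \<le> (s * real ?n) ^ ?n / s ^ k"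
    using s by (intro divide_right_mono) auto
  also have "\<dots> = (real k + 2) ^ (k + 2) * s\<^sup>2"
    using s by (simp add: power_mult_distrib power_add add_ac power2_eq_square)
  finally show ?thesis using s by (simp add: flat_exp_def)
qed (simp add: flat_exp_def)

lemma flat_exp_deriv:
  "(flat_exp k has_real_derivative (flat_exp (k + 2) s - real k * flat_exp (k + 1) s)) (at s)"
proof -
  consider "s > 0" | "s < 0" | "s = 0" by linarith
  then show ?thesis
  proof cases
    case 1
    have "((\<lambda>s. exp (- 1 / s)) has_real_derivative exp (- 1 / s) * (1 / s\<^sup>2)) (at s)"
      using 1 by (auto intro!: derivative_eq_intros simp: power2_eq_square)
    moreover have "((\<lambda>s. s ^ k) has_real_derivative real k * s ^ (k - 1)) (at s)"
      by (rule DERIV_cong[OF DERIV_pow]) simp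
    ultimately have "((\<lambda>s. exp (- 1 / s) / s ^ k) has_real_derivative
        (exp (- 1 / s) * (1 / s\<^sup>2) * s ^ k - exp (- 1 / s) * (real k * s ^ (k - 1))) / (s ^ k * s ^ k)) (at s)"
      using 1 by (intro DERIV_divide) auto
    moreover have "(exp (- 1 / s) * (1 / s\<^sup>2) * s ^ k - exp (- 1 / s) * (real k * s ^ (k - 1))) / (s ^ k * s ^ k)
        = flat_exp (k + 2) s - real k * flat_exp (k + 1) s"
      using 1 by (cases k) (auto simp: flat_exp_def field_simps power2_eq_square)
    ultimately have "((\<lambda>s. exp (- 1 / s) / s ^ k) has_real_derivative
        flat_exp (k + 2) s - real k * flat_exp (k + 1) s) (at s)" by simp
    then show ?thesis
      by (rule has_field_derivative_transform_within_open[of _ _ _ "{0<..}"])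
         (use 1 in \<open>auto simp: flat_exp_def\<close>)
  next
    case 2
    have "((\<lambda>s. 0) has_real_derivative flat_exp (k + 2) s - real k * flat_exp (k + 1) s) (at s)"
      using 2 by (simp add: flat_exp_def)
    then show ?thesis
      by (rule has_field_derivative_transform_within_open[of _ _ _ "{..<0}"])
         (use 2 in \<open>auto simp: flat_exp_def\<close>)
  next
    case 3
    define C where "C = (real k + 2) ^ (k + 2)"
    have "(\<lambda>h. (flat_exp k (0 + h) - flat_exp k 0) / h) \<midarrow>0\<rightarrow> 0"
    proof (rule Lim_null_comparison)
      have "norm (flat_exp k h / h) \<le> C * \<bar>h\<bar>" for h
      proof (cases "h = 0")
        case False
        have "\<bar>flat_exp k h\<bar> \<le> C * h\<^sup>2"
          using flat_exp_quadratic_bound[of k h] flat_exp_nonneg[of k h] by (simp add: C_def)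
        also have "h\<^sup>2 = \<bar>h\<bar> * \<bar>h\<bar>" by (simp add: power2_eq_square)
        finally show ?thesis using False by (simp add: field_simps)
      qed simp
      then show "\<forall>\<^sub>F h in at 0. norm ((flat_exp k (0 + h) - flat_exp k 0) / h) \<le> C * \<bar>h\<bar>"
        by (simp add: flat_exp_def[of k 0])
      show "((\<lambda>h. C * \<bar>h\<bar>) \<longlongrightarrow> 0) (at 0)"
        by (intro tendsto_eq_intros) auto
    qed
    then show ?thesis unfolding 3 by (simp add: DERIV_def flat_exp_def[of _ 0])
  qed
qed

text \<open>An algebra of functions that contains the bump functions and is closed under partial
  derivatives.\<close>

inductive bump_algebra :: "real \<Rightarrow> ('a::euclidean_space \<Rightarrow> real) \<Rightarrow> bool" for c where
  const: "bump_algebra c (\<lambda>_. a)"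
| coord: "bump_algebra c (\<lambda>x. x \<bullet> v)"
| add: "bump_algebra c f \<Longrightarrow> bump_algebra c h \<Longrightarrow> bump_algebra c (\<lambda>x. f x + h x)"
| mult: "bump_algebra c f \<Longrightarrow> bump_algebra c h \<Longrightarrow> bump_algebra c (\<lambda>x. f x * h x)"
| flat: "bump_algebra c (\<lambda>x. flat_exp k (2 - c * (x \<bullet> x)))"

lemma flat_exp_radial_derivative:
  fixes x :: "'a::euclidean_space"
  shows "((\<lambda>x. flat_exp k (2 - c * (x \<bullet> x))) has_derivative (\<lambda>v.
      (flat_exp (k + 2) (2 - c * (x \<bullet> x)) + (- real k) * flat_exp (k + 1) (2 - c * (x \<bullet> x))) * ((- 2 * c) * (x \<bullet> v)))) (at x)"
proof -
  have "((\<lambda>x. 2 - c * (x \<bullet> x)) has_derivative (\<lambda>v. (- 2 * c) * (x \<bullet> v))) (at x)"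
    by (auto intro!: derivative_eq_intros simp: inner_commute algebra_simps)
  from has_derivative_compose[OF this flat_exp_deriv[unfolded has_field_derivative_def]]
  show ?thesis by simp
qed

lemma bump_algebra_derivative:
  assumes "bump_algebra c f"
  shows "\<exists>D. (\<forall>x. (f has_derivative D x) (at x)) \<and> (\<forall>v. bump_algebra c (\<lambda>x. D x v))"
  using assms
proof induction
  case (const a)
  show ?case by (rule exI[of _ "\<lambda>x v. 0"]) (auto intro: bump_algebra.const)
next
  case (coord v)
  show ?case
    by (rule exI[of _ "\<lambda>x w. w \<bullet> v"]) (auto intro: bump_algebra.const intro!: derivative_eq_intros)
next
  case (add f h)
  then obtain D E where "\<forall>x. (f has_derivative D x) (at x)" "\<forall>v. bump_algebra c (\<lambda>x. D x v)"
    "\<forall>x. (h has_derivative E x) (at x)" "\<forall>v. bump_algebra c (\<lambda>x. E x v)" by auto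
  then show ?case
    by (intro exI[of _ "\<lambda>x v. D x v + E x v"]) (auto intro: bump_algebra.add has_derivative_add)
next
  case (mult f h)
  then obtain D E where "\<forall>x. (f has_derivative D x) (at x)" "\<forall>v. bump_algebra c (\<lambda>x. D x v)"
    "\<forall>x. (h has_derivative E x) (at x)" "\<forall>v. bump_algebra c (\<lambda>x. E x v)" by auto
  then show ?case using mult
    by (intro exI[of _ "\<lambda>x v. f x * E x v + D x v * h x"])
       (auto intro!: bump_algebra.add[OF bump_algebra.mult bump_algebra.mult] has_derivative_mult)
next
  case (flat k)
  let ?D = "\<lambda>x v. (flat_exp (k + 2) (2 - c * (x \<bullet> x)) + (- real k) * flat_exp (k + 1) (2 - c * (x \<bullet> x))) * ((- 2 * c) * (x \<bullet> v))"
  show ?case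
    by (intro exI[of _ ?D] conjI allI flat_exp_radial_derivative bump_algebra.intros)
qed

lemma bump_algebra_smooth:
  fixes f :: "'a::euclidean_space \<Rightarrow> real"
  assumes "bump_algebra c f"
  shows "smooth f"
proof -
  have step: "bump_algebra c (partial_deriv i h)" if h: "bump_algebra c h" for i and h :: "'a \<Rightarrow> real"
  proof -
    obtain D where D: "\<forall>x. (h has_derivative D x) (at x)" "\<forall>v. bump_algebra c (\<lambda>x. D x v)"
      using bump_algebra_derivative[OF h] by auto
    have "partial_deriv i h = (\<lambda>x. D x i)" using D(1) partial_deriv_unique by fastforce
    then show ?thesis using D(2) by simp
  qed
  have "bump_algebra c (iter_partial js f)" for js
    by (induction js) (auto intro: assms step)
  then show ?thesis
    unfolding smooth_def using bump_algebra_derivative differentiableI by blast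
qed

text \<open>The 2 places the sphere of radius t strictly inside the support, where the argument of
  \<open>flat_exp\<close> is 1 and the value exp (- 1) for every t.\<close>

definition bump :: "real \<Rightarrow> 'a::euclidean_space \<Rightarrow> real" where
  "bump t x = flat_exp 0 (2 - (1 / t\<^sup>2) * (x \<bullet> x))"

lemma bump_test_function:
  assumes t: "t > 0"
  shows "test_function (bump t :: 'a::euclidean_space \<Rightarrow> real)"
proof (rule test_functionI)
  show "smooth (bump t :: 'a \<Rightarrow> real)"
    unfolding bump_def by (rule bump_algebra_smooth, rule bump_algebra.flat)
  fix x :: 'a assume x: "2 * t \<le> norm x"
  have "(2 * t)\<^sup>2 \<le> (norm x)\<^sup>2" using x t by (intro power_mono) auto
  then have "2 \<le> (1 / t\<^sup>2) * (x \<bullet> x)"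
    using t order_trans[of "2 * t\<^sup>2" "4 * t\<^sup>2" "x \<bullet> x"]
    by (simp add: power2_norm_eq_inner field_simps)
  then show "bump t x = 0" by (simp add: bump_def flat_exp_def)
qed

lemma bump_sphere:
  assumes "t > 0"
  shows "(\<integral>y. bump t (y::'a::euclidean_space) \<partial>sphere_measure 0 t) = exp (- 1)"
proof -
  interpret compact_C1 "bump t :: 'a \<Rightarrow> real" "grad (bump t)"
    by (rule test_function_compact_C1[OF bump_test_function[OF assms]])
  have V: "unit_ball_volume TYPE('a) > 0" by (rule unit_ball_volume_pos)
  have [measurable]: "ball (0::'a) 1 \<in> sets borel" by auto
  have "unit_ball_volume TYPE('a) * (\<integral>y. bump t (y::'a) \<partial>sphere_measure 0 t)
      = (\<integral>y. indicator (ball (0::'a) 1) y * bump t (0 + t *\<^sub>R sgn y) \<partial>lborel)"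
    by (rule integral_sphere_measure) measurable
  also have "\<dots> = (\<integral>y. indicator (ball (0::'a) 1) y * exp (- 1) \<partial>lborel)"
  proof (rule integral_cong_AE)
    show "AE y::'a in lborel. indicator (ball 0 1) y * bump t (0 + t *\<^sub>R sgn y) = indicator (ball 0 1) y * exp (- 1)"
    proof (use AE_lborel_singleton[of "0::'a"] in eventually_elim)
      fix y :: 'a assume "y \<noteq> 0"
      then have "sgn y \<bullet> sgn y = 1" by (simp add: norm_sgn flip: power2_norm_eq_inner)
      then show "indicator (ball 0 1) y * bump t (0 + t *\<^sub>R sgn y) = indicator (ball 0 1) y * exp (- 1)"
        using assms by (simp add: bump_def flat_exp_def power2_eq_square)
    qed
  qed measurable
  also have "\<dots> = unit_ball_volume TYPE('a) * exp (- 1)" by (simp add: unit_ball_volume_def)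
  finally show ?thesis using V by simp
qed

lemma bump_scale: "t > 0 \<Longrightarrow> bump t (t *\<^sub>R x) = bump 1 x"
  by (simp add: bump_def power2_eq_square)

lemma grad_bump_scale:
  assumes "t > 0"
  shows "grad (bump t) (t *\<^sub>R x) = (1 / t) *\<^sub>R grad (bump 1) (x :: 'a::euclidean_space)"
proof -
  interpret T: compact_C1 "bump t :: 'a \<Rightarrow> real" "grad (bump t)"
    by (rule test_function_compact_C1[OF bump_test_function[OF assms]])
  interpret O: compact_C1 "bump 1 :: 'a \<Rightarrow> real" "grad (bump 1)"
    by (rule test_function_compact_C1[OF bump_test_function]) simp
  have "((\<lambda>x. t *\<^sub>R x) has_derivative (\<lambda>v. t *\<^sub>R v)) (at x)" by (auto intro!: derivative_eq_intros)
  from has_derivative_compose[OF this T.deriv]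
  have "(bump 1 has_derivative (\<lambda>v. grad (bump t) (t *\<^sub>R x) \<bullet> (t *\<^sub>R v))) (at x)"
    using bump_scale[OF assms, where 'a='a] by simp
  from has_derivative_unique[OF this O.deriv]
  have "grad (bump t) (t *\<^sub>R x) \<bullet> (t *\<^sub>R v) = grad (bump 1) x \<bullet> v" for v by metis
  then have "(t *\<^sub>R grad (bump t) (t *\<^sub>R x)) \<bullet> v = grad (bump 1) x \<bullet> v" for v by simp
  then have "t *\<^sub>R grad (bump t) (t *\<^sub>R x) = grad (bump 1) x" by (metis vector_eq_rdot)
  then show ?thesis using assms by (metis divide_self_if one_neq_zero order_less_irrefl scaleR_one
      scaleR_scaleR times_divide_eq_left mult_1)
qed

lemma integral_lborel_scaleR:
  fixes f :: "'a::euclidean_space \<Rightarrow> real"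
  assumes [measurable]: "f \<in> borel_measurable borel" and "c > 0" and nn: "\<And>x. f x \<ge> 0"
  shows "(\<integral>x. f x \<partial>lborel) = c ^ DIM('a) * (\<integral>x. f (c *\<^sub>R x) \<partial>lborel)"
  using nn_integral_lborel_scaleR[of "\<lambda>x. ennreal (f x)" c] assms
  by (simp add: integral_eq_nn_integral nn enn2real_mult)

text \<open>Scaling x = t z: the gradient part is exactly of order t^(n-2), and the L2 part is of
  order t^n, which is smaller because t <= 1. Up to a constant this is the capacity of the ball of
  radius t.\<close>

lemma bump_energy:
  assumes t: "t > 0" "t \<le> 1" and dim: "DIM('a::euclidean_space) > 2"
  shows "(\<integral>x. (bump t (x::'a))\<^sup>2 \<partial>lborel) + (\<integral>x. (norm (grad (bump t) (x::'a)))\<^sup>2 \<partial>lborel)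
    \<le> ((\<integral>x. (bump 1 (x::'a))\<^sup>2 \<partial>lborel) + (\<integral>x. (norm (grad (bump 1) (x::'a)))\<^sup>2 \<partial>lborel)) * t ^ (DIM('a) - 2)"
proof -
  let ?n = "DIM('a)"
  interpret T: compact_C1 "bump t :: 'a \<Rightarrow> real" "grad (bump t)"
    by (rule test_function_compact_C1[OF bump_test_function[OF t(1)]])
  have n: "t ^ ?n = t ^ (?n - 2) * t\<^sup>2" using dim by (metis le_add_diff_inverse2 less_imp_le power_add)
  have "(\<integral>x. (bump t (x::'a))\<^sup>2 \<partial>lborel) = t ^ ?n * (\<integral>x. (bump 1 (x::'a))\<^sup>2 \<partial>lborel)"
    using t by (subst integral_lborel_scaleR[of _ t]) (auto simp: bump_scale)
  also have "\<dots> \<le> t ^ (?n - 2) * (\<integral>x. (bump 1 (x::'a))\<^sup>2 \<partial>lborel)"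
    using t unfolding n by (intro mult_right_mono mult_left_le) (auto simp: power_le_one)
  finally have 1: "(\<integral>x. (bump t (x::'a))\<^sup>2 \<partial>lborel) \<le> t ^ (?n - 2) * (\<integral>x. (bump 1 (x::'a))\<^sup>2 \<partial>lborel)" .
  have "(\<integral>x. (norm (grad (bump t) (x::'a)))\<^sup>2 \<partial>lborel) = t ^ ?n * (\<integral>x. (norm (grad (bump 1) (x::'a)))\<^sup>2 / t\<^sup>2 \<partial>lborel)"
    using t by (subst integral_lborel_scaleR[of _ t]) (auto simp: grad_bump_scale power_divide)
  also have "\<dots> = t ^ (?n - 2) * (\<integral>x. (norm (grad (bump 1) (x::'a)))\<^sup>2 \<partial>lborel)"
    using t unfolding n by simp
  finally show ?thesis using 1 by (simp add: algebra_simps)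
qed


section \<open>The Sobolev space: pairing with test functions and the resolvent\<close>

lemma L2_Cauchy_Schwarz:
  fixes f u :: "'x \<Rightarrow> real"
  assumes [measurable]: "f \<in> borel_measurable M" "u \<in> borel_measurable M"
    and f: "integrable M (\<lambda>x. (f x)\<^sup>2)" and u: "integrable M (\<lambda>x. (u x)\<^sup>2)"
  shows "integrable M (\<lambda>x. f x * u x)"
    and "\<bar>\<integral>x. f x * u x \<partial>M\<bar> \<le> sqrt (\<integral>x. (f x)\<^sup>2 \<partial>M) * sqrt (\<integral>x. (u x)\<^sup>2 \<partial>M)"
proof -
  show int: "integrable M (\<lambda>x. f x * u x)"
  proof (rule Bochner_Integration.integrable_bound)
    show "integrable M (\<lambda>x. (f x)\<^sup>2 + (u x)\<^sup>2)" by (intro Bochner_Integration.integrable_add f u)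
    have "\<bar>f x * u x\<bar> \<le> (f x)\<^sup>2 + (u x)\<^sup>2" for x
      using sum_squares_bound[of "\<bar>f x\<bar>" "\<bar>u x\<bar>"] mult_nonneg_nonneg[OF abs_ge_zero abs_ge_zero, of "f x" "u x"]
      by (simp only: abs_mult power2_abs)
    then show "AE x in M. norm (f x * u x) \<le> norm ((f x)\<^sup>2 + (u x)\<^sup>2)" by simp
  qed measurable
  have "(ennreal \<bar>\<integral>x. f x * u x \<partial>M\<bar>)\<^sup>2 \<le> (\<integral>\<^sup>+x. ennreal \<bar>f x\<bar> * ennreal \<bar>u x\<bar> \<partial>M)\<^sup>2"
    using integral_norm_bound_ennreal[OF int]
    by (intro power_mono) (auto simp: ennreal_mult[symmetric] abs_mult)
  also have "\<dots> \<le> (\<integral>\<^sup>+x. (ennreal \<bar>f x\<bar>)\<^sup>2 \<partial>M) * (\<integral>\<^sup>+x. (ennreal \<bar>u x\<bar>)\<^sup>2 \<partial>M)"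
    by (rule Cauchy_Schwarz_nn_integral) measurable
  also have "\<dots> = ennreal (\<integral>x. (f x)\<^sup>2 \<partial>M) * ennreal (\<integral>x. (u x)\<^sup>2 \<partial>M)"
    using f u by (simp add: ennreal_power nn_integral_eq_integral)
  finally have "ennreal (\<bar>\<integral>x. f x * u x \<partial>M\<bar>\<^sup>2) \<le> ennreal ((\<integral>x. (f x)\<^sup>2 \<partial>M) * (\<integral>x. (u x)\<^sup>2 \<partial>M))"
    by (simp add: ennreal_mult ennreal_power)
  then have "\<bar>\<integral>x. f x * u x \<partial>M\<bar>\<^sup>2 \<le> (\<integral>x. (f x)\<^sup>2 \<partial>M) * (\<integral>x. (u x)\<^sup>2 \<partial>M)"
    by (subst (asm) ennreal_le_iff) auto
  then show "\<bar>\<integral>x. f x * u x \<partial>M\<bar> \<le> sqrt (\<integral>x. (f x)\<^sup>2 \<partial>M) * sqrt (\<integral>x. (u x)\<^sup>2 \<partial>M)"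
    unfolding real_sqrt_mult[symmetric] by (rule real_le_rsqrt)
qed

lemma test_function_partial_deriv:
  assumes \<phi>: "test_function \<phi>" and i: "i \<in> Basis"
  shows "test_function (partial_deriv i \<phi>)"
proof -
  interpret compact_C1 \<phi> "grad \<phi>" by (rule test_function_compact_C1[OF \<phi>])
  obtain R where "\<And>x. R \<le> norm x \<Longrightarrow> grad \<phi> x = 0" using obtain_radius by metis
  then show ?thesis
    by (intro test_functionI[where R=R] smooth_partial_deriv test_function_smooth[OF \<phi>] i partial_deriv_eq_0)
qed

context sobolev_H1
begin

definition represents :: "'h \<Rightarrow> ('a \<Rightarrow> real) \<Rightarrow> bool" where
  "represents h \<phi> \<longleftrightarrow> test_function \<phi> \<and> (AE x in lborel. rep h x = \<phi> x)"

lemma represents_dense: "v \<in> closure {h. \<exists>\<phi>. represents h \<phi>}"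
  using test_functions_dense by (simp add: represents_def)

text \<open>The locale fixes the inner product on pairs of test functions. Since \<phi> - laplacian
  \<phi> is square integrable, the right side is continuous in \<open>v\<close> by
  \<open>rep_L2_bound\<close>, and density carries the formula over to all \<open>v\<close>. It is
  the form in which \<open>resolvent\<close> states its equation.\<close>

lemma inner_represents:
  assumes h: "represents h \<phi>"
  shows "inner h v = (\<integral>x. rep v x * (\<phi> x - laplacian \<phi> x) \<partial>lborel)"
proof -
  have \<phi>: "test_function \<phi>" using h by (simp add: represents_def)
  then have s: "smooth \<phi>" by (rule test_function_smooth)
  interpret compact_C1 \<phi> "grad \<phi>" by (rule test_function_compact_C1[OF \<phi>])
  define f where "f x = \<phi> x - laplacian \<phi> x" for x
  have fc: "continuous_on UNIV f"
    unfolding f_def laplacian_def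
    by (intro continuous_intros smooth_continuous smooth_partial_deriv s)
  have [measurable]: "f \<in> borel_measurable borel" by (rule borel_measurable_continuous_onI[OF fc])
  have "\<exists>R. \<forall>x. R \<le> norm x \<longrightarrow> partial_deriv i (partial_deriv i \<phi>) x = 0" if "i \<in> Basis" for i
    using compact_C1.support[OF test_function_compact_C1] test_function_partial_deriv \<phi> that by blast
  then obtain r where r: "\<And>i x. i \<in> Basis \<Longrightarrow> r i \<le> norm x \<Longrightarrow> partial_deriv i (partial_deriv i \<phi>) x = 0"
    by metis
  obtain R where R: "R > 0" "\<And>x. R \<le> norm x \<Longrightarrow> \<phi> x = 0" using obtain_radius by metis
  \<comment> \<open>Each summand is nonnegative, so the sum is one radius beyond all those chosen
    for the individual second derivatives.\<close>
  define R' where "R' = R + (\<Sum>i\<in>Basis. \<bar>r i\<bar>)"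
  have f0: "f x = 0" if x: "R' \<le> norm x" for x
  proof -
    have "r i \<le> norm x" if "i \<in> Basis" for i
      using member_le_sum[of i Basis "\<lambda>i. \<bar>r i\<bar>"] that x R(1) by (simp add: R'_def)
    then have "laplacian \<phi> x = 0"
      unfolding laplacian_def by (intro sum.neutral ballI r)
    moreover have "0 \<le> (\<Sum>i\<in>Basis. \<bar>r i\<bar>)" by (intro sum_nonneg) auto
    then have "R \<le> norm x" using x unfolding R'_def by linarith
    ultimately show ?thesis using R(2) by (simp add: f_def)
  qed
  have f2: "integrable lborel (\<lambda>x. (f x)\<^sup>2)"
  proof -
    have "integrable lborel (\<lambda>x. indicator (cball 0 R') x *\<^sub>R (f x)\<^sup>2)"
      by (intro borel_integrable_compact continuous_intros continuous_on_subset[OF fc]) auto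
    also have "(\<lambda>x. indicator (cball 0 R') x *\<^sub>R (f x)\<^sup>2) = (\<lambda>x. (f x)\<^sup>2)"
      using f0 by (auto simp: indicator_def fun_eq_iff)
    finally show ?thesis .
  qed
  note [measurable] = rep_measurable
  define T where "T v = (\<integral>x. f x * rep v x \<partial>lborel)" for v
  define F where "F = sqrt (\<integral>x. (f x)\<^sup>2 \<partial>lborel)"
  have int: "integrable lborel (\<lambda>x. f x * rep v x)" for v
    by (intro L2_Cauchy_Schwarz f2 rep_square_integrable) measurable
  have lip: "\<bar>T v - T w\<bar> \<le> F * norm (v - w)" for v w
  proof -
    have "AE x in lborel. rep (1 *\<^sub>R v + (-1) *\<^sub>R w) x = 1 * rep v x + (-1) * rep w x" by (rule rep_linear)
    then have ae: "AE x in lborel. f x * rep v x - f x * rep w x = f x * rep (v - w) x"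
      by eventually_elim (simp add: right_diff_distrib)
    have "T v - T w = (\<integral>x. f x * rep v x - f x * rep w x \<partial>lborel)"
      unfolding T_def by (rule Bochner_Integration.integral_diff[symmetric, OF int int])
    also have "\<dots> = T (v - w)" unfolding T_def by (intro integral_cong_AE ae) measurable
    finally have "\<bar>T v - T w\<bar> \<le> F * sqrt (\<integral>x. (rep (v - w) x)\<^sup>2 \<partial>lborel)"
      unfolding T_def F_def
      by (simp add: L2_Cauchy_Schwarz f2 rep_square_integrable rep_measurable)
    also have "\<dots> \<le> F * norm (v - w)"
      unfolding F_def using rep_L2_bound[of "v - w"]
      by (intro mult_left_mono real_le_lsqrt) auto
    finally show ?thesis .
  qed
  obtain d where d: "\<And>n. \<exists>\<psi>. represents (d n) \<psi>" "d \<longlonglongrightarrow> v"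
    using represents_dense[of v] unfolding closure_sequential by auto
  have "inner h (d n) = T (d n)" for n
  proof -
    obtain \<psi> where \<psi>: "test_function \<psi>" "AE x in lborel. rep (d n) x = \<psi> x"
      using d(1)[of n] by (auto simp: represents_def)
    interpret Q: compact_C1 \<psi> "grad \<psi>" by (rule test_function_compact_C1[OF \<psi>(1)])
    have "inner h (d n) = (\<integral>x. (\<phi> x - laplacian \<phi> x) * \<psi> x \<partial>lborel)"
      using h \<psi> by (intro inner_test_functions) (auto simp: represents_def)
    also have "\<dots> = (\<integral>x. f x * \<psi> x \<partial>lborel)" by (simp add: f_def)
    also have "\<dots> = T (d n)"
      unfolding T_def using \<psi>(2) by (intro integral_cong_AE) auto
    finally show ?thesis .
  qed
  moreover have "(\<lambda>n. T (d n)) \<longlonglongrightarrow> T v"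
  proof (rule Lim_null_comparison[where g="\<lambda>n. F * norm (d n - v)", THEN LIM_zero_cancel])
    show "\<forall>\<^sub>F n in sequentially. norm (T (d n) - T v) \<le> F * norm (d n - v)"
      using lip by simp
    show "(\<lambda>n. F * norm (d n - v)) \<longlonglongrightarrow> 0"
      using d(2) by (intro tendsto_mult_right_zero tendsto_norm_zero LIM_zero)
  qed
  moreover have "(\<lambda>n. inner h (d n)) \<longlonglongrightarrow> inner h v" by (intro tendsto_intros d(2))
  ultimately have "inner h v = T v" using LIMSEQ_unique by simp
  then show ?thesis by (simp add: T_def f_def mult.commute)
qed

lemma norm_represents:
  assumes h: "represents h \<phi>"
  shows "(norm h)\<^sup>2 = (\<integral>x. (\<phi> x)\<^sup>2 \<partial>lborel) + (\<integral>x. (norm (grad \<phi> x))\<^sup>2 \<partial>lborel)"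
  using h inner_test_functions[of \<phi> \<phi> h h] integral_laplacian[of \<phi>]
  by (simp add: represents_def power2_norm_eq_inner)

lemma energy_le_norm:
  assumes "represents h \<phi>"
  shows "compact_C1.energy (grad \<phi>) \<le> (norm h)\<^sup>2"
proof -
  interpret compact_C1 \<phi> "grad \<phi>"
    using assms by (intro test_function_compact_C1) (simp add: represents_def)
  show ?thesis unfolding norm_represents[OF assms] energy_def by simp
qed

lemma represents_lincomb:
  assumes "represents h \<phi>" "represents k \<psi>"
  shows "represents (a *\<^sub>R h + b *\<^sub>R k) (\<lambda>x. a * \<phi> x + b * \<psi> x)"
proof -
  have "AE x in lborel. rep (a *\<^sub>R h + b *\<^sub>R k) x = a * rep h x + b * rep k x" by (rule rep_linear)
  moreover have "AE x in lborel. rep h x = \<phi> x" "AE x in lborel. rep k x = \<psi> x"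
    using assms by (auto simp: represents_def)
  ultimately have "AE x in lborel. rep (a *\<^sub>R h + b *\<^sub>R k) x = a * \<phi> x + b * \<psi> x"
    by eventually_elim simp
  then show ?thesis using assms by (auto simp: represents_def intro: test_function_lincomb)
qed

lemma obtain_represents:
  assumes "test_function \<phi>"
  obtains h where "represents h \<phi>"
  using rep_test_function[OF assms] assms by (auto simp: represents_def)

lemma norm_le_represents:
  assumes "\<And>h \<phi>. represents h \<phi> \<Longrightarrow> inner h v \<le> C * norm h" "C \<ge> 0"
  shows "norm v \<le> C"
  by (rule norm_le_if_inner_le_dense[OF represents_dense]) (use assms in auto)

text \<open>\<open>L\<close> acts on test functions and not on elements of H, so it is passed to
  \<open>riesz_graph\<close> as the graph \<open>P\<close>, without first showing that
  \<open>h\<close> determines \<phi>. Density of test functions gives the uniqueness that the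
  definite description in \<open>resolvent\<close> requires.\<close>

lemma inner_resolvent:
  assumes lin: "\<And>\<phi> \<psi> a b. test_function \<phi> \<Longrightarrow> test_function \<psi> \<Longrightarrow>
      L (\<lambda>x. a * \<phi> x + b * \<psi> x) = a * L \<phi> + b * L \<psi>"
    and bound: "\<And>h \<phi>. represents h \<phi> \<Longrightarrow> \<bar>L \<phi>\<bar> \<le> C * norm h"
    and h: "represents h \<phi>"
  shows "inner h (resolvent rep L) = L \<phi>"
proof -
  define P where "P = {(h, L \<phi>) |h \<phi>. represents h \<phi>}"
  have P: "subspace P"
  proof (rule subspaceI)
    have comb: "(a *\<^sub>R h + b *\<^sub>R k, a * L \<phi> + b * L \<psi>) \<in> P"
      if "represents h \<phi>" "represents k \<psi>" for h k \<phi> \<psi> a b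
    proof -
      have "(a *\<^sub>R h + b *\<^sub>R k, L (\<lambda>x. a * \<phi> x + b * \<psi> x)) \<in> P"
        unfolding P_def using represents_lincomb[OF that] by blast
      then show ?thesis using lin[of \<phi> \<psi> a b] that by (simp add: represents_def)
    qed
    show "0 \<in> P" using comb[OF h h, of 0 0] by (simp add: zero_prod_def)
    show "p + q \<in> P" if p: "p \<in> P" and q: "q \<in> P" for p q
    proof -
      obtain h \<phi> k \<psi> where "p = (h, L \<phi>)" "represents h \<phi>" "q = (k, L \<psi>)" "represents k \<psi>"
        using p q by (auto simp: P_def)
      then show ?thesis using comb[of h \<phi> k \<psi> 1 1] by simp
    qed
    show "c *\<^sub>R p \<in> P" if p: "p \<in> P" for c p
    proof -
      obtain h \<phi> where "p = (h, L \<phi>)" "represents h \<phi>" using p by (auto simp: P_def)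
      then show ?thesis using comb[of h \<phi> h \<phi> c 0] by simp
    qed
  qed
  moreover have "\<bar>r\<bar> \<le> C * norm v" if "(v, r) \<in> P" for v r using that bound by (auto simp: P_def)
  ultimately obtain u where "\<forall>(v, r)\<in>P. inner v u = r" using riesz_graph[of P C] by blast
  then have u: "inner h u = L \<phi>" if "represents h \<phi>" for h \<phi> using that by (auto simp: P_def)
  have "resolvent rep L = u"
    unfolding resolvent_def
  proof (rule the_equality)
    show "\<forall>\<phi>. test_function \<phi> \<longrightarrow> (\<integral>x. rep u x * (\<phi> x - laplacian \<phi> x) \<partial>lborel) = L \<phi>"
      using u inner_represents obtain_represents by metis
    fix w assume w: "\<forall>\<phi>. test_function \<phi> \<longrightarrow> (\<integral>x. rep w x * (\<phi> x - laplacian \<phi> x) \<partial>lborel) = L \<phi>"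
    have "norm (w - u) \<le> 0"
    proof (rule norm_le_represents)
      fix h \<phi> assume h: "represents h \<phi>"
      then have "inner h w = L \<phi>" using w inner_represents[OF h, of w] by (auto simp: represents_def)
      then show "inner h (w - u) \<le> 0 * norm h" using u[OF h] by (simp add: inner_diff_right)
    qed simp
    then show "w = u" by simp
  qed
  then show ?thesis using u h by simp
qed

end

section \<open>Positivity of the renormalisation constant\<close>

text \<open>All terms are positive, but an infinite sum carries information only if it converges.
  Since Gamma (m + \<alpha> + 1) >= Gamma (\<alpha> + 1), because their quotient is a Pochhammer
  product of factors at least 1, the series is dominated by an exponential series in
  (t/2)^2.\<close>

lemma bessel_I_pos:
  assumes \<alpha>: "\<alpha> \<ge> 0" and t: "t > 0"
  shows "bessel_I \<alpha> t > 0"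
proof -
  define f where "f m = (t / 2) powr (2 * real m + \<alpha>) / (fact m * Gamma (real m + \<alpha> + 1))" for m :: nat
  have G: "Gamma (\<alpha> + 1) \<le> Gamma (real m + \<alpha> + 1)" for m
  proof -
    have "pochhammer (\<alpha> + 1) m = Gamma (\<alpha> + 1 + real m) / Gamma (\<alpha> + 1)"
      using \<alpha> by (intro pochhammer_Gamma) (auto simp: nonpos_Ints_def)
    moreover have "pochhammer (\<alpha> + 1) m \<ge> 1"
      unfolding pochhammer_prod using \<alpha> by (intro prod_ge_1) auto
    moreover have "Gamma (\<alpha> + 1) > 0" using \<alpha> by (intro Gamma_real_pos) auto
    ultimately show ?thesis by (simp add: field_simps)
  qed
  have G0: "Gamma (\<alpha> + 1) > 0" using \<alpha> by (intro Gamma_real_pos) auto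
  have Gm: "Gamma (real m + \<alpha> + 1) > 0" for m using G[of m] G0 by linarith
  have pos: "f m > 0" for m unfolding f_def using t Gm[of m] by simp
  have le: "f m \<le> (t / 2) powr \<alpha> / Gamma (\<alpha> + 1) * (inverse (fact m) * ((t / 2)\<^sup>2) ^ m)" for m
  proof -
    have "(t / 2) powr (2 * real m + \<alpha>) = (t / 2) powr real (2 * m) * (t / 2) powr \<alpha>"
      using t by (simp add: powr_add)
    also have "(t / 2) powr real (2 * m) = ((t / 2)\<^sup>2) ^ m"
      using t by (subst powr_realpow) (auto simp: power_mult)
    finally have "f m = ((t / 2)\<^sup>2) ^ m * (t / 2) powr \<alpha> / (fact m * Gamma (real m + \<alpha> + 1))"
      by (simp add: f_def)
    also have "\<dots> \<le> ((t / 2)\<^sup>2) ^ m * (t / 2) powr \<alpha> / (fact m * Gamma (\<alpha> + 1))"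
      using G[of m] G0 Gm[of m] t by (intro divide_left_mono mult_left_mono mult_pos_pos) auto
    finally show ?thesis by (simp add: field_simps)
  qed
  have "summable f"
  proof (rule summable_comparison_test')
    show "summable (\<lambda>m. (t / 2) powr \<alpha> / Gamma (\<alpha> + 1) * (inverse (fact m) * ((t / 2)\<^sup>2) ^ m))"
      by (intro summable_mult summable_exp)
    show "norm (f m) \<le> (t / 2) powr \<alpha> / Gamma (\<alpha> + 1) * (inverse (fact m) * ((t / 2)\<^sup>2) ^ m)" if "m \<ge> 0" for m
      using le[of m] pos[of m] by simp
  qed
  then have "suminf f > 0" using pos by (intro suminf_pos) auto
  then show ?thesis unfolding bessel_I_def f_def[abs_def] .
qed

lemma renorm_const_pos:
  assumes "\<nu> \<ge> 2" "t > 0"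
  shows "renorm_const \<nu> t > 0"
  using assms bessel_I_pos[of "(\<nu> - 2) / 2" t]
  unfolding renorm_const_def by (intro divide_pos_pos mult_pos_pos Gamma_real_pos) auto


section \<open>Norms of the normalised spherical elements\<close>

text \<open>Distinct exponents make this a subsum of the full geometric series with sum 4. It is
  applied once on each side of the diagonal index, which gives the 8 of the next lemma.\<close>

lemma sum_geometric_inj_le:
  fixes d :: "nat \<Rightarrow> nat"
  assumes "finite A" "inj_on d A"
  shows "(\<Sum>l\<in>A. (3/4::real) ^ d l) \<le> 4"
proof -
  have "(\<Sum>l\<in>A. (3/4::real) ^ d l) = (\<Sum>i\<in>d ` A. (3/4) ^ i)"
    using assms(2) by (simp add: sum.reindex)
  also have "\<dots> \<le> (\<Sum>i. (3/4) ^ i)"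
    using assms(1) by (intro sum_le_suminf summable_geometric) auto
  also have "\<dots> = 4" by (subst suminf_geometric) auto
  finally show ?thesis .
qed

lemma sum_geometric_distance_le:
  "(\<Sum>k\<in>{1..m}. \<Sum>l\<in>{1..m}. (3/4::real) ^ (max k l - min k l)) \<le> 8 * real m"
proof -
  have "(\<Sum>l\<in>{1..m}. (3/4::real) ^ (max k l - min k l)) \<le> 8" for k :: nat
  proof -
    have "(\<Sum>l\<in>{1..m}. (3/4::real) ^ (max k l - min k l))
        = (\<Sum>l\<in>{1..m} \<inter> {..k}. (3/4::real) ^ (max k l - min k l))
        + (\<Sum>l\<in>{1..m} - {..k}. (3/4::real) ^ (max k l - min k l))"
      by (rule sum.Int_Diff) simp
    also have "\<dots> \<le> 4 + 4"
      by (intro add_mono sum_geometric_inj_le) (auto simp: inj_on_def)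
    finally show ?thesis by simp
  qed
  then have "(\<Sum>k\<in>{1..m}. \<Sum>l\<in>{1..m}. (3/4::real) ^ (max k l - min k l)) \<le> (\<Sum>k\<in>{1..m}. 8)"
    by (intro sum_mono)
  then show ?thesis by simp
qed

text \<open>With k <= l the quotient of the two sides comes down to sqrt (2^(-d * p)) against
  (3/4)^d for d = l - k. For p >= 1 this follows from 1/2 <= 9/16 = (3/4)^2; 3/4 is a rational
  majorant of 1 / sqrt 2.\<close>

lemma geometric_scales_covariance:
  fixes k l N p :: nat
  assumes p: "p \<ge> 1"
  defines "\<tau> i \<equiv> (1/2::real) ^ (N + i)"
  shows "sqrt (\<tau> k ^ p) * sqrt (\<tau> l ^ p) \<le> max (\<tau> k) (\<tau> l) ^ p * (3/4) ^ (max k l - min k l)"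
proof -
  have *: "sqrt (\<tau> k ^ p) * sqrt (\<tau> l ^ p) \<le> max (\<tau> k) (\<tau> l) ^ p * (3/4) ^ (l - k)" if kl: "k \<le> l" for k l
  proof -
    define d where "d = l - k"
    have l: "\<tau> l = \<tau> k * (1/2) ^ d" using kl by (simp add: \<tau>_def d_def flip: power_add)
    have "\<tau> l \<le> \<tau> k" unfolding \<tau>_def using kl by (intro power_decreasing) auto
    then have mx: "max (\<tau> k) (\<tau> l) = \<tau> k" by simp
    have pos: "\<tau> k > 0" by (simp add: \<tau>_def)
    have "((1/2::real) ^ d) ^ p \<le> ((1/2) ^ d) ^ 1"
      using p by (intro power_decreasing) (auto simp: power_le_one)
    also have "\<dots> \<le> (9/16) ^ d" by (simp add: power_mono)
    also have "(9/16::real) ^ d = ((3/4) ^ d)\<^sup>2"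
      by (simp add: power_mult[symmetric] mult.commute[of d]) (simp add: power_mult power2_eq_square)
    finally have "sqrt (((1/2::real) ^ d) ^ p) \<le> (3/4) ^ d" by (intro real_le_lsqrt) auto
    then have "\<tau> k ^ p * sqrt (((1/2::real) ^ d) ^ p) \<le> \<tau> k ^ p * (3/4) ^ d"
      using pos by (intro mult_left_mono) auto
    moreover have "sqrt (\<tau> k ^ p) * sqrt (\<tau> l ^ p) = \<tau> k ^ p * sqrt (((1/2::real) ^ d) ^ p)"
      using pos unfolding l power_mult_distrib real_sqrt_mult by (simp flip: mult.assoc)
    ultimately show ?thesis unfolding mx d_def by simp
  qed
  show ?thesis
  proof (cases "k \<le> l")
    case True then show ?thesis using *[of k l] by simp
  next
    case False
    then show ?thesis using *[of l k] by (simp add: max.commute[of "\<tau> k"] mult.commute[of "sqrt (\<tau> k ^ p)"])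
  qed
qed

context sobolev_H1
begin

definition sphere_element :: "'a \<Rightarrow> real \<Rightarrow> 'h" where
  "sphere_element x t = resolvent rep (renorm_sphere x t)"

text \<open>The divisor is the norm at the origin for every centre x, matching
  \<open>avg_variance\<close>, where the variance is also read off at the origin.\<close>

definition unit_sphere_element :: "'a \<Rightarrow> real \<Rightarrow> 'h" where
  "unit_sphere_element x t = (1 / norm (sphere_element 0 t)) *\<^sub>R sphere_element x t"

lemma sphere_average_norm_bound:
  assumes dim: "DIM('a) > 2" and t: "t > 0"
  shows "\<exists>C. \<forall>h \<phi>. represents h \<phi> \<longrightarrow> \<bar>\<integral>y. \<phi> y \<partial>sphere_measure x t\<bar> \<le> C * norm h"
proof (intro exI allI impI)
  let ?c = "1 / (unit_ball_volume TYPE('a) * real DIM('a) * real (DIM('a) - 2)) * (1 / t ^ (DIM('a) - 2))"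
  fix h \<phi> assume h: "represents h \<phi>"
  interpret compact_C1 \<phi> "grad \<phi>"
    using h by (intro test_function_compact_C1) (simp add: represents_def)
  have V: "unit_ball_volume TYPE('a) > 0" by (rule unit_ball_volume_pos)
  have "\<bar>\<integral>y. \<phi> y \<partial>sphere_measure x t\<bar>\<^sup>2 \<le> ?c * energy"
    using weighted_sphere_averages[of "{()}" "\<lambda>_. 1" "\<lambda>_. t" x] dim t by simp
  also have "\<dots> \<le> ?c * (norm h)\<^sup>2"
    using V t energy_le_norm[OF h] by (intro mult_left_mono) auto
  finally have "\<bar>\<integral>y. \<phi> y \<partial>sphere_measure x t\<bar> \<le> sqrt (?c * (norm h)\<^sup>2)" by (rule real_le_rsqrt)
  then show "\<bar>\<integral>y. \<phi> y \<partial>sphere_measure x t\<bar> \<le> sqrt ?c * norm h" by (simp only: real_sqrt_mult real_sqrt_abs abs_norm_cancel)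
qed

lemma inner_sphere_element:
  assumes dim: "DIM('a) > 2" and t: "t > 0" and h: "represents h \<phi>"
  shows "inner h (sphere_element x t) = renorm_const (real DIM('a)) t * (\<integral>y. \<phi> y \<partial>sphere_measure x t)"
proof -
  let ?V = "unit_ball_volume TYPE('a)"
  obtain C where C: "\<And>h \<phi>. represents h \<phi> \<Longrightarrow> \<bar>\<integral>y. \<phi> y \<partial>sphere_measure x t\<bar> \<le> C * norm h"
    using sphere_average_norm_bound[OF dim t] by blast
  have c: "renorm_const (real DIM('a)) t > 0" using dim t by (intro renorm_const_pos) auto
  have "inner h (resolvent rep (renorm_sphere x t)) = renorm_sphere x t \<phi>"
  proof (rule inner_resolvent[OF _ _ h])
    fix \<phi> \<psi> :: "'a \<Rightarrow> real" and a b
    assume \<phi>: "test_function \<phi>" and \<psi>: "test_function \<psi>"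
    interpret A: compact_C1 \<phi> "grad \<phi>" by (rule test_function_compact_C1[OF \<phi>])
    interpret B: compact_C1 \<psi> "grad \<psi>" by (rule test_function_compact_C1[OF \<psi>])
    have "?V * (\<integral>y. a * \<phi> y + b * \<psi> y \<partial>sphere_measure x t)
      = (\<integral>y. indicator (ball 0 1) y * (a * \<phi> (x + t *\<^sub>R sgn y) + b * \<psi> (x + t *\<^sub>R sgn y)) \<partial>lborel)"
      by (rule integral_sphere_measure) measurable
    also have "\<dots> = (\<integral>y. a * (indicator (ball 0 1) y * \<phi> (x + t *\<^sub>R sgn y))
        + b * (indicator (ball 0 1) y * \<psi> (x + t *\<^sub>R sgn y)) \<partial>lborel)"
      by (simp add: distrib_left mult_ac)
    also have "\<dots> = a * (\<integral>y. indicator (ball 0 1) y * \<phi> (x + t *\<^sub>R sgn y) \<partial>lborel)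
        + b * (\<integral>y. indicator (ball 0 1) y * \<psi> (x + t *\<^sub>R sgn y) \<partial>lborel)"
      by (subst Bochner_Integration.integral_add)
         (auto intro!: integrable_mult_right A.integrable_sphere B.integrable_sphere)
    also have "\<dots> = ?V * (a * (\<integral>y. \<phi> y \<partial>sphere_measure x t) + b * (\<integral>y. \<psi> y \<partial>sphere_measure x t))"
      by (simp add: integral_sphere_measure[symmetric] distrib_left mult_ac)
    finally have "(\<integral>y. a * \<phi> y + b * \<psi> y \<partial>sphere_measure x t)
       = a * (\<integral>y. \<phi> y \<partial>sphere_measure x t) + b * (\<integral>y. \<psi> y \<partial>sphere_measure x t)"
      using unit_ball_volume_pos[where 'a='a] by simp
    then show "renorm_sphere x t (\<lambda>x. a * \<phi> x + b * \<psi> x) = a * renorm_sphere x t \<phi> + b * renorm_sphere x t \<psi>"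
      by (simp add: renorm_sphere_def distrib_left mult_ac)
  next
    fix h \<phi> assume "represents h \<phi>"
    from mult_left_mono[OF C[OF this], of "renorm_const (real DIM('a)) t"] c
    show "\<bar>renorm_sphere x t \<phi>\<bar> \<le> (renorm_const (real DIM('a)) t * C) * norm h"
      by (simp add: renorm_sphere_def abs_mult mult.assoc)
  qed
  then show ?thesis by (simp add: sphere_element_def renorm_sphere_def)
qed

text \<open>Pairing with \<open>bump t\<close> gives c * exp (- 1) <= norm h * norm (sphere_element
  0 t), where c is the renormalisation constant, and norm h is at most of order sqrt (t^(n-2)). So
  the standard deviation divided by c is at least of order t^((2-n)/2), the size predicted by the
  Green function.\<close>

lemma normalised_weight_bound:
  assumes dim: "DIM('a) > 2"
  shows "\<exists>A>0. \<forall>t\<in>{0<..1}. norm (sphere_element 0 t) > 0 \<and>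
     renorm_const (real DIM('a)) t / norm (sphere_element 0 t) \<le> sqrt A * sqrt (t ^ (DIM('a) - 2))"
proof -
  define E where "E = (\<integral>x. (bump 1 (x::'a))\<^sup>2 \<partial>lborel) + (\<integral>x. (norm (grad (bump 1) (x::'a)))\<^sup>2 \<partial>lborel)"
  have E: "E \<ge> 0" unfolding E_def by simp
  have main: "norm (sphere_element 0 t) > 0 \<and>
     renorm_const (real DIM('a)) t / norm (sphere_element 0 t) \<le> sqrt ((exp 1)\<^sup>2 * E + 1) * sqrt (t ^ (DIM('a) - 2))"
    if t: "t \<in> {0<..1}" for t
  proof -
    let ?c = "renorm_const (real DIM('a)) t" and ?s = "norm (sphere_element 0 t)"
    have c: "?c > 0" using dim t by (intro renorm_const_pos) auto
    obtain h where h: "represents h (bump t)"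
      using obtain_represents bump_test_function t by (metis greaterThanAtMost_iff)
    have "(norm h)\<^sup>2 \<le> E * t ^ (DIM('a) - 2)"
      unfolding norm_represents[OF h] E_def using t dim by (intro bump_energy) auto
    then have nh: "norm h \<le> sqrt (E * t ^ (DIM('a) - 2))" by (rule real_le_rsqrt)
    have "?c * exp (- 1) = inner h (sphere_element 0 t)"
      using t dim by (subst inner_sphere_element[OF dim _ h]) (auto simp: bump_sphere)
    also have "\<dots> \<le> norm h * ?s" by (rule norm_cauchy_schwarz)
    finally have le: "?c * exp (- 1) \<le> norm h * ?s" .
    moreover have "?c * exp (- 1) > 0" using c by simp
    ultimately have s: "?s > 0" by (smt (verit) mult_not_zero norm_ge_zero)
    have "?c / ?s \<le> exp 1 * norm h" using le s by (simp add: field_simps exp_minus)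
    also have "\<dots> \<le> exp 1 * sqrt (E * t ^ (DIM('a) - 2))" using nh by simp
    also have "\<dots> = sqrt ((exp 1)\<^sup>2 * E) * sqrt (t ^ (DIM('a) - 2))"
      by (simp add: real_sqrt_mult)
    also have "\<dots> \<le> sqrt ((exp 1)\<^sup>2 * E + 1) * sqrt (t ^ (DIM('a) - 2))"
      using t by (intro mult_right_mono) auto
    finally show ?thesis using s by simp
  qed
  show ?thesis
    \<comment> \<open>The summand 1 makes the constant positive from \<open>E \<ge> 0\<close>
      alone.\<close>
    by (rule exI[of _ "(exp 1)\<^sup>2 * E + 1"]) (use main E in \<open>auto intro: add_nonneg_pos\<close>)
qed

lemma inner_unit_sphere_element:
  assumes "DIM('a) > 2" "t > 0" "represents h \<phi>"
  shows "inner h (unit_sphere_element x t)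
    = renorm_const (real DIM('a)) t / norm (sphere_element 0 t) * (\<integral>y. \<phi> y \<partial>sphere_measure x t)"
  using inner_sphere_element[OF assms, of x] by (simp add: unit_sphere_element_def)

text \<open>The weights sqrt (t^(n-2)) turn the Green function bound for radii
  \<open>\<tau> k\<close> and \<open>\<tau> l\<close> into a multiple of (3/4) to the power of the
  distance between k and l. Each row of the covariance bound is then summable, so the total is
  linear in m and uniform in x and N.\<close>

lemma norm_sum_unit_sphere_elements:
  assumes dim: "DIM('a) > 2"
  shows "\<exists>B>0. \<forall>x N m. (norm (\<Sum>k\<in>{1..m}. unit_sphere_element x ((1/2) ^ (N + k))))\<^sup>2 \<le> B * real m"
proof -
  let ?n = "DIM('a)" and ?V = "unit_ball_volume TYPE('a)"
  obtain A where A: "A > 0" and s: "\<And>t. t \<in> {0<..1} \<Longrightarrow> norm (sphere_element 0 t) > 0"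
    and w: "\<And>t. t \<in> {0<..1} \<Longrightarrow> renorm_const (real ?n) t / norm (sphere_element 0 t) \<le> sqrt A * sqrt (t ^ (?n - 2))"
    using normalised_weight_bound[OF dim] by blast
  have V: "?V > 0" by (rule unit_ball_volume_pos)
  define c where "c = 1 / (?V * real ?n * real (?n - 2))"
  have c: "c > 0" unfolding c_def using V dim by simp
  have main: "(norm (\<Sum>k\<in>{1..m}. unit_sphere_element x ((1/2) ^ (N + k))))\<^sup>2 \<le> (c * A * 8) * real m" for x N m
  proof -
    define \<tau> where "\<tau> k = (1/2::real) ^ (N + k)" for k
    define b where "b k = renorm_const (real ?n) (\<tau> k) / norm (sphere_element 0 (\<tau> k))" for k
    have \<tau>: "\<tau> k > 0" "\<tau> k \<in> {0<..1}" for k by (auto simp: \<tau>_def power_le_one)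
    have b0: "b k \<ge> 0" for k
      unfolding b_def using renorm_const_pos[of "real ?n" "\<tau> k"] \<tau>[of k] dim by (intro divide_nonneg_nonneg) auto
    have b_le: "b k \<le> sqrt A * sqrt (\<tau> k ^ (?n - 2))" for k unfolding b_def by (rule w[OF \<tau>(2)])
    have bb: "b k * b l / max (\<tau> k) (\<tau> l) ^ (?n - 2) \<le> A * (3/4) ^ (max k l - min k l)" for k l
    proof -
      have "b k * b l \<le> (sqrt A * sqrt (\<tau> k ^ (?n - 2))) * (sqrt A * sqrt (\<tau> l ^ (?n - 2)))"
        using A by (intro mult_mono b_le b0 mult_nonneg_nonneg) (auto simp: less_imp_le \<tau>)
      also have "\<dots> = A * (sqrt (\<tau> k ^ (?n - 2)) * sqrt (\<tau> l ^ (?n - 2)))" using A by simp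
      also have "\<dots> \<le> A * (max (\<tau> k) (\<tau> l) ^ (?n - 2) * (3/4) ^ (max k l - min k l))"
        using A dim unfolding \<tau>_def by (intro mult_left_mono geometric_scales_covariance) auto
      finally have "b k * b l \<le> (A * (3/4) ^ (max k l - min k l)) * max (\<tau> k) (\<tau> l) ^ (?n - 2)"
        by (simp add: mult_ac)
      moreover have "max (\<tau> k) (\<tau> l) ^ (?n - 2) > 0" using \<tau>(1)[of k] by (intro zero_less_power) simp
      ultimately show ?thesis by (simp only: pos_divide_le_eq)
    qed
    have Q: "(\<Sum>k\<in>{1..m}. \<Sum>l\<in>{1..m}. b k * b l / max (\<tau> k) (\<tau> l) ^ (?n - 2)) \<le> A * (8 * real m)"
    proof -
      have "(\<Sum>k\<in>{1..m}. \<Sum>l\<in>{1..m}. b k * b l / max (\<tau> k) (\<tau> l) ^ (?n - 2))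
         \<le> (\<Sum>k\<in>{1..m}. \<Sum>l\<in>{1..m}. A * (3/4) ^ (max k l - min k l))"
        by (intro sum_mono bb)
      also have "\<dots> \<le> A * (8 * real m)"
        using sum_geometric_distance_le[of m] A by (simp flip: sum_distrib_left)
      finally show ?thesis .
    qed
    have "norm (\<Sum>k\<in>{1..m}. unit_sphere_element x (\<tau> k)) \<le> sqrt (c * A * 8 * real m)"
    proof (rule norm_le_represents)
      fix h \<phi> assume h: "represents h \<phi>"
      interpret compact_C1 \<phi> "grad \<phi>"
        using h by (intro test_function_compact_C1) (simp add: represents_def)
      define S where "S = (\<Sum>k\<in>{1..m}. b k * \<bar>\<integral>y. \<phi> y \<partial>sphere_measure x (\<tau> k)\<bar>)"
      have "inner h (\<Sum>k\<in>{1..m}. unit_sphere_element x (\<tau> k))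
          = (\<Sum>k\<in>{1..m}. b k * (\<integral>y. \<phi> y \<partial>sphere_measure x (\<tau> k)))"
        unfolding inner_sum_right b_def by (intro sum.cong refl inner_unit_sphere_element dim h \<tau>)
      also have "\<dots> \<le> S" unfolding S_def by (intro sum_mono mult_left_mono b0) auto
      also have "S \<le> sqrt ((c * A * 8 * real m) * (norm h)\<^sup>2)"
      proof (rule real_le_rsqrt)
        have "S\<^sup>2 \<le> c * (\<Sum>k\<in>{1..m}. \<Sum>l\<in>{1..m}. b k * b l / max (\<tau> k) (\<tau> l) ^ (?n - 2)) * energy"
          unfolding S_def c_def by (intro weighted_sphere_averages b0 \<tau> dim) auto
        also have "\<dots> \<le> c * (A * (8 * real m)) * (norm h)\<^sup>2"
          by (rule mult_mono[OF mult_left_mono[OF Q] energy_le_norm[OF h]])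
             (use c A energy_nonneg in auto)
        finally show "S\<^sup>2 \<le> (c * A * 8 * real m) * (norm h)\<^sup>2" by (simp add: mult_ac)
      qed
      also have "\<dots> = sqrt (c * A * 8 * real m) * norm h" by (simp only: real_sqrt_mult real_sqrt_abs abs_norm_cancel)
      finally show "inner h (\<Sum>k\<in>{1..m}. unit_sphere_element x (\<tau> k)) \<le> sqrt (c * A * 8 * real m) * norm h" .
    qed (use c A in simp)
    then have "(norm (\<Sum>k\<in>{1..m}. unit_sphere_element x (\<tau> k)))\<^sup>2 \<le> (sqrt (c * A * 8 * real m))\<^sup>2"
      by (intro power_mono) auto
    then show ?thesis using c A by (simp add: \<tau>_def)
  qed
  show ?thesis by (rule exI[of _ "c * A * 8"]) (use main c A in auto)
qed

text \<open>The squared weight is of order t^(n-2) and the modulus of the unnormalised average of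
  order dist x y / t^(n-1); their product leaves dist x y / t.\<close>

lemma norm_diff_unit_sphere_elements:
  assumes dim: "DIM('a) > 2"
  shows "\<exists>C>0. \<forall>x y. \<forall>t\<in>{0<..1}.
    (norm (unit_sphere_element x t - unit_sphere_element y t))\<^sup>2 \<le> C * dist x y / t"
proof -
  let ?n = "DIM('a)" and ?V = "unit_ball_volume TYPE('a)"
  obtain A where A: "A > 0" and s: "\<And>t. t \<in> {0<..1} \<Longrightarrow> norm (sphere_element 0 t) > 0"
    and w: "\<And>t. t \<in> {0<..1} \<Longrightarrow> renorm_const (real ?n) t / norm (sphere_element 0 t) \<le> sqrt A * sqrt (t ^ (?n - 2))"
    using normalised_weight_bound[OF dim] by blast
  have V: "?V > 0" by (rule unit_ball_volume_pos)
  define c where "c = 9 / (?V * real ?n)"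
  have c: "c > 0" unfolding c_def using V dim by simp
  have main: "(norm (unit_sphere_element x t - unit_sphere_element y t))\<^sup>2 \<le> (A * c) * dist x y / t"
    if t: "t \<in> {0<..1}" for x y t
  proof -
    define b where "b = renorm_const (real ?n) t / norm (sphere_element 0 t)"
    have t0: "t > 0" using t by simp
    have b0: "b \<ge> 0" unfolding b_def using renorm_const_pos[of "real ?n" t] t0 dim by (intro divide_nonneg_nonneg) auto
    have "b\<^sup>2 \<le> (sqrt A * sqrt (t ^ (?n - 2)))\<^sup>2"
      unfolding b_def[symmetric] using b0 w[OF t] by (intro power_mono) (auto simp: b_def)
    then have b2: "b\<^sup>2 \<le> A * t ^ (?n - 2)" using A t0 by (simp add: power_mult_distrib)
    have "t ^ (?n - 1) = t ^ (?n - 2) * t"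
      using dim by (metis Suc_diff_Suc Suc_1 Suc_lessD power_Suc2)
    then have tt: "A * t ^ (?n - 2) * (dist x y / t ^ (?n - 1)) = A * dist x y / t" using t0 by simp
    have "norm (unit_sphere_element x t - unit_sphere_element y t) \<le> sqrt (A * c * dist x y / t)"
    proof (rule norm_le_represents)
      fix h \<phi> assume h: "represents h \<phi>"
      interpret compact_C1 \<phi> "grad \<phi>"
        using h by (intro test_function_compact_C1) (simp add: represents_def)
      define D where "D = (\<integral>z. \<phi> z \<partial>sphere_measure x t) - (\<integral>z. \<phi> z \<partial>sphere_measure y t)"
      have "inner h (unit_sphere_element x t - unit_sphere_element y t) = b * D"
        unfolding inner_diff_right inner_unit_sphere_element[OF dim t0 h] b_def D_def
        by (simp add: right_diff_distrib)
      also have "\<dots> \<le> sqrt ((A * c * dist x y / t) * (norm h)\<^sup>2)"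
      proof (rule real_le_rsqrt)
        have "(b * D)\<^sup>2 = b\<^sup>2 * D\<^sup>2" by (rule power_mult_distrib)
        also have "\<dots> \<le> (A * t ^ (?n - 2)) * (c * (dist x y / t ^ (?n - 1)) * energy)"
          unfolding D_def c_def using A t0 by (intro mult_mono b2 sphere_average_modulus) auto
        also have "\<dots> = c * (A * t ^ (?n - 2) * (dist x y / t ^ (?n - 1))) * energy" by (simp only: mult_ac)
        also have "\<dots> \<le> c * (A * t ^ (?n - 2) * (dist x y / t ^ (?n - 1))) * (norm h)\<^sup>2"
          using A c t0 by (intro mult_left_mono energy_le_norm h) auto
        also have "\<dots> = (A * c * dist x y / t) * (norm h)\<^sup>2" unfolding tt by simp
        finally show "(b * D)\<^sup>2 \<le> (A * c * dist x y / t) * (norm h)\<^sup>2" .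
      qed
      also have "\<dots> = sqrt (A * c * dist x y / t) * norm h" by (simp only: real_sqrt_mult real_sqrt_abs abs_norm_cancel)
      finally show "inner h (unit_sphere_element x t - unit_sphere_element y t) \<le> sqrt (A * c * dist x y / t) * norm h" .
    qed (use A c t0 in simp)
    then have "(norm (unit_sphere_element x t - unit_sphere_element y t))\<^sup>2 \<le> (sqrt (A * c * dist x y / t))\<^sup>2"
      by (intro power_mono) auto
    then show ?thesis using A c t0 by simp
  qed
  show ?thesis by (rule exI[of _ "A * c"]) (use main A c in auto)
qed

end


section \<open>Dyadic grids, summable tails and chaining\<close>

definition dyadic_grid :: "nat \<Rightarrow> 'a::euclidean_space set" where
  "dyadic_grid j = (\<lambda>f. \<Sum>i\<in>Basis. (real_of_int (f i) / 2 ^ j) *\<^sub>R i) `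
     (PiE Basis (\<lambda>_. {- (2 ^ j)..2 ^ j}))"

definition dyadic_floor :: "nat \<Rightarrow> 'a::euclidean_space \<Rightarrow> 'a" where
  "dyadic_floor j x = (\<Sum>i\<in>Basis. (real_of_int \<lfloor>2 ^ j * (x \<bullet> i)\<rfloor> / 2 ^ j) *\<^sub>R i)"

lemma finite_dyadic_grid: "finite (dyadic_grid j)"
  unfolding dyadic_grid_def by (intro finite_imageI finite_PiE) auto

lemma card_dyadic_grid: "real (card (dyadic_grid j :: 'a::euclidean_space set)) \<le> (4 * 2 ^ j) ^ DIM('a)"
proof -
  have "card (dyadic_grid j :: 'a set) \<le> card (PiE (Basis :: 'a set) (\<lambda>_. {- (2 ^ j)..2 ^ j :: int}))"
    unfolding dyadic_grid_def by (intro card_image_le finite_PiE) auto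
  also have "\<dots> = card {- (2 ^ j)..2 ^ j :: int} ^ DIM('a)" by (simp add: card_PiE)
  also have "card {- (2 ^ j)..2 ^ j :: int} = 2 * 2 ^ j + 1"
    by (simp add: nat_add_distrib nat_mult_distrib nat_power_eq)
  also have "(2 * 2 ^ j + 1 :: nat) \<le> 4 * 2 ^ j" by simp
  finally have "card (dyadic_grid j :: 'a set) \<le> (4 * 2 ^ j) ^ DIM('a)" by (simp add: power_mono)
  then have "real (card (dyadic_grid j :: 'a set)) \<le> real ((4 * 2 ^ j) ^ DIM('a))" by (rule of_nat_mono)
  then show ?thesis by simp
qed

lemma dyadic_floor_in_grid:
  assumes "x \<in> cbox (- One) (One :: 'a::euclidean_space)"
  shows "dyadic_floor j x \<in> dyadic_grid j"
proof -
  have "\<lfloor>2 ^ j * (x \<bullet> i)\<rfloor> \<in> {- (2 ^ j)..2 ^ j}" if i: "i \<in> Basis" for i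
  proof -
    have "- 1 \<le> x \<bullet> i" "x \<bullet> i \<le> 1" using assms i by (auto simp: mem_box)
    then have u: "real_of_int (- (2 ^ j)) \<le> 2 ^ j * (x \<bullet> i)" "2 ^ j * (x \<bullet> i) \<le> (2 ^ j :: real)"
      using mult_left_mono[of "- 1" "x \<bullet> i" "2 ^ j"] mult_left_mono[of "x \<bullet> i" 1 "2 ^ j"] by simp_all
    show ?thesis using floor_mono[OF u(1), unfolded floor_of_int] floor_mono[OF u(2)] by simp
  qed
  then have "(\<lambda>i\<in>Basis. \<lfloor>2 ^ j * (x \<bullet> i)\<rfloor>) \<in> PiE Basis (\<lambda>_. {- (2 ^ j)..2 ^ j})" by auto
  moreover have "dyadic_floor j x = (\<Sum>i\<in>Basis. (real_of_int ((\<lambda>i\<in>Basis. \<lfloor>2 ^ j * (x \<bullet> i)\<rfloor>) i) / 2 ^ j) *\<^sub>R i)"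
    unfolding dyadic_floor_def by (intro sum.cong) auto
  ultimately show ?thesis unfolding dyadic_grid_def by blast
qed

lemma dyadic_floor_real:
  "real_of_int \<lfloor>2 ^ j * s\<rfloor> / 2 ^ j \<le> s" "s - 1 / 2 ^ j \<le> real_of_int \<lfloor>2 ^ j * s\<rfloor> / 2 ^ j"
proof -
  show "real_of_int \<lfloor>2 ^ j * s\<rfloor> / 2 ^ j \<le> s"
    using of_int_floor_le[of "2 ^ j * s"] by (simp add: field_simps)
  have "2 ^ j * s - 1 \<le> real_of_int \<lfloor>2 ^ j * s\<rfloor>" by linarith
  then have "(2 ^ j * s - 1) / 2 ^ j \<le> real_of_int \<lfloor>2 ^ j * s\<rfloor> / 2 ^ j" by (intro divide_right_mono) auto
  then show "s - 1 / 2 ^ j \<le> real_of_int \<lfloor>2 ^ j * s\<rfloor> / 2 ^ j" by (simp add: diff_divide_distrib)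
qed

lemma norm_le_if_inner_le:
  fixes v :: "'a::euclidean_space"
  assumes "\<And>i. i \<in> Basis \<Longrightarrow> \<bar>v \<bullet> i\<bar> \<le> e"
  shows "norm v \<le> real DIM('a) * e"
  using norm_le_l1[of v] sum_mono[of Basis "\<lambda>i. \<bar>v \<bullet> i\<bar>" "\<lambda>_. e"] assms by simp

lemma inner_dyadic_floor: "i \<in> Basis \<Longrightarrow> dyadic_floor j x \<bullet> i = real_of_int \<lfloor>2 ^ j * (x \<bullet> i)\<rfloor> / 2 ^ j"
  by (simp add: dyadic_floor_def)

lemma dist_dyadic_floor: "dist (dyadic_floor j x) x \<le> real DIM('a) / 2 ^ j" for x :: "'a::euclidean_space"
proof -
  have "norm (dyadic_floor j x - x) \<le> real DIM('a) * (1 / 2 ^ j)"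
  proof (rule norm_le_if_inner_le)
    fix i :: 'a assume "i \<in> Basis"
    then show "\<bar>(dyadic_floor j x - x) \<bullet> i\<bar> \<le> 1 / 2 ^ j"
      using dyadic_floor_real[where j=j and s="x \<bullet> i"] by (simp add: inner_diff_left inner_dyadic_floor)
  qed
  then show ?thesis by (simp add: dist_norm)
qed

lemma dist_dyadic_floor_Suc:
  "dist (dyadic_floor j x) (dyadic_floor (Suc j) x) \<le> real DIM('a) / 2 ^ j" for x :: "'a::euclidean_space"
proof -
  have "norm (dyadic_floor j x - dyadic_floor (Suc j) x) \<le> real DIM('a) * (1 / 2 ^ j)"
  proof (rule norm_le_if_inner_le)
    fix i :: 'a assume "i \<in> Basis"
    moreover have "(1::real) / 2 ^ Suc j \<le> 1 / 2 ^ j" by (simp add: field_simps)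
    ultimately show "\<bar>(dyadic_floor j x - dyadic_floor (Suc j) x) \<bullet> i\<bar> \<le> 1 / 2 ^ j"
      using dyadic_floor_real[where j=j and s="x \<bullet> i"] dyadic_floor_real[where j="Suc j" and s="x \<bullet> i"]
      unfolding inner_diff_left by (simp only: inner_dyadic_floor)
  qed
  then show ?thesis by (simp add: dist_norm)
qed

lemma dyadic_floor_tendsto: "(\<lambda>j. dyadic_floor j x) \<longlonglongrightarrow> (x::'a::euclidean_space)"
proof (rule Lim_null_comparison[where g="\<lambda>j. real DIM('a) * (1/2) ^ j", THEN LIM_zero_cancel])
  show "\<forall>\<^sub>F j in sequentially. norm (dyadic_floor j x - x) \<le> real DIM('a) * (1/2) ^ j"
    using dist_dyadic_floor[of _ x] by (simp add: dist_norm power_one_over)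
  show "(\<lambda>j. real DIM('a) * (1/2) ^ j) \<longlonglongrightarrow> 0"
    by (intro tendsto_mult_right_zero LIMSEQ_power_zero) simp
qed

lemma exp_minus_le_power:
  assumes "u > 0" "p > 0"
  shows "exp (- u) \<le> (real p / u) ^ p"
proof -
  have "(u / real p) ^ p \<le> (1 + u / real p) ^ p" using assms by (intro power_mono) auto
  also have "\<dots> \<le> exp u"
    using assms by (intro exp_ge_one_plus_x_over_n_power_n) (auto intro: order_trans[of _ 0])
  finally have "inverse (exp u) \<le> inverse ((u / real p) ^ p)"
    using assms by (intro le_imp_inverse_le zero_less_power) auto
  also have "\<dots> = (real p / u) ^ p" using assms by (simp add: power_divide)
  finally show ?thesis by (simp add: exp_minus)
qed

text \<open>Doubly exponential decay beats every geometric growth: exp (- u) is at most a constant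
  times u^(-p), and p is taken so large that r^p exceeds 2 * K.\<close>

lemma summable_power_mult_exp_neg_power:
  fixes r K c C :: real
  assumes r: "r > 1" and K: "K > 0" and c: "c > 0" and C: "C \<ge> 0"
  shows "summable (\<lambda>j. C * K ^ j * exp (- (r ^ j / c)))"
proof -
  obtain p0 where p0: "2 * K < r ^ p0" using real_arch_pow[OF r] by blast
  define p where "p = Suc p0"
  have p: "2 * K < r ^ p" "p > 0"
    using p0 r order_less_le_trans[OF p0, of "r ^ Suc p0"] by (auto simp: p_def intro: power_increasing)
  have le: "C * K ^ j * exp (- (r ^ j / c)) \<le> C * (real p * c) ^ p * (1/2) ^ j" for j
  proof -
    have "exp (- (r ^ j / c)) \<le> (real p / (r ^ j / c)) ^ p"
      using r c p by (intro exp_minus_le_power) auto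
    also have "\<dots> = (real p * c) ^ p / (r ^ p) ^ j"
      by (simp add: power_divide power_mult[symmetric] mult.commute[of j])
    also have "\<dots> \<le> (real p * c) ^ p / (2 * K) ^ j"
      using p K c r by (intro divide_left_mono power_mono mult_pos_pos) auto
    finally have "K ^ j * exp (- (r ^ j / c)) \<le> K ^ j * ((real p * c) ^ p / (2 * K) ^ j)"
      using K by (intro mult_left_mono) auto
    also have "\<dots> = (real p * c) ^ p * (1/2) ^ j"
      using K by (simp add: power_mult_distrib power_one_over)
    finally show ?thesis using C by (simp add: mult.assoc mult_left_mono)
  qed
  show ?thesis
  proof (rule summable_comparison_test')
    show "summable (\<lambda>j. C * (real p * c) ^ p * (1/2) ^ j)" by (intro summable_mult summable_geometric) simp
    show "norm (C * K ^ j * exp (- (r ^ j / c))) \<le> C * (real p * c) ^ p * (1/2) ^ j" if "j \<ge> 0" for j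
      using le[of j] C K by simp
  qed
qed

lemma (in prob_space) prob_UN_le_card:
  assumes "finite I" "\<And>i. i \<in> I \<Longrightarrow> A i \<in> events" "\<And>i. i \<in> I \<Longrightarrow> prob (A i) \<le> c"
  shows "prob (\<Union>i\<in>I. A i) \<le> real (card I) * c"
proof -
  have "prob (\<Union>i\<in>I. A i) \<le> (\<Sum>i\<in>I. prob (A i))"
    using assms by (intro finite_measure_subadditive_finite) auto
  also have "\<dots> \<le> real (card I) * c" using sum_bounded_above[of I "\<lambda>i. prob (A i)" c] assms(3) by simp
  finally show ?thesis .
qed

text \<open>Chaining: the field number \<open>N\<close> is controlled on the dyadic grid of level \<open>4 * N\<close> by its tail
  and on all finer grids by its increments, whose variance \<open>c * 2 ^ N * dist x y\<close> is there already
  exponentially small.\<close>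

lemma (in prob_space) sup_bound_by_chaining:
  fixes S :: "nat \<Rightarrow> 'x::euclidean_space \<Rightarrow> 'a \<Rightarrow> real" and c d l :: real
  assumes meas[measurable]: "\<And>N x. S N x \<in> borel_measurable M"
    and cont: "\<And>N \<theta>. \<theta> \<in> space M \<Longrightarrow> continuous_on UNIV (\<lambda>x. S N x \<theta>)"
    and tail: "\<And>N x b. b > 0 \<Longrightarrow> prob {\<theta> \<in> space M. b \<le> S N x \<theta>} \<le> exp (- b\<^sup>2 / d)"
    and incr: "\<And>N x y v b. b > 0 \<Longrightarrow> v > 0 \<Longrightarrow> c * 2 ^ N * dist x y \<le> v \<Longrightarrow>
        prob {\<theta> \<in> space M. b \<le> \<bar>S N x \<theta> - S N y \<theta>\<bar>} \<le> 2 * exp (- b\<^sup>2 / v)"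
    and c: "c > 0" and d: "d > 0" and l: "l > 0" "4 * d * real (4 * DIM('x) + 1) \<le> l\<^sup>2"
  shows "AE \<theta> in M. \<forall>\<^sub>F N in sequentially. \<forall>x\<in>cbox (- One) One. S N x \<theta> < l * sqrt (real N)"
proof -
  let ?n = "DIM('x)"
  \<comment> \<open>The grid is allowed half of the final threshold; the other half is kept for the
    passage to the finer grids.\<close>
  define A where "A N = (\<Union>p\<in>dyadic_grid (4 * N). {\<theta> \<in> space M. l / 2 * sqrt (real N) \<le> S N p \<theta>})" for N
  define c' where "c' = c * real ?n"
  have c': "c' > 0" using c by (simp add: c'_def)
  \<comment> \<open>All fields with 4 * N <= j are collected in one event per level, so a single
    application of Borel-Cantelli in j controls the increments for all large N at once. There are
    only j + 1 such fields.\<close>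
  define I where "I j = {(N, p, q). 4 * N \<le> j \<and> p \<in> dyadic_grid j \<and> q \<in> dyadic_grid (Suc j)
      \<and> dist p (q::'x) \<le> real ?n / 2 ^ j}" for j :: nat
  \<comment> \<open>The ratio 9/10 has to give a convergent sum of increments, here 10, while its
    square 81/100 must exceed the decay rate 5/8 of the variance bound below; the quotient is
    162/125 > 1.\<close>
  define B where "B j = (\<Union>(N, p, q)\<in>I j. {\<theta> \<in> space M. (9/10) ^ j \<le> \<bar>S N p \<theta> - S N (q::'x) \<theta>\<bar>})" for j
  have "finite (I j)" and cardI: "card (I j) \<le> (j + 1) * (card (dyadic_grid j :: 'x set) * card (dyadic_grid (Suc j) :: 'x set))" for j
  proof -
    have sub: "I j \<subseteq> {..j} \<times> dyadic_grid j \<times> dyadic_grid (Suc j)" by (auto simp: I_def)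
    have fin: "finite ({..j} \<times> (dyadic_grid j :: 'x set) \<times> (dyadic_grid (Suc j) :: 'x set))"
      by (intro finite_cartesian_product finite_dyadic_grid) auto
    show "finite (I j)" by (rule finite_subset[OF sub fin])
    show "card (I j) \<le> (j + 1) * (card (dyadic_grid j :: 'x set) * card (dyadic_grid (Suc j) :: 'x set))"
      using card_mono[OF fin sub] by (simp add: card_cartesian_product)
  qed note finI = this(1)
  have A_sets: "A N \<in> events" for N
    unfolding A_def by (intro sets.finite_UN finite_dyadic_grid) measurable
  have B_sets: "B j \<in> events" for j
    unfolding B_def by (intro sets.finite_UN finI) (auto split: prod.splits)
  \<comment> \<open>The grid has at most 4^n * 2^(4 * n * N) points, and 2 <= exp 1. Of the exponent
    4 * n + 1 provided by the hypothesis on \<open>l\<close>, the part 4 * n pays for these points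
    and the 1 remains. For N = 0 the threshold is 0, where \<open>tail\<close> does not
    apply.\<close>
  have A_prob: "prob (A N) \<le> 4 ^ ?n * exp (- 1) ^ N" if N: "N \<ge> 1" for N
  proof -
    have "prob (A N) \<le> real (card (dyadic_grid (4 * N) :: 'x set)) * exp (- (l / 2 * sqrt (real N))\<^sup>2 / d)"
      unfolding A_def using N l by (intro prob_UN_le_card finite_dyadic_grid tail) auto
    also have "\<dots> \<le> (4 * 2 ^ (4 * N)) ^ ?n * exp (- (real (4 * ?n + 1) * real N))"
    proof (intro mult_mono card_dyadic_grid)
      have "real (4 * ?n + 1) * real N * d \<le> l\<^sup>2 / 4 * real N"
        using mult_right_mono[OF l(2), of "real N"] by (simp add: algebra_simps)
      then have "real (4 * ?n + 1) * real N \<le> (l / 2 * sqrt (real N))\<^sup>2 / d"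
        using d by (simp add: pos_le_divide_eq power_mult_distrib power_divide)
      then show "exp (- (l / 2 * sqrt (real N))\<^sup>2 / d) \<le> exp (- (real (4 * ?n + 1) * real N))" by simp
    qed auto
    also have "(4 * 2 ^ (4 * N)) ^ ?n = (4 ^ ?n :: real) * 2 ^ (4 * N * ?n)"
      by (simp add: power_mult_distrib power_mult[symmetric])
    also have "4 ^ ?n * 2 ^ (4 * N * ?n) * exp (- (real (4 * ?n + 1) * real N))
      \<le> 4 ^ ?n * exp 1 ^ (4 * N * ?n) * exp (- (real (4 * ?n + 1) * real N))"
      using exp_ge_add_one_self[of 1] by (intro mult_right_mono mult_left_mono power_mono) auto
    also have "\<dots> = 4 ^ ?n * exp (- 1) ^ N"
      by (simp add: exp_of_nat_mult[symmetric] exp_add[symmetric] mult.assoc) (simp add: algebra_simps)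
    finally show ?thesis .
  qed
  have "summable (\<lambda>N. prob (A N))"
  proof (rule summable_comparison_test')
    show "summable (\<lambda>N. 4 ^ ?n * exp (- 1 :: real) ^ N)" by (intro summable_mult summable_geometric) simp
  qed (use A_prob in auto)
  then have A_ev: "AE \<theta> in M. \<forall>\<^sub>F N in sequentially. \<theta> \<in> space M - A N"
    by (intro borel_cantelli_AE1 A_sets) (auto simp: emeasure_eq_measure)
  have B_prob: "prob (B j) \<le> 2 * 32 ^ ?n * (2 * 4 ^ ?n) ^ j * exp (- ((162/125) ^ j / c'))" for j
  proof -
    have "prob {\<theta> \<in> space M. (9/10) ^ j \<le> \<bar>S N p \<theta> - S N q \<theta>\<bar>} \<le> 2 * exp (- ((162/125) ^ j / c'))"
      if I: "(N, p, q) \<in> I j" for N p q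
    proof -
      \<comment> \<open>On the levels j >= 4 * N the factor 2^N is at most 2^(j/4), and 2 <= (5/4)^4
        = 625/256 replaces the fourth root by the rational 5/4. With the mesh factor 1 / 2^j the
        variance decays like (5/8)^j.\<close>
      have "((2::real) ^ N) ^ 4 = 2 ^ (4 * N)" by (simp add: power_mult[symmetric] mult.commute)
      also have "\<dots> \<le> 2 ^ j" using I by (intro power_increasing) (auto simp: I_def)
      also have "\<dots> \<le> (625/256) ^ j" by (intro power_mono) auto
      also have "(625/256::real) ^ j = ((5/4) ^ j) ^ 4"
        by (simp add: power_mult[symmetric] mult.commute[of j]) (simp add: power_mult power_numeral_reduce)
      finally have N: "(2::real) ^ N \<le> (5/4) ^ j" by (subst (asm) power_mono_iff) auto
      have "c * 2 ^ N * dist p q \<le> c * (5/4) ^ j * (real ?n / 2 ^ j)"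
        using c N I by (intro mult_mono) (auto simp: I_def)
      also have "\<dots> = c' * (5/8) ^ j" by (simp add: c'_def power_divide field_simps flip: power_mult_distrib)
      finally have "prob {\<theta> \<in> space M. (9/10) ^ j \<le> \<bar>S N p \<theta> - S N q \<theta>\<bar>}
          \<le> 2 * exp (- ((9/10) ^ j)\<^sup>2 / (c' * (5/8) ^ j))"
        using c' by (intro incr) auto
      also have "- ((9/10::real) ^ j)\<^sup>2 / (c' * (5/8) ^ j) = - ((162/125) ^ j / c')"
      proof -
        have "((9/10::real) ^ j)\<^sup>2 = (162/125) ^ j * (5/8) ^ j"
          by (simp add: power_mult[symmetric] mult.commute[of j] power_mult_distrib[symmetric])
             (simp add: power_mult power2_eq_square)
        then show ?thesis using c' by simp
      qed
      finally show ?thesis .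
    qed
    then have "prob (B j) \<le> real (card (I j)) * (2 * exp (- ((162/125) ^ j / c')))"
      unfolding B_def by (intro prob_UN_le_card finI) (auto split: prod.splits)
    also have "\<dots> \<le> (32 ^ ?n * (2 * 4 ^ ?n) ^ j) * (2 * exp (- ((162/125) ^ j / c')))"
    proof (intro mult_right_mono)
      have "real (card (I j)) \<le> real (j + 1) * (real (card (dyadic_grid j :: 'x set)) * real (card (dyadic_grid (Suc j) :: 'x set)))"
        using of_nat_mono[OF cardI[of j], where 'a=real] by (simp only: of_nat_mult)
      also have "\<dots> \<le> 2 ^ j * ((4 * 2 ^ j) ^ ?n * (4 * 2 ^ Suc j) ^ ?n)"
      proof (intro mult_mono card_dyadic_grid)
        have "j + 1 \<le> 2 ^ j" by (induction j) auto
        then show "real (j + 1) \<le> 2 ^ j" by (metis of_nat_le_iff of_nat_numeral of_nat_power)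
      qed auto
      also have "\<dots> = 32 ^ ?n * (2 * 4 ^ ?n) ^ j"
      proof -
        have "(4 * 2 ^ j) ^ ?n * (4 * 2 ^ Suc j) ^ ?n = ((4 * 2 ^ j) * (4 * 2 ^ Suc j) :: real) ^ ?n"
          by (rule power_mult_distrib[symmetric])
        also have "(4 * 2 ^ j) * (4 * 2 ^ Suc j) = 32 * ((2::real) ^ j * 2 ^ j)" by simp
        also have "(2::real) ^ j * 2 ^ j = (2 * 2) ^ j" by (rule power_mult_distrib[symmetric])
        also have "(32 * (2 * 2 :: real) ^ j) ^ ?n = 32 ^ ?n * ((2 * 2) ^ ?n) ^ j"
          by (simp only: power_mult_distrib[of 32] power_mult[symmetric] mult.commute[of j])
        finally show ?thesis by (simp add: power_mult_distrib)
      qed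
      finally show "real (card (I j)) \<le> 32 ^ ?n * (2 * 4 ^ ?n) ^ j" .
    qed auto
    finally show ?thesis by (simp add: mult_ac)
  qed
  have "summable (\<lambda>j. prob (B j))"
  proof (rule summable_comparison_test')
    show "summable (\<lambda>j. 2 * 32 ^ ?n * (2 * 4 ^ ?n) ^ j * exp (- ((162/125::real) ^ j / c')))"
      using c' by (intro summable_power_mult_exp_neg_power) auto
  qed (use B_prob in auto)
  then have B_ev: "AE \<theta> in M. \<forall>\<^sub>F j in sequentially. \<theta> \<in> space M - B j"
    by (intro borel_cantelli_AE1 B_sets) (auto simp: emeasure_eq_measure)
  \<comment> \<open>The chain adds at most 10 to the value on the grid, which has to fit into the
    remaining l / 2 * sqrt N.\<close>
  have large: "\<forall>\<^sub>F N in sequentially. 20 / l < sqrt (real N)"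
    by (rule filterlim_at_top_dense[THEN iffD1, rule_format])
       (intro filterlim_compose[OF sqrt_at_top] filterlim_real_sequentially)
  show ?thesis
    using A_ev B_ev
  proof eventually_elim
    case (elim \<theta>)
    from elim(2) obtain j0 where j0: "\<And>j. j \<ge> j0 \<Longrightarrow> \<theta> \<in> space M - B j"
      by (auto simp: eventually_sequentially)
    show ?case
      using elim(1) large eventually_ge_at_top[of j0]
    proof eventually_elim
      case (elim N)
      show ?case
      proof
        fix x :: 'x assume x: "x \<in> cbox (- One) One"
        define s where "s i = S N (dyadic_floor (4 * N + i) x) \<theta>" for i
        have "s 0 < l / 2 * sqrt (real N)"
          using elim(1) dyadic_floor_in_grid[OF x, of "4 * N"] by (force simp: A_def s_def)
        moreover have step: "s (Suc i) \<le> s i + (9/10) ^ i" for i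
        proof -
          have "\<theta> \<in> space M - B (4 * N + i)" using elim by (intro j0) auto
          moreover have "(N, dyadic_floor (4 * N + i) x, dyadic_floor (Suc (4 * N + i)) x) \<in> I (4 * N + i)"
            using dyadic_floor_in_grid[OF x] dist_dyadic_floor_Suc by (auto simp: I_def)
          ultimately have "\<bar>s i - s (Suc i)\<bar> < (9/10) ^ (4 * N + i)"
            by (force simp: B_def s_def)
          also have "\<dots> \<le> (9/10) ^ i" by (intro power_decreasing) auto
          finally show ?thesis by linarith
        qed
        have "s i \<le> s 0 + (\<Sum>k<i. (9/10) ^ k)" for i
        proof (induction i)
          case (Suc i)
          then show ?case using step[of i] by simp
        qed simp
        moreover have "(\<Sum>k<i. (9/10::real) ^ k) \<le> 10" for i
        proof -
          have "(\<Sum>k<i. (9/10::real) ^ k) \<le> (\<Sum>k. (9/10) ^ k)"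
            by (intro sum_le_suminf summable_geometric) auto
          also have "\<dots> = 10" by (subst suminf_geometric) auto
          finally show ?thesis .
        qed
        ultimately have "s i \<le> s 0 + 10" for i by (smt (verit))
        moreover have "s \<longlonglongrightarrow> S N x \<theta>"
        proof -
          have "isCont (\<lambda>x. S N x \<theta>) x"
            using cont[of \<theta> N] elim(1) by (simp add: continuous_on_eq_continuous_at)
          moreover have "(\<lambda>i. dyadic_floor (4 * N + i) x) \<longlonglongrightarrow> x"
            using LIMSEQ_ignore_initial_segment[OF dyadic_floor_tendsto[of x], of "4 * N"] by (simp add: add.commute)
          ultimately show ?thesis unfolding s_def by (rule isCont_tendsto_compose)
        qed
        ultimately have "S N x \<theta> \<le> s 0 + 10" by (intro LIMSEQ_le_const2[of s]) auto
        moreover have "20 < l * sqrt (real N)" using elim(2) l by (simp add: pos_divide_less_eq mult.commute)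
        ultimately show "S N x \<theta> < l * sqrt (real N)" using \<open>s 0 < l / 2 * sqrt (real N)\<close> by simp
      qed
    qed
  qed
qed


section \<open>Sums over scales and the exclusion of thick points\<close>

lemma paley_wiener_sum:
  assumes PW: "paley_wiener_map W emb PW" and "finite K"
  shows "AE \<theta> in W. PW (\<Sum>k\<in>K. a k *\<^sub>R h k) \<theta> = (\<Sum>k\<in>K. a k * PW (h k) \<theta>)"
  using \<open>finite K\<close>
proof (induction K)
  case empty
  have "AE \<theta> in W. PW (0 *\<^sub>R 0 + 0 *\<^sub>R 0) \<theta> = 0 * PW 0 \<theta> + 0 * PW 0 \<theta>"
    using PW unfolding paley_wiener_map_def by blast
  then show ?case by simp
next
  case (insert k K)
  have "AE \<theta> in W. PW (a k *\<^sub>R h k + 1 *\<^sub>R (\<Sum>k\<in>K. a k *\<^sub>R h k)) \<theta>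
      = a k * PW (h k) \<theta> + 1 * PW (\<Sum>k\<in>K. a k *\<^sub>R h k) \<theta>"
    using PW unfolding paley_wiener_map_def by blast
  with insert.IH show ?case by eventually_elim (use insert.hyps in simp)
qed

text \<open>The 64 is 4 * 16: the 16 of \<open>paley_wiener_tail\<close> and the 4 from evaluating
  the tail at half of the threshold on the grid. \<open>B\<close> is chosen before \<open>m\<close>,
  so that the condition on \<open>l\<close> can later be met by taking \<open>m\<close>
  large.\<close>

lemma (in gaussian_free_field) scale_sum_bound:
  assumes dim: "DIM('a) > 2" and PW: "paley_wiener_map W emb PW"
    and avg: "spherical_averages rep W PW avg"
  shows "\<exists>B>0. \<forall>m\<ge>1. \<forall>l>0. 64 * B * real m * real (4 * DIM('a) + 1) \<le> l\<^sup>2 \<longrightarrow>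
    (AE \<theta> in W. \<forall>\<^sub>F N in sequentially. \<forall>x\<in>cbox (- One) One.
       (\<Sum>k\<in>{1..m}. avg x ((1/2) ^ (N + k)) \<theta> / sqrt (avg_variance W avg ((1/2) ^ (N + k)))) < l * sqrt (real N))"
proof -
  obtain B where B: "B > 0"
    "\<And>x N m. (norm (\<Sum>k\<in>{1..m}. unit_sphere_element x ((1/2) ^ (N + k))))\<^sup>2 \<le> B * real m"
    using norm_sum_unit_sphere_elements[OF dim] by blast
  obtain C where C: "C > 0" "\<And>x y t. t \<in> {0<..1} \<Longrightarrow>
    (norm (unit_sphere_element x t - unit_sphere_element y t))\<^sup>2 \<le> C * dist x y / t"
    using norm_diff_unit_sphere_elements[OF dim] by blast
  have avg_meas: "avg x t \<in> borel_measurable W"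
    and avg_PW: "AE \<theta> in W. avg x t \<theta> = PW (sphere_element x t) \<theta>" if "t \<in> {0<..1}" for x t
    using avg that unfolding spherical_averages_def sphere_element_def by blast+
  have avg_cont: "continuous_on (UNIV \<times> {0<..1}) (\<lambda>(x, t). avg x t \<theta>)" for \<theta>
    using avg unfolding spherical_averages_def by blast
  have PW_meas: "PW h \<in> borel_measurable W" for h using PW unfolding paley_wiener_map_def by blast
  \<comment> \<open>The isometry turns the variance into a norm in H, so dividing by the standard
    deviation yields exactly \<open>unit_sphere_element\<close>.\<close>
  have var: "sqrt (avg_variance W avg t) = norm (sphere_element 0 t)" if t: "t \<in> {0<..1}" for t
  proof -
    have "avg_variance W avg t = (\<integral>\<theta>. (PW (sphere_element 0 t) \<theta>)\<^sup>2 \<partial>W)"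
      unfolding avg_variance_def
    proof (rule integral_cong_AE)
      show "AE \<theta> in W. (avg 0 t \<theta>)\<^sup>2 = (PW (sphere_element 0 t) \<theta>)\<^sup>2"
        using avg_PW[OF t, of 0] by eventually_elim simp
    qed (intro borel_measurable_power avg_meas t PW_meas)+
    also have "\<dots> = (norm (sphere_element 0 t))\<^sup>2"
      using PW unfolding paley_wiener_map_def by blast
    finally show ?thesis by simp
  qed
  show ?thesis
  proof (intro exI[of _ B] conjI allI impI B(1))
    fix m :: nat and l :: real
    assume m: "1 \<le> m" and l: "0 < l" "64 * B * real m * real (4 * DIM('a) + 1) \<le> l\<^sup>2"
    define \<tau> where "\<tau> N k = (1/2::real) ^ (N + k)" for N k :: nat
    have \<tau>: "\<tau> N k \<in> {0<..1}" for N k by (auto simp: \<tau>_def power_le_one)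
    define S where "S N x \<theta> = (\<Sum>k\<in>{1..m}. avg x (\<tau> N k) \<theta> / sqrt (avg_variance W avg (\<tau> N k)))" for N x \<theta>
    define u where "u N x = (\<Sum>k\<in>{1..m}. unit_sphere_element x (\<tau> N k))" for N x
    have S_PW: "AE \<theta> in W. S N x \<theta> = PW (u N x) \<theta>" for N x
    proof -
      have "AE \<theta> in W. \<forall>k\<in>{1..m}. avg x (\<tau> N k) \<theta> = PW (sphere_element x (\<tau> N k)) \<theta>"
        by (intro AE_finite_allI avg_PW \<tau>) auto
      moreover have "AE \<theta> in W. PW (u N x) \<theta>
          = (\<Sum>k\<in>{1..m}. 1 / norm (sphere_element 0 (\<tau> N k)) * PW (sphere_element x (\<tau> N k)) \<theta>)"
        unfolding u_def unit_sphere_element_def by (intro paley_wiener_sum[OF PW]) auto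
      ultimately show ?thesis by eventually_elim (simp add: S_def var[OF \<tau>])
    qed
    have S_meas[measurable]: "S N x \<in> borel_measurable W" for N x
      unfolding S_def by (intro borel_measurable_sum borel_measurable_divide avg_meas \<tau>) auto
    \<comment> \<open>The factor m^2 comes from the triangle inequality over the scales, 2^m from
      the smallest radius 2^(-(N+m)), and 16 from the tail bound. It may grow with m, since m is
      fixed while N tends to infinity.\<close>
    define c where "c = 16 * (real m)\<^sup>2 * C * 2 ^ m"
    have c: "c > 0" unfolding c_def using m C by simp
    have u_diff: "16 * (norm (u N x - u N y))\<^sup>2 \<le> c * 2 ^ N * dist x y" for N x y
    proof -
      have "norm (u N x - u N y) \<le> (\<Sum>k\<in>{1..m}. norm (unit_sphere_element x (\<tau> N k) - unit_sphere_element y (\<tau> N k)))"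
        unfolding u_def sum_subtractf[symmetric] by (rule norm_sum)
      also have "\<dots> \<le> (\<Sum>k\<in>{1..m}. sqrt (C * dist x y * 2 ^ (N + m)))"
      proof (rule sum_mono, rule real_le_rsqrt)
        fix k assume k: "k \<in> {1..m}"
        have "(norm (unit_sphere_element x (\<tau> N k) - unit_sphere_element y (\<tau> N k)))\<^sup>2 \<le> C * dist x y / \<tau> N k"
          by (rule C(2)[OF \<tau>])
        also have "\<dots> = C * dist x y * 2 ^ (N + k)" by (simp add: \<tau>_def power_divide)
        also have "\<dots> \<le> C * dist x y * 2 ^ (N + m)"
          using C(1) k by (intro mult_left_mono power_increasing) auto
        finally show "(norm (unit_sphere_element x (\<tau> N k) - unit_sphere_element y (\<tau> N k)))\<^sup>2 \<le> C * dist x y * 2 ^ (N + m)" .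
      qed
      also have "\<dots> = real m * sqrt (C * dist x y * 2 ^ (N + m))" by simp
      finally have "(norm (u N x - u N y))\<^sup>2 \<le> (real m * sqrt (C * dist x y * 2 ^ (N + m)))\<^sup>2"
        by (intro power_mono) auto
      also have "\<dots> = (real m)\<^sup>2 * (C * dist x y * 2 ^ (N + m))" using C(1) by (simp add: power_mult_distrib)
      finally show ?thesis unfolding c_def by (simp add: power_add mult_ac)
    qed
    have "AE \<theta> in W. \<forall>\<^sub>F N in sequentially. \<forall>x\<in>cbox (- One) One. S N x \<theta> < l * sqrt (real N)"
    proof (rule sup_bound_by_chaining[where c=c and d="16 * (B * real m)"])
      show "S N x \<in> borel_measurable W" for N x by (rule S_meas)
      show "continuous_on UNIV (\<lambda>x. S N x \<theta>)" for N \<theta>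
      proof -
        have "continuous_on UNIV (\<lambda>x. avg x (\<tau> N k) \<theta>)" for k
        proof -
          have "continuous_on UNIV (\<lambda>x. case (x, \<tau> N k) of (x, t) \<Rightarrow> avg x t \<theta>)"
            by (rule continuous_on_compose2[OF avg_cont]) (use \<tau>[of N k] in \<open>auto intro!: continuous_intros\<close>)
          then show ?thesis by simp
        qed
        then show ?thesis
          unfolding S_def divide_inverse by (intro continuous_on_sum continuous_on_mult_right)
      qed
      show "prob {\<theta> \<in> space W. b \<le> S N x \<theta>} \<le> exp (- b\<^sup>2 / (16 * (B * real m)))" if b: "b > 0" for N x b
      proof -
        have "prob {\<theta> \<in> space W. b \<le> S N x \<theta>} = prob {\<theta> \<in> space W. b \<le> PW (u N x) \<theta>}"
          using S_PW[of N x] S_meas[of N x] PW_meas[of "u N x"]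
          by (intro finite_measure_eq_AE) (auto elim: eventually_mono)
        also have "\<dots> \<le> exp (- b\<^sup>2 / (16 * (B * real m)))"
          using B m b by (intro paley_wiener_tail[OF PW]) (auto simp: u_def \<tau>_def)
        finally show ?thesis .
      qed
      show "prob {\<theta> \<in> space W. b \<le> \<bar>S N x \<theta> - S N y \<theta>\<bar>} \<le> 2 * exp (- b\<^sup>2 / v)"
        if b: "b > 0" and v: "v > 0" "c * 2 ^ N * dist x y \<le> v" for N x y v b
      proof -
        have one: "prob {\<theta> \<in> space W. b \<le> S N x \<theta> - S N y \<theta>} \<le> exp (- b\<^sup>2 / v)"
          if "c * 2 ^ N * dist x y \<le> v" for x y
        proof -
          have "prob {\<theta> \<in> space W. b \<le> S N x \<theta> - S N y \<theta>} = prob {\<theta> \<in> space W. b \<le> PW (u N x - u N y) \<theta>}"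
          proof (rule finite_measure_eq_AE)
            show "AE \<theta> in W. (\<theta> \<in> {\<theta> \<in> space W. b \<le> S N x \<theta> - S N y \<theta>})
                = (\<theta> \<in> {\<theta> \<in> space W. b \<le> PW (u N x - u N y) \<theta>})"
              using S_PW[of N x] S_PW[of N y] paley_wiener_diff[OF PW, of "u N x" "u N y"]
              by eventually_elim simp
          qed (use S_meas PW_meas in measurable)
          \<comment> \<open>The positive bound v / 16 stands in for the variance, which is 0 when
            the two points coincide.\<close>
          also have "\<dots> \<le> exp (- b\<^sup>2 / (16 * (v / 16)))"
            using b v(1) u_diff[of N x y] that by (intro paley_wiener_tail[OF PW]) auto
          finally show ?thesis by simp
        qed
        have "prob {\<theta> \<in> space W. b \<le> \<bar>S N x \<theta> - S N y \<theta>\<bar>}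
          \<le> prob ({\<theta> \<in> space W. b \<le> S N x \<theta> - S N y \<theta>} \<union> {\<theta> \<in> space W. b \<le> S N y \<theta> - S N x \<theta>})"
          by (intro finite_measure_mono) (auto intro!: sets.Un)
        also have "\<dots> \<le> prob {\<theta> \<in> space W. b \<le> S N x \<theta> - S N y \<theta>} + prob {\<theta> \<in> space W. b \<le> S N y \<theta> - S N x \<theta>}"
          by (intro measure_Un_le) measurable
        also have "\<dots> \<le> 2 * exp (- b\<^sup>2 / v)"
          using one[of x y] one[of y x] v(2) by (simp add: dist_commute)
        finally show ?thesis .
      qed
      show "4 * (16 * (B * real m)) * real (4 * DIM('a) + 1) \<le> l\<^sup>2" using l(2) by (simp add: mult_ac)
    qed (use c l B m in auto)
    then show "AE \<theta> in W. \<forall>\<^sub>F N in sequentially. \<forall>x\<in>cbox (- One) One.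
       (\<Sum>k\<in>{1..m}. avg x ((1/2) ^ (N + k)) \<theta> / sqrt (avg_variance W avg ((1/2) ^ (N + k)))) < l * sqrt (real N)"
      by (simp add: S_def \<tau>_def)
  qed
qed

theorem theorem13:
  fixes rep :: "'h::{real_inner, complete_space} \<Rightarrow> real ^ 'n \<Rightarrow> real"
    and W :: "'b::{banach, second_countable_topology} measure"
    and emb :: "'h \<Rightarrow> 'b"
    and pairing :: "'b \<Rightarrow> (real ^ 'n \<Rightarrow> real) \<Rightarrow> real"
    and PW :: "'h \<Rightarrow> 'b \<Rightarrow> real"
    and avg :: "real ^ 'n \<Rightarrow> real \<Rightarrow> 'b \<Rightarrow> real"
    and \<gamma> :: real
  assumes "CARD('n) > 2"
    and "gaussian_free_field rep W emb pairing"
    and "paley_wiener_map W emb PW"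
    and "spherical_averages rep W PW avg"
    and "\<gamma> > 0"
  shows "AE \<theta> in W. perfect_thick_points W avg \<gamma> \<theta> = {}"
proof -
  interpret gaussian_free_field rep W emb pairing by fact
  let ?n = "DIM(real ^ 'n)"
  have dim: "?n > 2" using assms(1) by simp
  define a where "a = sqrt (2 * real ?n * \<gamma>)"
  have a: "a > 0" unfolding a_def using assms(5) dim by simp
  obtain B where B: "B > 0" and main: "\<And>m l. m \<ge> 1 \<Longrightarrow> l > 0 \<Longrightarrow> 64 * B * real m * real (4 * ?n + 1) \<le> l\<^sup>2 \<Longrightarrow>
    (AE \<theta> in W. \<forall>\<^sub>F N in sequentially. \<forall>x\<in>cbox (- One) One.
       (\<Sum>k\<in>{1..m}. avg x ((1/2) ^ (N + k)) \<theta> / sqrt (avg_variance W avg ((1/2) ^ (N + k)))) < l * sqrt (real N))"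
    using scale_sum_bound[OF dim assms(3,4)] by blast
  \<comment> \<open>At a thick point the quotient eventually exceeds half of its limit a, and at t =
    2^(-N-k) one has - ln t >= N * ln 2; together they give q * sqrt N for each scale.\<close>
  define q where "q = a / 2 * sqrt (ln 2)"
  have q: "q > 0" unfolding q_def using a by simp
  \<comment> \<open>With l = m * q the right side of the condition in \<open>scale_sum_bound\<close>
    is quadratic in m and the left side linear, so a large m satisfies it for every q > 0, hence for
    every \<gamma> > 0.\<close>
  obtain m0 :: nat where m0: "64 * B * real (4 * ?n + 1) / q\<^sup>2 < real m0"
    using reals_Archimedean2 by blast
  define m where "m = Suc m0"
  have m: "m \<ge> 1" by (simp add: m_def)
  have "64 * B * real (4 * ?n + 1) / q\<^sup>2 \<le> real m" using m0 by (simp add: m_def)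
  then have m': "64 * B * real (4 * ?n + 1) \<le> real m * q\<^sup>2" using q by (simp only: pos_divide_le_eq zero_less_power)
  have l: "real m * q > 0" using m q by simp
  have "64 * B * real m * real (4 * ?n + 1) \<le> (real m * q)\<^sup>2"
    using mult_left_mono[OF m', of "real m"] by (simp add: power_mult_distrib power2_eq_square mult_ac)
  from main[OF m l this] show ?thesis
  proof eventually_elim
    case (elim \<theta>)
    show "perfect_thick_points W avg \<gamma> \<theta> = {}"
    proof (rule ccontr)
      assume "perfect_thick_points W avg \<gamma> \<theta> \<noteq> {}"
      then obtain x where x: "x \<in> cbox (- One) One"
        and lim: "((\<lambda>t. avg x t \<theta> / sqrt (- avg_variance W avg t * ln t)) \<longlongrightarrow> a) (at_right 0)"
        unfolding perfect_thick_points_def a_def by blast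
      have "\<forall>\<^sub>F t in at_right 0. a / 2 < avg x t \<theta> / sqrt (- avg_variance W avg t * ln t)"
        using a by (intro order_tendstoD(1)[OF lim]) simp
      then obtain e where e: "e > 0"
        "\<And>t. 0 < t \<Longrightarrow> t < e \<Longrightarrow> a / 2 < avg x t \<theta> / sqrt (- avg_variance W avg t * ln t)"
        unfolding eventually_at_right_field by blast
      have "(\<lambda>N. (1/2::real) ^ N) \<longlonglongrightarrow> 0" by (intro LIMSEQ_power_zero) simp
      then have "\<forall>\<^sub>F N in sequentially. (1/2::real) ^ N < e" using e(1) by (rule order_tendstoD(2))
      with elim eventually_ge_at_top[of 1] have "\<forall>\<^sub>F N in sequentially. False"
      proof eventually_elim
        case (elim N)
        have "q * sqrt (real N) \<le> avg x ((1/2) ^ (N + k)) \<theta> / sqrt (avg_variance W avg ((1/2) ^ (N + k)))"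
          for k :: nat
        proof -
          define t where "t = (1/2::real) ^ (N + k)"
          have "t \<le> (1/2) ^ N" unfolding t_def by (intro power_decreasing) auto
          then have t: "t < e" using elim by linarith
          have t0: "0 < t" by (simp add: t_def)
          have ln: "- ln t = real (N + k) * ln 2"
            unfolding t_def by (subst ln_realpow) (auto simp: ln_div)
          \<comment> \<open>Uses N >= 1: for t = 1 the logarithm would vanish and its root could not
            be moved to the other side.\<close>
          have pos: "- ln t > 0" unfolding ln using elim by simp
          have "a / 2 < avg x t \<theta> / (sqrt (avg_variance W avg t) * sqrt (- ln t))"
            using e(2)[OF t0 t] by (simp flip: real_sqrt_mult)
          then have "a / 2 * sqrt (- ln t) < avg x t \<theta> / sqrt (avg_variance W avg t)"
            using pos by (simp add: pos_less_divide_eq flip: divide_divide_eq_left)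
          moreover have "q * sqrt (real N) \<le> a / 2 * sqrt (- ln t)"
          proof -
            have "q * sqrt (real N) = a / 2 * sqrt (real N * ln 2)"
              unfolding q_def by (simp add: real_sqrt_mult)
            also have "\<dots> \<le> a / 2 * sqrt (- ln t)"
              using a unfolding ln by (intro mult_left_mono real_sqrt_le_mono mult_right_mono) auto
            finally show ?thesis .
          qed
          ultimately have "q * sqrt (real N) \<le> avg x t \<theta> / sqrt (avg_variance W avg t)" by linarith
          then show ?thesis unfolding t_def .
        qed
        then have "(\<Sum>k\<in>{1..m}. q * sqrt (real N))
          \<le> (\<Sum>k\<in>{1..m}. avg x ((1/2) ^ (N + k)) \<theta> / sqrt (avg_variance W avg ((1/2) ^ (N + k))))"
          by (intro sum_mono)
        moreover have "(\<Sum>k\<in>{1..m}. avg x ((1/2) ^ (N + k)) \<theta> / sqrt (avg_variance W avg ((1/2) ^ (N + k))))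
          < real m * q * sqrt (real N)" using elim x by blast
        ultimately show False by (simp add: mult.assoc)
      qed
      then show False by simp
    qed
  qed
qed

end
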